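(* Let $E$ be an infinite-dimensional real separable Hilbert space and let $\mathcal E$ be an orthonormal basis of $E$. Then there does not exist a unitary transformation $\mathcal F$ of the space $\mathcal H_{\mathcal E}$ onto itself which, for every choice of a non-negative nuclear operator $D$ on $E$ with basis of eigenvectors $\mathcal E$, implements the unitary equivalence of the semigroups $\mathcal U_{tD}$, $t\ge0$, and $\widehat{\mathcal U}_{tD}$, $t\ge0$, i.e. such that $\mathcal U_{tD}=\mathcal F\,\widehat{\mathcal U}_{tD}\,\mathcal F^{-1}$ for all $t\ge0$ and all such $D$.
   Context: Let $\mathcal E=\{e_k\}_{k\in\mathbb N}$, $x_k=(x,e_k)$. A block is a set $\Pi_{a,b}=\{x\in E: x_j\in[a_j,b_j)\ \forall j\}$ with $a,b\in\ell_\infty$, $a_j<b_j$; it is absolutely measurable if it is empty or $\sum_j\max\{0,\ln(b_j-a_j)\}<\infty$. Put $\lambda_{\mathcal E}(\Pi_{a,b})=\prod_j(b_j-a_j)$ if $\Pi_{a,b}\ne\emptyset$ (value $0$ if the product diverges to $0$), and $\lambda_{\mathcal E}(\emptyset)=0$. It is known that $\lambda_{\mathcal E}$ extends uniquely to a finitely additive shift-invariant measure on the ring generated by absolutely measurable blocks, and then to the completion $\mathcal R_{\mathcal E}$ of this ring. $\mathcal H_{\mathcal E}$ is the complex Hilbert space obtained by completing (modulo the null space) the space of finite sums $\sum c_k\chi_{B_k}$, $c_k\in\mathbb C$, $B_k\in\mathcal R_{\mathcal E}$ pairwise disjoint, in the norm $(\sum|c_k|^2\lambda_{\mathcal E}(B_k))^{1/2}$.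 For $h\in E$, $S_hf(x)=f(x-h)$ (unitary on $\mathcal H_{\mathcal E}$). For a nuclear operator $D\ge0$ with $De_k=d_ke_k$ ($\sum d_k<\infty$): $\mathcal U_{tD}f=\int_ES_hf\,d\nu_{tD}(h)$ (Pettis integral), where $\nu_{tD}$ is the centered Gaussian measure on $E$ with covariance operator $tD$, i.e. with Fourier transform $\exp(-\frac t2(D\xi,\xi))$; $\widehat{\mathcal U}_{tD}$ is the strong limit as $N\to\infty$ of the operators of multiplication by $\exp(-\frac t2\sum_{k\le N}d_kx_k^2)$ on $\mathcal H_{\mathcal E}$ (this limit exists for every nuclear $D\ge0$). *)

theory Defs
  imports "HOL-Probability.Probability"
begin

text \<open>
  Throughout, \<open>e\<close> is a sequence in a real Hilbert space; the space, the ring, the measure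
  and the operators below all depend on it, hence the leading parameter \<open>e\<close>.
  An orthonormal basis indexed by \<^typ>\<open>nat\<close> makes the space infinite-dimensional, and the
  coordinates are \<open>x \<bullet> e j\<close>.
\<close>

definition orthonormal_basis :: "(nat \<Rightarrow> 'e::real_inner) \<Rightarrow> bool" where
  "orthonormal_basis e \<longleftrightarrow>
     (\<forall>i j. e i \<bullet> e j = (if i = j then 1 else 0)) \<and> closure (span (range e)) = UNIV"

section \<open>Blocks, the generated ring, and its finitely additive measure\<close>

definition block :: "(nat \<Rightarrow> 'e::real_inner) \<Rightarrow> (nat \<Rightarrow> real) \<Rightarrow> (nat \<Rightarrow> real) \<Rightarrow> 'e set" where
  "block e a b = {x. \<forall>j. a j \<le> x \<bullet> e j \<and> x \<bullet> e j < b j}"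

definition block_bounds :: "(nat \<Rightarrow> real) \<Rightarrow> (nat \<Rightarrow> real) \<Rightarrow> bool" where
  "block_bounds a b \<longleftrightarrow> bounded (range a) \<and> bounded (range b) \<and> (\<forall>j. a j < b j)"

definition abs_measurable :: "(nat \<Rightarrow> 'e::real_inner) \<Rightarrow> (nat \<Rightarrow> real) \<Rightarrow> (nat \<Rightarrow> real) \<Rightarrow> bool" where
  "abs_measurable e a b \<longleftrightarrow>
     block_bounds a b \<and> (block e a b = {} \<or> summable (\<lambda>j. max 0 (ln (b j - a j))))"

definition am_blocks :: "(nat \<Rightarrow> 'e::real_inner) \<Rightarrow> 'e set set" where
  "am_blocks e = {block e a b | a b. abs_measurable e a b}"

definition block_ring :: "(nat \<Rightarrow> 'e::real_inner) \<Rightarrow> 'e set set" where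
  "block_ring e = ring_of_sets UNIV hull am_blocks e"

text \<open>
  The infinite product is the limit of its partial products, which is \<open>0\<close> when the product
  diverges to \<open>0\<close>; the library's \<^const>\<open>prodinf\<close> leaves that case unspecified.
\<close>

definition is_block_measure :: "(nat \<Rightarrow> 'e::real_inner) \<Rightarrow> ('e set \<Rightarrow> real) \<Rightarrow> bool" where
  "is_block_measure e \<mu> \<longleftrightarrow>
     (\<forall>A\<in>block_ring e. 0 \<le> \<mu> A) \<and>
     additive (block_ring e) \<mu> \<and>
     (\<forall>A\<in>block_ring e. \<forall>h. \<mu> ((\<lambda>x. x + h) ` A) = \<mu> A) \<and>
     \<mu> {} = 0 \<and>
     (\<forall>a b. abs_measurable e a b \<longrightarrow> block e a b \<noteq> {} \<longrightarrow>
        \<mu> (block e a b) = lim (\<lambda>n. \<Prod>j<n. b j - a j))"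

text \<open>
  Such a measure exists and its restriction to \<open>block_ring e\<close> is unique; it is only ever used
  on that ring, so the choice operator picks out a well-determined object.
\<close>

definition block_measure :: "(nat \<Rightarrow> 'e::real_inner) \<Rightarrow> 'e set \<Rightarrow> real" where
  "block_measure e = (SOME \<mu>. is_block_measure e \<mu>)"

text \<open>
  The completion of a finitely additive measure on a ring (Jordan completion): the sets whose
  inner and outer measures from the ring are finite and agree.
\<close>

definition completed_ring :: "(nat \<Rightarrow> 'e::real_inner) \<Rightarrow> 'e set set" where
  "completed_ring e =
     {A. \<forall>\<epsilon>>0. \<exists>B\<in>block_ring e. \<exists>C\<in>block_ring e.
           B \<subseteq> A \<and> A \<subseteq> C \<and> block_measure e (C - B) < \<epsilon>}"

definition lam :: "(nat \<Rightarrow> 'e::real_inner) \<Rightarrow> 'e set \<Rightarrow> real" where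
  "lam e A = Inf {block_measure e C | C. C \<in> block_ring e \<and> A \<subseteq> C}"

section \<open>The Hilbert space\<close>

definition simple_functions :: "(nat \<Rightarrow> 'e::real_inner) \<Rightarrow> ('e \<Rightarrow> complex) set" where
  "simple_functions e =
     {f. \<exists>(n::nat) c B. (\<forall>k<n. B k \<in> completed_ring e) \<and> disjoint_family_on B {..<n} \<and>
           f = (\<lambda>x. \<Sum>k<n. c k * indicator (B k) x)}"

text \<open>
  The value of \<open>(\<Sum>|c\<^sub>k|\<^sup>2 \<lambda>(B\<^sub>k))\<^bsup>1/2\<^esup>\<close> does not depend on the representation of the simple
  function; it is taken here on the canonical one, by the level sets of the nonzero values.
  The inner product (linear in the first argument) is the one that induces this norm.
\<close>

definition snorm :: "(nat \<Rightarrow> 'e::real_inner) \<Rightarrow> ('e \<Rightarrow> complex) \<Rightarrow> real" where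
  "snorm e f = sqrt (\<Sum>u\<in>range f - {0}. (cmod u)\<^sup>2 * lam e (f -` {u}))"

definition sinner :: "(nat \<Rightarrow> 'e::real_inner) \<Rightarrow> ('e \<Rightarrow> complex) \<Rightarrow> ('e \<Rightarrow> complex) \<Rightarrow> complex" where
  "sinner e f g =
     (\<Sum>u\<in>range f - {0}. \<Sum>v\<in>range g - {0}.
        u * cnj v * complex_of_real (lam e (f -` {u} \<inter> g -` {v})))"

text \<open>
  The completion modulo the null space is realized by classes of Cauchy sequences of simple
  functions, two sequences being identified if the norm of their difference tends to \<open>0\<close>.
\<close>

type_synonym 'e hvec = "(nat \<Rightarrow> 'e \<Rightarrow> complex) set"

definition cauchy_seqs :: "(nat \<Rightarrow> 'e::real_inner) \<Rightarrow> (nat \<Rightarrow> 'e \<Rightarrow> complex) set" where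
  "cauchy_seqs e =
     {X. (\<forall>n. X n \<in> simple_functions e) \<and>
         (\<forall>\<epsilon>>0. \<exists>N. \<forall>m\<ge>N. \<forall>n\<ge>N. snorm e (\<lambda>x. X m x - X n x) < \<epsilon>)}"

definition seq_equiv :: "(nat \<Rightarrow> 'e::real_inner) \<Rightarrow> (nat \<Rightarrow> 'e \<Rightarrow> complex) rel" where
  "seq_equiv e =
     {(X, Y). X \<in> cauchy_seqs e \<and> Y \<in> cauchy_seqs e \<and>
              (\<lambda>n. snorm e (\<lambda>x. X n x - Y n x)) \<longlonglongrightarrow> 0}"

definition hspace :: "(nat \<Rightarrow> 'e::real_inner) \<Rightarrow> 'e hvec set" where
  "hspace e = cauchy_seqs e // seq_equiv e"

definition cls :: "(nat \<Rightarrow> 'e::real_inner) \<Rightarrow> (nat \<Rightarrow> 'e \<Rightarrow> complex) \<Rightarrow> 'e hvec" where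
  "cls e X = seq_equiv e `` {X}"

definition rep :: "'e hvec \<Rightarrow> nat \<Rightarrow> 'e \<Rightarrow> complex" where
  "rep u = (SOME X. X \<in> u)"

definition hadd :: "(nat \<Rightarrow> 'e::real_inner) \<Rightarrow> 'e hvec \<Rightarrow> 'e hvec \<Rightarrow> 'e hvec" where
  "hadd e u v = cls e (\<lambda>n x. rep u n x + rep v n x)"

definition hscale :: "(nat \<Rightarrow> 'e::real_inner) \<Rightarrow> complex \<Rightarrow> 'e hvec \<Rightarrow> 'e hvec" where
  "hscale e c u = cls e (\<lambda>n x. c * rep u n x)"

definition hinner :: "(nat \<Rightarrow> 'e::real_inner) \<Rightarrow> 'e hvec \<Rightarrow> 'e hvec \<Rightarrow> complex" where
  "hinner e u v = lim (\<lambda>n. sinner e (rep u n) (rep v n))"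

definition hdist :: "(nat \<Rightarrow> 'e::real_inner) \<Rightarrow> 'e hvec \<Rightarrow> 'e hvec \<Rightarrow> real" where
  "hdist e u v = lim (\<lambda>n. snorm e (\<lambda>x. rep u n x - rep v n x))"

definition unitary_on_hspace :: "(nat \<Rightarrow> 'e::real_inner) \<Rightarrow> ('e hvec \<Rightarrow> 'e hvec) \<Rightarrow> bool" where
  "unitary_on_hspace e F \<longleftrightarrow>
     bij_betw F (hspace e) (hspace e) \<and>
     (\<forall>u\<in>hspace e. \<forall>v\<in>hspace e. F (hadd e u v) = hadd e (F u) (F v)) \<and>
     (\<forall>c. \<forall>u\<in>hspace e. F (hscale e c u) = hscale e c (F u)) \<and>
     (\<forall>u\<in>hspace e. \<forall>v\<in>hspace e. hinner e (F u) (F v) = hinner e u v)"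

section \<open>Nonnegative nuclear operators diagonal in the basis\<close>

definition nuclear :: "('e::real_inner \<Rightarrow> 'e) \<Rightarrow> bool" where
  "nuclear D \<longleftrightarrow>
     (\<exists>y z. summable (\<lambda>n. norm (y n) * norm (z n)) \<and>
            (\<forall>x. (\<lambda>n. (x \<bullet> y n) *\<^sub>R z n) sums D x))"

definition nonneg_operator :: "('e::real_inner \<Rightarrow> 'e) \<Rightarrow> bool" where
  "nonneg_operator D \<longleftrightarrow>
     bounded_linear D \<and> (\<forall>x y. D x \<bullet> y = x \<bullet> D y) \<and> (\<forall>x. 0 \<le> D x \<bullet> x)"

definition eigenbasis :: "(nat \<Rightarrow> 'e::real_inner) \<Rightarrow> ('e \<Rightarrow> 'e) \<Rightarrow> bool" where
  "eigenbasis e D \<longleftrightarrow> (\<forall>k. \<exists>d. D (e k) = d *\<^sub>R e k)"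

section \<open>The semigroup of averaged shifts\<close>

definition shift_op :: "(nat \<Rightarrow> 'e::real_inner) \<Rightarrow> 'e \<Rightarrow> 'e hvec \<Rightarrow> 'e hvec" where
  "shift_op e h u = cls e (\<lambda>n x. rep u n (x - h))"

text \<open>A Borel measure on a separable Hilbert space is determined by its Fourier transform.\<close>

definition gaussian :: "('e::real_inner \<Rightarrow> 'e) \<Rightarrow> 'e measure" where
  "gaussian Q =
     (SOME M. prob_space M \<and> sets M = sets borel \<and>
        (\<forall>\<xi>. (\<integral>h. iexp (\<xi> \<bullet> h) \<partial>M) = complex_of_real (exp (- (Q \<xi> \<bullet> \<xi>) / 2))))"

definition has_pettis_integral ::
  "(nat \<Rightarrow> 'e::real_inner) \<Rightarrow> 'e measure \<Rightarrow> ('e \<Rightarrow> 'e hvec) \<Rightarrow> 'e hvec \<Rightarrow> bool" where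
  "has_pettis_integral e M G g \<longleftrightarrow>
     g \<in> hspace e \<and>
     (\<forall>\<phi>\<in>hspace e. integrable M (\<lambda>h. hinner e (G h) \<phi>) \<and>
                    hinner e g \<phi> = (\<integral>h. hinner e (G h) \<phi> \<partial>M))"

definition U_op :: "(nat \<Rightarrow> 'e::real_inner) \<Rightarrow> ('e \<Rightarrow> 'e) \<Rightarrow> real \<Rightarrow> 'e hvec \<Rightarrow> 'e hvec" where
  "U_op e D t f =
     (THE g. has_pettis_integral e (gaussian (\<lambda>x. t *\<^sub>R D x)) (\<lambda>h. shift_op e h f) g)"

section \<open>The semigroup of multiplication operators\<close>

text \<open>
  \<open>G n \<rightarrow> 0\<close> in the upper seminorm \<open>inf {snorm s | s simple, |g| \<le> |s| pointwise}\<close>, which extends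
  the norm from simple functions to arbitrary dominated ones.
\<close>

definition upper_null :: "(nat \<Rightarrow> 'e::real_inner) \<Rightarrow> (nat \<Rightarrow> 'e \<Rightarrow> complex) \<Rightarrow> bool" where
  "upper_null e G \<longleftrightarrow>
     (\<exists>Z. (\<forall>n. Z n \<in> simple_functions e) \<and>
          (\<forall>n x. cmod (G n x) \<le> cmod (Z n x)) \<and>
          (\<lambda>n. snorm e (Z n)) \<longlonglongrightarrow> 0)"

text \<open>
  Multiplication by a function \<open>p\<close>. Products of \<open>p\<close> with simple functions need not be simple, so
  \<open>p u\<close> is the vector \<open>v\<close> such that \<open>p X\<^sub>n - Y\<^sub>n \<rightarrow> 0\<close> in the upper seminorm, where the simple
  functions \<open>X\<^sub>n\<close> converge to \<open>u\<close> and \<open>Y\<^sub>n\<close> to \<open>v\<close>. For bounded \<open>p\<close> the vector \<open>v\<close> does not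
  depend on the choice of the two sequences.
\<close>

definition mult_op :: "(nat \<Rightarrow> 'e::real_inner) \<Rightarrow> ('e \<Rightarrow> real) \<Rightarrow> 'e hvec \<Rightarrow> 'e hvec" where
  "mult_op e p u =
     (THE v. v \<in> hspace e \<and>
        (\<exists>X\<in>u. \<exists>Y\<in>v. upper_null e (\<lambda>n x. complex_of_real (p x) * X n x - Y n x)))"

text \<open>As \<open>e\<close> is orthonormal, the eigenvalue \<open>d\<^sub>k\<close> is \<open>D (e k) \<bullet> e k\<close>.\<close>

definition U_hat_op :: "(nat \<Rightarrow> 'e::real_inner) \<Rightarrow> ('e \<Rightarrow> 'e) \<Rightarrow> real \<Rightarrow> 'e hvec \<Rightarrow> 'e hvec" where
  "U_hat_op e D t f =
     (THE g. g \<in> hspace e \<and>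
        (\<lambda>N. hdist e
           (mult_op e (\<lambda>x. exp (- (t / 2) * (\<Sum>k\<le>N. (D (e k) \<bullet> e k) * (x \<bullet> e k)\<^sup>2))) f) g)
        \<longlonglongrightarrow> 0)"

end

theory Submission
  imports Defs
begin

text \<open>
  Let \<open>u\<close> be the class of the indicator of the cube with all sides \<open>[- 1/2, 1/2)\<close>, and let \<open>D\<close> have
  the eigenvalues \<open>1 / (k + 1)\<^sup>2\<close>. The coordinates of a shift \<open>h\<close> distributed by the Gaussian
  measure with covariance \<open>t D\<close> have standard deviations proportional to \<open>1 / (k + 1)\<close>, so
  \<open>\<Sum>|h\<^sub>k|\<close> diverges almost surely and the shifted cube meets every given block in a null set.
  Hence \<open>S\<^sub>h u\<close> is almost surely orthogonal to any fixed vector, and the averaged vector is \<open>0\<close>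
  for every small \<open>t > 0\<close>. The multiplication semigroup, on the other hand, is strongly continuous
  at \<open>t = 0\<close>, because the coordinates are uniformly bounded on blocks, so it cannot annihilate a
  nonzero vector for all small \<open>t\<close>. A single operator \<open>D\<close> therefore already rules out the equivalence.

  The norm is defined through a measure selected by choice, so its existence has to be proved.
  It comes from infinite products of uniform distributions on the sequence space.
\<close>

section \<open>Rings of sets and finitely additive contents\<close>

text \<open>Nuclearity asks for a summable sequence of eigenvalues, while the cube loses its mass
  when their square roots fail to be summable; \<open>1 / (k + 1)^2\<close> lies in this gap, each
  coordinate costing a factor \<open>1 - c / (k + 1)\<close>. Two obstacles shape the rest. First,
  \<open>gaussian\<close> is pinned down only by its Fourier transform, so neither independence nor
  the law of the coordinates is at hand: overlaps are bounded by products of trigonometric factors,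
  whose integrals the Fourier transform evaluates exactly. Second, the product measure behind the
  block measure gives mass zero to the square summable sequences, so it cannot be restricted to the
  Hilbert space: the ring is instead mapped homomorphically into the sets of sequences and the
  measure is pulled back. Vectors are classes with arbitrary representatives and operators are
  definite descriptions, so convergence and uniqueness precede every computation. The exceptional
  null set of shifts depends on the test vector, which is harmless because the integral is
  weak.\<close>

lemma ring_of_sets_hull: "ring_of_sets UNIV (ring_of_sets UNIV hull G)"
  by (rule hull_in) (auto simp: ring_of_sets_iff)

lemma ring_hull_induct [consumes 1, case_names basic empty union diff]:
  assumes "A \<in> ring_of_sets UNIV hull G"
    and "\<And>A. A \<in> G \<Longrightarrow> P A" and "P {}"
    and "\<And>A B. A \<in> ring_of_sets UNIV hull G \<Longrightarrow> B \<in> ring_of_sets UNIV hull G \<Longrightarrow>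
           P A \<Longrightarrow> P B \<Longrightarrow> P (A \<union> B)"
    and "\<And>A B. A \<in> ring_of_sets UNIV hull G \<Longrightarrow> B \<in> ring_of_sets UNIV hull G \<Longrightarrow>
           P A \<Longrightarrow> P B \<Longrightarrow> P (A - B)"
  shows "P A"
proof -
  have "ring_of_sets UNIV {A \<in> ring_of_sets UNIV hull G. P A}"
    using assms(3-5) ring_of_sets_hull[of G] by (auto simp: ring_of_sets_iff)
  moreover have "G \<subseteq> {A \<in> ring_of_sets UNIV hull G. P A}"
    using assms(2) hull_subset[of G] by blast
  ultimately have "ring_of_sets UNIV hull G \<subseteq> {A \<in> ring_of_sets UNIV hull G. P A}"
    by (rule hull_minimal[rotated])
  then show ?thesis using assms(1) by blast
qed

text \<open>Closure only under the two operations whose effect on an additive function is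
  determined: disjoint union and proper difference.\<close>

inductive_set dsystem :: "'a set set \<Rightarrow> 'a set set" for G where
  basic: "A \<in> G \<Longrightarrow> A \<in> dsystem G"
| empty: "{} \<in> dsystem G"
| union: "A \<in> dsystem G \<Longrightarrow> B \<in> dsystem G \<Longrightarrow> A \<inter> B = {} \<Longrightarrow> A \<union> B \<in> dsystem G"
| diff: "A \<in> dsystem G \<Longrightarrow> B \<in> dsystem G \<Longrightarrow> B \<subseteq> A \<Longrightarrow> A - B \<in> dsystem G"

text \<open>Two passes: \<open>base\<close> lets one factor range over the generators and inducts on
  the other, then the same induction runs with the roles exchanged. \<open>insert {} G\<close> is
  the right hypothesis because disjoint generators may meet in a set that is not a
  generator.\<close>

lemma dsystem_Int:
  assumes G: "\<And>A B. A \<in> G \<Longrightarrow> B \<in> G \<Longrightarrow> A \<inter> B \<in> insert {} G"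
    and "A \<in> dsystem G" "B \<in> dsystem G"
  shows "A \<inter> B \<in> dsystem G"
proof -
  have step: "A \<inter> B \<in> dsystem G"
    if A: "\<And>B. B \<in> G \<Longrightarrow> A \<inter> B \<in> dsystem G" and B: "B \<in> dsystem G" for A B
    using B
  proof induction
    case (union B C)
    have "A \<inter> (B \<union> C) = (A \<inter> B) \<union> (A \<inter> C)" by blast
    with union show ?case by (auto intro!: dsystem.union)
  next
    case (diff B C)
    have "A \<inter> (B - C) = (A \<inter> B) - (A \<inter> C)" by blast
    with diff show ?case by (auto intro!: dsystem.diff)
  qed (auto intro: A dsystem.intros)
  have base: "A \<inter> B \<in> dsystem G" if "A \<in> G" "B \<in> dsystem G" for A B
  proof (rule step[OF _ that(2)])
    fix B assume "B \<in> G"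
    from G[OF that(1) this] show "A \<inter> B \<in> dsystem G" by (auto intro: dsystem.intros)
  qed
  have "B \<inter> A \<in> dsystem G" if "B \<in> G" for B
    using base[OF that assms(2)] .
  then show ?thesis
    by (intro step[OF _ assms(3)]) (simp add: Int_commute)
qed

text \<open>The finitary version of Dynkin's \<open>\<pi>\<close>-\<open>\<lambda>\<close> theorem.\<close>

lemma ring_hull_disjoint_induct [consumes 1, case_names Int basic empty union diff]:
  assumes "A \<in> ring_of_sets UNIV hull G"
    and G: "\<And>A B. A \<in> G \<Longrightarrow> B \<in> G \<Longrightarrow> A \<inter> B \<in> insert {} G"
    and "\<And>A. A \<in> G \<Longrightarrow> P A" and "P {}"
    and "\<And>A B. A \<in> ring_of_sets UNIV hull G \<Longrightarrow> B \<in> ring_of_sets UNIV hull G \<Longrightarrow>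
           A \<inter> B = {} \<Longrightarrow> P A \<Longrightarrow> P B \<Longrightarrow> P (A \<union> B)"
    and "\<And>A B. A \<in> ring_of_sets UNIV hull G \<Longrightarrow> B \<in> ring_of_sets UNIV hull G \<Longrightarrow>
           B \<subseteq> A \<Longrightarrow> P A \<Longrightarrow> P B \<Longrightarrow> P (A - B)"
  shows "P A"
proof -
  interpret ring_of_sets UNIV "ring_of_sets UNIV hull G"
    by (rule ring_of_sets_hull)
  have "ring_of_sets UNIV (dsystem G)"
    unfolding ring_of_sets_iff
  proof (intro conjI ballI)
    fix A B assume AB: "A \<in> dsystem G" "B \<in> dsystem G"
    have *: "A - (A \<inter> B) \<in> dsystem G"
      using AB dsystem_Int[OF G AB] by (intro dsystem.diff) auto
    then show "A - B \<in> dsystem G" by (simp add: Diff_Int)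
    have "B \<union> (A - (A \<inter> B)) \<in> dsystem G"
      using AB * by (intro dsystem.union) auto
    moreover have "B \<union> (A - (A \<inter> B)) = A \<union> B" by blast
    ultimately show "A \<union> B \<in> dsystem G" by simp
  qed (auto intro: dsystem.intros)
  then have "ring_of_sets UNIV hull G \<subseteq> dsystem G"
    by (intro hull_minimal) (auto intro: dsystem.intros)
  with assms(1) have "A \<in> dsystem G" by blast
  moreover have "A \<in> ring_of_sets UNIV hull G \<and> P A" if "A \<in> dsystem G" for A
    using that
  proof induction
    case (basic A)
    then show ?case using assms(3) hull_subset[of G] by blast
  next
    case (union A B)
    then show ?case using assms(5) by blast
  next
    case (diff A B)
    then show ?case using assms(6) by blast
  qed (use assms(4) in blast)
  ultimately show ?thesis by blast
qed

text \<open>Uniqueness of finitely additive extensions from an intersection-stable family; it drives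
  both the compatibility of the charts and translation invariance.\<close>

lemma additive_hull_eqI:
  fixes \<mu> \<nu> :: "'a set \<Rightarrow> real"
  assumes A: "A \<in> ring_of_sets UNIV hull G"
    and G: "\<And>A B. A \<in> G \<Longrightarrow> B \<in> G \<Longrightarrow> A \<inter> B \<in> insert {} G"
    and \<mu>: "additive (ring_of_sets UNIV hull G) \<mu>"
    and \<nu>: "additive (ring_of_sets UNIV hull G) \<nu>"
    and eq: "\<And>A. A \<in> G \<Longrightarrow> \<mu> A = \<nu> A"
  shows "\<mu> A = \<nu> A"
proof -
  interpret ring_of_sets UNIV "ring_of_sets UNIV hull G"
    by (rule ring_of_sets_hull)
  have Un: "\<mu> (A \<union> B) = \<mu> A + \<mu> B" "\<nu> (A \<union> B) = \<nu> A + \<nu> B"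
    if "A \<in> ring_of_sets UNIV hull G" "B \<in> ring_of_sets UNIV hull G" "A \<inter> B = {}" for A B
    using that \<mu> \<nu> by (auto simp: additive_def)
  show ?thesis
    using A
  proof (induction rule: ring_hull_disjoint_induct)
    case (Int A B)
    then show ?case by (rule G)
  next
    case empty
    show ?case using Un[of "{}" "{}"] by simp
  next
    case (diff A B)
    moreover have "A - B \<in> ring_of_sets UNIV hull G"
      using diff by auto
    moreover have "A = B \<union> (A - B)" using diff by blast
    ultimately show ?case using Un[of B "A - B"] by auto
  qed (auto simp: eq Un)
qed

text \<open>Instantiated twice: with \<open>block_measure e\<close> on \<open>block_ring e\<close>,
  and with \<open>lam e\<close> on its completion.\<close>

locale content = ring_of_sets UNIV R for R :: "'a set set" +
  fixes \<mu> :: "'a set \<Rightarrow> real"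
  assumes additive: "additive R \<mu>"
    and nonneg: "A \<in> R \<Longrightarrow> 0 \<le> \<mu> A"
begin

lemma content_Un: "A \<in> R \<Longrightarrow> B \<in> R \<Longrightarrow> A \<inter> B = {} \<Longrightarrow> \<mu> (A \<union> B) = \<mu> A + \<mu> B"
  using additive by (auto simp: additive_def)

lemma content_empty [simp]: "\<mu> {} = 0"
  using content_Un[of "{}" "{}"] by simp

lemma content_Diff:
  assumes "A \<in> R" "B \<in> R" "B \<subseteq> A"
  shows "\<mu> (A - B) = \<mu> A - \<mu> B"
proof -
  have "\<mu> (B \<union> (A - B)) = \<mu> B + \<mu> (A - B)"
    using assms by (intro content_Un) auto
  then show ?thesis using assms by (simp add: Un_absorb1)
qed

lemma content_mono: "A \<in> R \<Longrightarrow> B \<in> R \<Longrightarrow> A \<subseteq> B \<Longrightarrow> \<mu> A \<le> \<mu> B"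
  using content_Diff[of B A] nonneg[of "B - A"] by auto

lemma content_Un_le: "A \<in> R \<Longrightarrow> B \<in> R \<Longrightarrow> \<mu> (A \<union> B) \<le> \<mu> A + \<mu> B"
  using content_Un[of A "B - A"] content_mono[of "B - A" B] by (auto simp: Diff)

lemma content_UN:
  assumes "finite I" "\<And>i. i \<in> I \<Longrightarrow> F i \<in> R" "disjoint_family_on F I"
  shows "\<mu> (\<Union>i\<in>I. F i) = (\<Sum>i\<in>I. \<mu> (F i))"
  using assms
proof (induction I rule: finite_induct)
  case (insert i I)
  have "\<mu> (F i \<union> (\<Union>i\<in>I. F i)) = \<mu> (F i) + \<mu> (\<Union>i\<in>I. F i)"
    using insert by (intro content_Un) (auto simp: disjoint_family_on_def)
  moreover have "disjoint_family_on F I"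
    using insert.prems by (auto simp: disjoint_family_on_def)
  ultimately show ?case using insert by simp
qed simp

end

section \<open>Simple functions\<close>

text \<open>The level set of 0 is exempt, since a ring need not contain the whole space. Values need
  only a zero, so that pairs and triples of functions are covered; these serve as common
  refinements.\<close>

definition simple_on :: "'a set set \<Rightarrow> ('a \<Rightarrow> 'b::zero) \<Rightarrow> bool" where
  "simple_on R f \<longleftrightarrow> finite (range f) \<and> (\<forall>u. u \<noteq> 0 \<longrightarrow> f -` {u} \<in> R)"

text \<open>The integral of \<open>\<psi> \<circ> f\<close> against a content, provided that
  \<open>\<psi>\<close> vanishes at 0.\<close>

definition simple_sum :: "('a set \<Rightarrow> real) \<Rightarrow> ('a \<Rightarrow> 'b::zero) \<Rightarrow> ('b \<Rightarrow> 'c::real_vector) \<Rightarrow> 'c" where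
  "simple_sum \<mu> f \<psi> = (\<Sum>u\<in>range f - {0}. \<mu> (f -` {u}) *\<^sub>R \<psi> u)"

context ring_of_sets
begin

lemma simple_on_vimage:
  assumes "simple_on M f" "0 \<notin> S"
  shows "f -` S \<in> M"
proof -
  have "f -` S = (\<Union>u\<in>range f \<inter> S. f -` {u})" by auto
  moreover have "(\<Union>u\<in>range f \<inter> S. f -` {u}) \<in> M"
    using assms by (intro finite_UN) (auto simp: simple_on_def, metis)
  ultimately show ?thesis by simp
qed

lemma simple_on_comp:
  assumes "simple_on M f" "\<phi> 0 = 0"
  shows "simple_on M (\<lambda>x. \<phi> (f x))"
proof -
  have "finite (range (\<lambda>x. \<phi> (f x)))"
    using assms finite_imageI[of "range f" \<phi>] by (simp add: simple_on_def image_image)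
  moreover have "(\<lambda>x. \<phi> (f x)) -` {u} \<in> M" if "u \<noteq> 0" for u
  proof -
    have "(\<lambda>x. \<phi> (f x)) -` {u} = f -` (\<phi> -` {u})" by auto
    then show ?thesis using simple_on_vimage[OF assms(1), of "\<phi> -` {u}"] that assms(2) by auto
  qed
  ultimately show ?thesis by (simp add: simple_on_def)
qed

lemma simple_on_Pair:
  assumes f: "simple_on M f" and g: "simple_on M g"
  shows "simple_on M (\<lambda>x. (f x, g x))"
proof -
  have "range (\<lambda>x. (f x, g x)) \<subseteq> range f \<times> range g" by auto
  then have "finite (range (\<lambda>x. (f x, g x)))"
    using f g by (rule_tac finite_subset) (auto simp: simple_on_def)
  moreover have "(\<lambda>x. (f x, g x)) -` {w} \<in> M" if "w \<noteq> 0" for w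
  proof -
    have S: "f -` (-{0}) \<in> M" "g -` (-{0}) \<in> M"
      using f g by (auto intro: simple_on_vimage)
    obtain u v where w: "w = (u, v)" by (cases w)
    consider "u \<noteq> 0" "v \<noteq> 0" | "u \<noteq> 0" "v = 0" | "u = 0" "v \<noteq> 0"
      using \<open>w \<noteq> 0\<close> unfolding w zero_prod_def by blast
    then show ?thesis
    proof cases
      case 1
      have "(\<lambda>x. (f x, g x)) -` {w} = f -` {u} \<inter> g -` {v}" by (auto simp: w)
      then show ?thesis using 1 f g by (auto simp: simple_on_def)
    next
      \<comment> \<open>A level set of one function alone is not inside the ring's reach when its
        value is 0; here it is removed as the complement of the support of \<open>g\<close>, within
        a level set of \<open>f\<close>.\<close>
      case 2
      have "(\<lambda>x. (f x, g x)) -` {w} = f -` {u} - g -` (-{0})" by (auto simp: w 2)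
      then show ?thesis using 2 S f by (auto simp: simple_on_def)
    next
      case 3
      have "(\<lambda>x. (f x, g x)) -` {w} = g -` {v} - f -` (-{0})" by (auto simp: w 3)
      then show ?thesis using 3 S g by (auto simp: simple_on_def)
    qed
  qed
  ultimately show ?thesis by (simp add: simple_on_def)
qed

lemma simple_on_comp2:
  assumes "simple_on M f" "simple_on M g" "\<phi> 0 0 = 0"
  shows "simple_on M (\<lambda>x. \<phi> (f x) (g x))"
  using simple_on_comp[OF simple_on_Pair[OF assms(1,2)], of "\<lambda>(u, v). \<phi> u v"] assms(3)
  by (simp add: zero_prod_def)

lemma simple_on_zero: "simple_on M (\<lambda>x. 0)"
  by (auto simp: simple_on_def vimage_def)

lemma simple_on_sum:
  fixes f :: "'i \<Rightarrow> 'a \<Rightarrow> 'b::comm_monoid_add"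
  assumes "\<And>i. i \<in> I \<Longrightarrow> simple_on M (f i)"
  shows "simple_on M (\<lambda>x. \<Sum>i\<in>I. f i x)"
proof (cases "finite I")
  case True
  then show ?thesis using assms
    by (induction I rule: finite_induct)
      (auto simp: simple_on_zero intro!: simple_on_comp2[where \<phi> = "(+)"])
qed (simp add: simple_on_zero)

lemma simple_on_indicator:
  assumes "A \<in> M"
  shows "simple_on M (\<lambda>x. c * indicator A x :: 'b::semiring_1)"
proof -
  have "range (indicator A :: 'a \<Rightarrow> 'b) \<subseteq> {0, 1}" by (auto simp: indicator_def)
  then have "finite (range (indicator A :: 'a \<Rightarrow> 'b))" by (rule finite_subset) simp
  moreover have "indicator A -` {u :: 'b} \<in> M" if "u \<noteq> 0" for u
  proof -
    have "indicator A -` {u :: 'b} = (if u = 1 then A else {})"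
      using that by (auto simp: indicator_def split: if_splits)
    then show ?thesis using assms by simp
  qed
  ultimately have "simple_on M (indicator A :: 'a \<Rightarrow> 'b)" by (simp add: simple_on_def)
  then show ?thesis using simple_on_comp[of "indicator A" "\<lambda>u. c * u"] by simp
qed

end

context content
begin

text \<open>Change of variables: the level sets of \<open>f\<close> are grouped by the value of
  \<open>\<phi>\<close>. All independence of representation rests on this, with \<open>f\<close> a
  pair or triple and \<open>\<phi>\<close> a projection or an arithmetic operation.\<close>

lemma simple_sum_comp:
  assumes f: "simple_on R f" and \<phi>: "\<phi> 0 = 0" and \<psi>: "\<psi> 0 = 0"
  shows "simple_sum \<mu> (\<lambda>x. \<phi> (f x)) \<psi> = simple_sum \<mu> f (\<lambda>u. \<psi> (\<phi> u))"
proof -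
  let ?S = "{u \<in> range f. \<phi> u \<noteq> 0}"
  have fin: "finite (range f)" using f by (simp add: simple_on_def)
  have *: "\<mu> ((\<lambda>x. \<phi> (f x)) -` {w}) = (\<Sum>u\<in>{u \<in> ?S. \<phi> u = w}. \<mu> (f -` {u}))"
    if "w \<noteq> 0" for w
  proof -
    have "(\<lambda>x. \<phi> (f x)) -` {w} = (\<Union>u\<in>{u \<in> ?S. \<phi> u = w}. f -` {u})"
      using that by auto
    moreover have "\<mu> (\<Union>u\<in>{u \<in> ?S. \<phi> u = w}. f -` {u}) =
        (\<Sum>u\<in>{u \<in> ?S. \<phi> u = w}. \<mu> (f -` {u}))"
      using f \<phi> fin by (intro content_UN) (auto simp: simple_on_def disjoint_family_on_def, metis)
    ultimately show ?thesis by simp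
  qed
  have "simple_sum \<mu> (\<lambda>x. \<phi> (f x)) \<psi> =
      (\<Sum>w\<in>\<phi> ` ?S. \<Sum>u\<in>{u \<in> ?S. \<phi> u = w}. \<mu> (f -` {u}) *\<^sub>R \<psi> (\<phi> u))"
    unfolding simple_sum_def
  proof (intro sum.cong)
    fix w assume "w \<in> \<phi> ` ?S"
    then show "\<mu> ((\<lambda>x. \<phi> (f x)) -` {w}) *\<^sub>R \<psi> w =
        (\<Sum>u\<in>{u \<in> ?S. \<phi> u = w}. \<mu> (f -` {u}) *\<^sub>R \<psi> (\<phi> u))"
      by (subst *) (auto simp: scaleR_sum_left)
  qed auto
  also have "\<dots> = (\<Sum>u\<in>?S. \<mu> (f -` {u}) *\<^sub>R \<psi> (\<phi> u))"
    using fin by (intro sum.group) auto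
  also have "\<dots> = simple_sum \<mu> f (\<lambda>u. \<psi> (\<phi> u))"
    unfolding simple_sum_def
    using fin by (intro sum.mono_neutral_left) (auto simp: \<phi> \<psi>)
  finally show ?thesis .
qed

lemma simple_sum_mono:
  assumes "simple_on R f" "\<And>x. f x \<noteq> 0 \<Longrightarrow> \<psi> (f x) \<le> (\<phi> (f x) :: real)"
  shows "simple_sum \<mu> f \<psi> \<le> simple_sum \<mu> f \<phi>"
  unfolding simple_sum_def real_scaleR_def using assms
  by (intro sum_mono mult_left_mono) (auto simp: simple_on_def nonneg)

lemma simple_sum_nonneg:
  assumes "simple_on R f" "\<And>u. (0::real) \<le> \<psi> u"
  shows "0 \<le> simple_sum \<mu> f \<psi>"
  unfolding simple_sum_def real_scaleR_def using assms
  by (intro sum_nonneg mult_nonneg_nonneg) (auto simp: simple_on_def nonneg)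

lemma simple_sum_fst:
  assumes "simple_on R f" "simple_on R g" "\<psi> 0 = 0"
  shows "simple_sum \<mu> f \<psi> = simple_sum \<mu> (\<lambda>x. (f x, g x)) (\<lambda>w. \<psi> (fst w))"
  using simple_sum_comp[OF simple_on_Pair[OF assms(1,2)], of fst \<psi>] assms(3)
  by (simp add: zero_prod_def)

lemma simple_sum_snd:
  assumes "simple_on R f" "simple_on R g" "\<psi> 0 = 0"
  shows "simple_sum \<mu> g \<psi> = simple_sum \<mu> (\<lambda>x. (f x, g x)) (\<lambda>w. \<psi> (snd w))"
  using simple_sum_comp[OF simple_on_Pair[OF assms(1,2)], of snd \<psi>] assms(3)
  by (simp add: zero_prod_def)

definition l2norm :: "('a \<Rightarrow> complex) \<Rightarrow> real" where
  "l2norm f = sqrt (simple_sum \<mu> f (\<lambda>u. (cmod u)\<^sup>2))"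

definition l2inner :: "('a \<Rightarrow> complex) \<Rightarrow> ('a \<Rightarrow> complex) \<Rightarrow> complex" where
  "l2inner f g = simple_sum \<mu> (\<lambda>x. (f x, g x)) (\<lambda>(u, v). u * cnj v)"

lemma l2norm_nonneg: "simple_on R f \<Longrightarrow> 0 \<le> l2norm f"
  by (auto simp: l2norm_def intro!: simple_sum_nonneg)

text \<open>Written on the level sets of a common refinement \<open>F\<close>, the norm is a
  weighted Euclidean norm over a finite index set, so the triangle and Cauchy-Schwarz inequalities
  reduce to those for \<open>L2_set\<close>.\<close>

lemma l2norm_eq_L2_set:
  assumes "simple_on R F" "\<And>x. f x = \<phi> (F x)" "\<phi> 0 = 0"
  shows "l2norm f = L2_set (\<lambda>w. sqrt (\<mu> (F -` {w})) * cmod (\<phi> w)) (range F - {0})"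
proof -
  have "f = (\<lambda>x. \<phi> (F x))" using assms(2) by auto
  then have "simple_sum \<mu> f (\<lambda>u. (cmod u)\<^sup>2) = simple_sum \<mu> F (\<lambda>w. (cmod (\<phi> w))\<^sup>2)"
    using simple_sum_comp[of F \<phi> "\<lambda>u. (cmod u)\<^sup>2"] assms(1,3) by simp
  also have "\<dots> = (\<Sum>w\<in>range F - {0}. (sqrt (\<mu> (F -` {w})) * cmod (\<phi> w))\<^sup>2)"
    unfolding simple_sum_def using assms(1)
    by (intro sum.cong) (auto simp: power_mult_distrib simple_on_def nonneg)
  finally show ?thesis by (simp add: l2norm_def L2_set_def)
qed

lemma l2norm_triangle:
  assumes f: "simple_on R f" and g: "simple_on R g"
  shows "l2norm (\<lambda>x. f x + g x) \<le> l2norm f + l2norm g"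
proof -
  let ?F = "\<lambda>x. (f x, g x)"
  let ?I = "range ?F - {0}"
  let ?s = "\<lambda>w. sqrt (\<mu> (?F -` {w}))"
  have F: "simple_on R ?F" by (rule simple_on_Pair[OF f g])
  have s: "0 \<le> ?s w" if "w \<in> ?I" for w using F that by (auto simp: simple_on_def nonneg)
  have "l2norm (\<lambda>x. f x + g x) = L2_set (\<lambda>w. ?s w * cmod (fst w + snd w)) ?I"
    by (rule l2norm_eq_L2_set[OF F]) auto
  also have "\<dots> \<le> L2_set (\<lambda>w. ?s w * cmod (fst w) + ?s w * cmod (snd w)) ?I"
    using s by (intro L2_set_mono)
      (auto simp: distrib_left[symmetric] intro!: mult_left_mono norm_triangle_ineq)
  also have "\<dots> \<le> L2_set (\<lambda>w. ?s w * cmod (fst w)) ?I + L2_set (\<lambda>w. ?s w * cmod (snd w)) ?I"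
    by (rule L2_set_triangle_ineq)
  also have "L2_set (\<lambda>w. ?s w * cmod (fst w)) ?I = l2norm f"
    by (rule l2norm_eq_L2_set[OF F, symmetric]) auto
  also have "L2_set (\<lambda>w. ?s w * cmod (snd w)) ?I = l2norm g"
    by (rule l2norm_eq_L2_set[OF F, symmetric]) auto
  finally show ?thesis .
qed

lemma l2norm_mono:
  assumes f: "simple_on R f" and g: "simple_on R g" and le: "\<And>x. cmod (f x) \<le> cmod (g x)"
  shows "l2norm f \<le> l2norm g"
proof -
  have F: "simple_on R (\<lambda>x. (f x, g x))" by (rule simple_on_Pair[OF f g])
  have "simple_sum \<mu> f (\<lambda>u. (cmod u)\<^sup>2) \<le> simple_sum \<mu> g (\<lambda>u. (cmod u)\<^sup>2)"
    unfolding simple_sum_fst[OF f g, of "\<lambda>u. (cmod u)\<^sup>2", simplified]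
      simple_sum_snd[OF f g, of "\<lambda>u. (cmod u)\<^sup>2", simplified]
    by (rule simple_sum_mono[OF F]) (simp add: le)
  then show ?thesis by (simp add: l2norm_def)
qed

lemma l2norm_scale:
  assumes "simple_on R f"
  shows "l2norm (\<lambda>x. c * f x) = cmod c * l2norm f"
proof -
  have "l2norm (\<lambda>x. c * f x) = L2_set (\<lambda>w. sqrt (\<mu> (f -` {w})) * cmod (c * w)) (range f - {0})"
    by (rule l2norm_eq_L2_set[OF assms]) auto
  also have "\<dots> = L2_set (\<lambda>w. cmod c * (sqrt (\<mu> (f -` {w})) * cmod w)) (range f - {0})"
    by (simp add: norm_mult mult_ac)
  also have "\<dots> = cmod c * L2_set (\<lambda>w. sqrt (\<mu> (f -` {w})) * cmod w) (range f - {0})"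
    by (simp add: L2_set_right_distrib)
  also have "L2_set (\<lambda>w. sqrt (\<mu> (f -` {w})) * cmod w) (range f - {0}) = l2norm f"
    by (rule l2norm_eq_L2_set[OF assms, symmetric]) auto
  finally show ?thesis .
qed

lemma l2norm_zero [simp]: "l2norm (\<lambda>x. 0) = 0"
  by (simp add: l2norm_def simple_sum_def)

lemma l2inner_Cauchy_Schwarz:
  assumes f: "simple_on R f" and g: "simple_on R g"
  shows "cmod (l2inner f g) \<le> l2norm f * l2norm g"
proof -
  let ?F = "\<lambda>x. (f x, g x)"
  let ?I = "range ?F - {0}"
  let ?s = "\<lambda>w. sqrt (\<mu> (?F -` {w}))"
  have F: "simple_on R ?F" by (rule simple_on_Pair[OF f g])
  have \<mu>: "\<mu> (?F -` {w}) = ?s w * ?s w" if "w \<in> ?I" for w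
    using F that by (auto simp: simple_on_def nonneg)
  have s: "0 \<le> ?s w" if "w \<in> ?I" for w using F that by (auto simp: simple_on_def nonneg)
  have "cmod (l2inner f g) \<le> (\<Sum>w\<in>?I. cmod (\<mu> (?F -` {w}) *\<^sub>R (fst w * cnj (snd w))))"
    unfolding l2inner_def simple_sum_def case_prod_unfold by (rule norm_sum)
  also have "\<dots> = (\<Sum>w\<in>?I. \<bar>?s w * cmod (fst w)\<bar> * \<bar>?s w * cmod (snd w)\<bar>)"
  proof (intro sum.cong refl)
    fix w assume "w \<in> ?I"
    from \<mu>[OF this] s[OF this]
    show "cmod (\<mu> (?F -` {w}) *\<^sub>R (fst w * cnj (snd w))) =
        \<bar>?s w * cmod (fst w)\<bar> * \<bar>?s w * cmod (snd w)\<bar>"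
      by (simp add: norm_mult abs_mult mult_ac)
  qed
  also have "\<dots> \<le> L2_set (\<lambda>w. ?s w * cmod (fst w)) ?I * L2_set (\<lambda>w. ?s w * cmod (snd w)) ?I"
    by (rule L2_set_mult_ineq)
  also have "L2_set (\<lambda>w. ?s w * cmod (fst w)) ?I = l2norm f"
    by (rule l2norm_eq_L2_set[OF F, symmetric]) auto
  also have "L2_set (\<lambda>w. ?s w * cmod (snd w)) ?I = l2norm g"
    by (rule l2norm_eq_L2_set[OF F, symmetric]) auto
  finally show ?thesis .
qed

lemma l2inner_commute:
  assumes f: "simple_on R f" and g: "simple_on R g"
  shows "l2inner g f = cnj (l2inner f g)"
proof -
  have "l2inner g f = simple_sum \<mu> (\<lambda>x. (f x, g x)) (\<lambda>w. snd w * cnj (fst w))"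
    using simple_sum_comp[OF simple_on_Pair[OF f g], of "\<lambda>w. (snd w, fst w)" "\<lambda>(u, v). u * cnj v"]
    by (simp add: l2inner_def zero_prod_def)
  also have "\<dots> = cnj (l2inner f g)"
    by (simp add: l2inner_def simple_sum_def case_prod_unfold mult.commute)
  finally show ?thesis .
qed

text \<open>On the joint level sets of all three functions the three inner products are sums over
  one index set and subtract termwise.\<close>

lemma l2inner_diff_left:
  assumes f: "simple_on R f" and g: "simple_on R g" and h: "simple_on R h"
  shows "l2inner (\<lambda>x. f x - g x) h = l2inner f h - l2inner g h"
proof -
  let ?F = "\<lambda>x. (f x, g x, h x)"
  have F: "simple_on R ?F" by (intro simple_on_Pair f g h)
  have 1: "l2inner (\<lambda>x. f x - g x) h = simple_sum \<mu> ?F (\<lambda>(u, v, w). (u - v) * cnj w)"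
    using simple_sum_comp[OF F, of "\<lambda>(u, v, w). (u - v, w)" "\<lambda>(u, v). u * cnj v"]
    by (simp add: l2inner_def zero_prod_def case_prod_unfold)
  have 2: "l2inner f h = simple_sum \<mu> ?F (\<lambda>(u, v, w). u * cnj w)"
    using simple_sum_comp[OF F, of "\<lambda>(u, v, w). (u, w)" "\<lambda>(u, v). u * cnj v"]
    by (simp add: l2inner_def zero_prod_def case_prod_unfold)
  have 3: "l2inner g h = simple_sum \<mu> ?F (\<lambda>(u, v, w). v * cnj w)"
    using simple_sum_comp[OF F, of "\<lambda>(u, v, w). (v, w)" "\<lambda>(u, v). u * cnj v"]
    by (simp add: l2inner_def zero_prod_def case_prod_unfold)
  show ?thesis
    unfolding 1 2 3 simple_sum_def
    by (simp add: sum_subtractf[symmetric] case_prod_unfold algebra_simps)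
qed

lemma l2inner_diff_right:
  assumes f: "simple_on R f" and g: "simple_on R g" and h: "simple_on R h"
  shows "l2inner h (\<lambda>x. f x - g x) = l2inner h f - l2inner h g"
proof -
  have "simple_on R (\<lambda>x. f x - g x)"
    using simple_on_comp2[OF f g, of "(-)"] by simp
  from l2inner_commute[OF this h] l2inner_commute[OF f h] l2inner_commute[OF g h]
  show ?thesis
    by (simp add: l2inner_diff_left[OF f g h])
qed

lemma l2inner_self:
  assumes "simple_on R f"
  shows "l2inner f f = complex_of_real ((l2norm f)\<^sup>2)"
proof -
  have "l2inner f f = simple_sum \<mu> f (\<lambda>u. u * cnj u)"
    using simple_sum_comp[OF assms, of "\<lambda>u. (u, u)" "\<lambda>(u, v). u * cnj v"]
    by (simp add: l2inner_def zero_prod_def)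
  also have "\<dots> = complex_of_real (simple_sum \<mu> f (\<lambda>u. (cmod u)\<^sup>2))"
    by (simp add: simple_sum_def complex_norm_square[symmetric] scaleR_conv_of_real)
  also have "simple_sum \<mu> f (\<lambda>u. (cmod u)\<^sup>2) = (l2norm f)\<^sup>2"
    using assms by (simp add: l2norm_def simple_sum_nonneg)
  finally show ?thesis .
qed

end

section \<open>Orthonormal sequences\<close>

text \<open>\<open>polish_space\<close> supplies the completeness behind
  \<open>Riesz_Fischer\<close> and the separability behind the Borel measurability
  arguments.\<close>

locale orthonormal_seq =
  fixes e :: "nat \<Rightarrow> 'e::{real_inner, polish_space}"
  assumes orth: "e i \<bullet> e j = (if i = j then 1 else 0)"
begin

lemma inner_sum_basis:
  "finite I \<Longrightarrow> (\<Sum>k\<in>I. c k *\<^sub>R e k) \<bullet> e j = (if j \<in> I then c j else 0)"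
  by (simp add: inner_sum_left orth if_distrib[of "\<lambda>x. _ * x"] cong: if_cong)

lemma norm_sum_basis:
  assumes "finite I"
  shows "(norm (\<Sum>k\<in>I. c k *\<^sub>R e k))\<^sup>2 = (\<Sum>k\<in>I. (c k)\<^sup>2)"
proof -
  have "(norm (\<Sum>k\<in>I. c k *\<^sub>R e k))\<^sup>2 = (\<Sum>k\<in>I. c k * ((\<Sum>k\<in>I. c k *\<^sub>R e k) \<bullet> e k))"
    by (simp add: power2_norm_eq_inner inner_sum_right)
  also have "\<dots> = (\<Sum>k\<in>I. (c k)\<^sup>2)"
    by (intro sum.cong) (simp_all add: inner_sum_basis[OF assms] power2_eq_square)
  finally show ?thesis .
qed

lemma norm_basis [simp]: "norm (e k) = 1"
  using orth[of k k] by (simp add: norm_eq_sqrt_inner)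

lemma abs_coord_le: "\<bar>x \<bullet> e k\<bar> \<le> norm x"
  using Cauchy_Schwarz_ineq2[of x "e k"] by simp

lemma Bessel: "(\<Sum>k<n. (x \<bullet> e k)\<^sup>2) \<le> (norm x)\<^sup>2"
proof -
  let ?s = "\<Sum>k<n. (x \<bullet> e k) *\<^sub>R e k"
  have s: "x \<bullet> ?s = (\<Sum>k<n. (x \<bullet> e k)\<^sup>2)" "?s \<bullet> ?s = (\<Sum>k<n. (x \<bullet> e k)\<^sup>2)"
    using norm_sum_basis[of "{..<n}" "\<lambda>k. x \<bullet> e k"]
    by (simp_all add: inner_sum_right power2_eq_square flip: power2_norm_eq_inner)
  have "0 \<le> (x - ?s) \<bullet> (x - ?s)" by simp
  also have "\<dots> = (norm x)\<^sup>2 - (\<Sum>k<n. (x \<bullet> e k)\<^sup>2)"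
    by (simp only: inner_diff_left inner_diff_right s inner_commute[of ?s x] power2_norm_eq_inner)
  finally show ?thesis by simp
qed

lemma summable_coord_sq: "summable (\<lambda>k. (x \<bullet> e k)\<^sup>2)"
  by (rule bounded_imp_summable[of _ "(norm x)\<^sup>2"])
    (use Bessel[of x "Suc _"] in \<open>auto simp: lessThan_Suc_atMost\<close>)

lemma Riesz_Fischer:
  assumes "summable (\<lambda>k. (c k)\<^sup>2)"
  obtains x where "(\<lambda>n. \<Sum>k<n. c k *\<^sub>R e k) \<longlonglongrightarrow> x" "\<And>k. x \<bullet> e k = c k"
proof -
  let ?s = "\<lambda>n. \<Sum>k<n. c k *\<^sub>R e k"
  let ?S = "\<lambda>n. \<Sum>k<n. (c k)\<^sup>2"
  \<comment> \<open>By Pythagoras, the Cauchy property of the vector series is that of the real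
    series of squares.\<close>
  have *: "(dist (?s m) (?s n))\<^sup>2 = dist (?S m) (?S n)" if "n \<le> m" for m n
  proof -
    have "{..<m} = {..<n} \<union> {n..<m}" using that by auto
    then have "?s m = ?s n + (\<Sum>k=n..<m. c k *\<^sub>R e k)" "?S m = ?S n + (\<Sum>k=n..<m. (c k)\<^sup>2)"
      by (simp_all add: sum.union_disjoint ivl_disj_int)
    then show ?thesis
      by (simp add: dist_norm norm_sum_basis sum_nonneg)
  qed
  have dist: "(dist (?s m) (?s n))\<^sup>2 = dist (?S m) (?S n)" for m n
    using *[of n m] *[of m n] by (cases "n \<le> m") (auto simp: dist_commute)
  have "Cauchy ?S"
    using assms by (intro convergent_Cauchy) (simp add: summable_iff_convergent)
  have "Cauchy ?s"
    unfolding Cauchy_def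
  proof (intro allI impI)
    fix r :: real assume "0 < r"
    then obtain N where N: "\<forall>m\<ge>N. \<forall>n\<ge>N. dist (?S m) (?S n) < r\<^sup>2"
      using \<open>Cauchy ?S\<close> unfolding Cauchy_def by (meson zero_less_power)
    have "dist (?s m) (?s n) < r" if "m \<ge> N" "n \<ge> N" for m n
    proof (rule power2_less_imp_less)
      show "(dist (?s m) (?s n))\<^sup>2 < r\<^sup>2" unfolding dist using N that by blast
    qed (use \<open>0 < r\<close> in simp)
    then show "\<exists>N. \<forall>m\<ge>N. \<forall>n\<ge>N. dist (?s m) (?s n) < r" by blast
  qed
  then obtain x where x: "?s \<longlonglongrightarrow> x"
    unfolding Cauchy_convergent_iff convergent_def by blast
  have "x \<bullet> e k = c k" for k
  proof (rule LIMSEQ_unique)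
    show "(\<lambda>n. ?s n \<bullet> e k) \<longlonglongrightarrow> x \<bullet> e k" by (intro tendsto_intros x)
    show "(\<lambda>n. ?s n \<bullet> e k) \<longlonglongrightarrow> c k"
      by (rule tendsto_eventually)
        (use eventually_gt_at_top[of k] in eventually_elim, simp add: inner_sum_basis)
  qed
  with x show ?thesis by (rule that)
qed

end

section \<open>Existence of the block measure\<close>

definition seq_box :: "(nat \<Rightarrow> real) \<Rightarrow> (nat \<Rightarrow> real) \<Rightarrow> (nat \<Rightarrow> real) set" where
  "seq_box a b = {z. \<forall>j. a j \<le> z j \<and> z j < b j}"

text \<open>This is \<open>z\<close> clamped to the interval between \<open>x\<close> and
  \<open>y\<close>; the lattice form keeps bounds on it linear.\<close>

definition median :: "real \<Rightarrow> real \<Rightarrow> real \<Rightarrow> real" where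
  "median x y z = max (min x y) (min (max x y) z)"

definition vol :: "(nat \<Rightarrow> real) \<Rightarrow> (nat \<Rightarrow> real) \<Rightarrow> real" where
  "vol a b = lim (\<lambda>n. \<Prod>j<n. b j - a j)"

text \<open>Split each logarithm into its positive and negative part. Absolute measurability makes
  the first product converge; the second is decreasing and bounded below by 0, so it converges too,
  possibly to 0.\<close>

lemma prod_sides_tendsto_vol:
  assumes "block_bounds a b" and "summable (\<lambda>j. max 0 (ln (b j - a j)))"
  shows "(\<lambda>n. \<Prod>j<n. b j - a j) \<longlonglongrightarrow> vol a b"
proof -
  let ?l = "\<lambda>j. ln (b j - a j)"
  have "(\<Prod>j<n. b j - a j) = exp (\<Sum>j<n. max 0 (?l j)) * (\<Prod>j<n. exp (min 0 (?l j)))" for n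
  proof -
    have "(\<Prod>j<n. b j - a j) = (\<Prod>j<n. exp (max 0 (?l j)) * exp (min 0 (?l j)))"
    proof (intro prod.cong refl)
      fix j
      have "max 0 (?l j) + min 0 (?l j) = ?l j" by auto
      then show "b j - a j = exp (max 0 (?l j)) * exp (min 0 (?l j))"
        using assms(1) by (simp add: block_bounds_def flip: exp_add)
    qed
    then show ?thesis by (simp add: exp_sum prod.distrib)
  qed
  moreover have "convergent (\<lambda>n. exp (\<Sum>j<n. max 0 (?l j)))"
    using assms(2) by (auto simp: summable_def sums_def convergent_def intro: tendsto_exp)
  moreover have "convergent (\<lambda>n. \<Prod>j<n. exp (min 0 (?l j)))"
  proof -
    have "decseq (\<lambda>n. \<Prod>j<n. exp (min 0 (?l j)))"
      by (rule decseq_SucI) (auto intro!: mult_left_le prod_nonneg)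
    moreover have "\<forall>n. 0 \<le> (\<Prod>j<n. exp (min 0 (?l j)))" by (intro allI prod_nonneg) auto
    ultimately obtain L where "(\<lambda>n. \<Prod>j<n. exp (min 0 (?l j))) \<longlonglongrightarrow> L"
      by (rule decseq_convergent)
    then show ?thesis by (rule convergentI)
  qed
  ultimately have "convergent (\<lambda>n. \<Prod>j<n. b j - a j)"
    by (auto intro: convergent_mult)
  then show ?thesis by (simp add: vol_def convergent_LIMSEQ_iff)
qed

section \<open>Nonempty blocks and their intersections\<close>

context orthonormal_seq
begin

text \<open>Nonemptiness is a genuine condition: the sides \<open>[1, 2)\<close> give the product 1,
  yet no vector has all coordinates in them, so the measure must be 0.\<close>

definition proper :: "(nat \<Rightarrow> real) \<Rightarrow> (nat \<Rightarrow> real) \<Rightarrow> bool" where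
  "proper a b \<longleftrightarrow> block_bounds a b \<and> block e a b \<noteq> {} \<and> summable (\<lambda>j. max 0 (ln (b j - a j)))"

lemma proper_iff: "proper a b \<longleftrightarrow> abs_measurable e a b \<and> block e a b \<noteq> {}"
  by (auto simp: proper_def abs_measurable_def)

lemma proper_less: "proper a b \<Longrightarrow> a j < b j"
  by (simp add: proper_def block_bounds_def)

lemma proper_vol: "proper a b \<Longrightarrow> (\<lambda>n. \<Prod>j<n. b j - a j) \<longlonglongrightarrow> vol a b"
  by (auto simp: proper_def intro: prod_sides_tendsto_vol)

lemma vol_nonneg: "proper a b \<Longrightarrow> 0 \<le> vol a b"
  by (rule LIMSEQ_le_const[OF proper_vol[of a b]])
    (assumption, intro exI[of _ 0] allI impI prod_nonneg, simp add: proper_less less_imp_le)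

lemma am_blocks_cases:
  assumes "A \<in> am_blocks e"
  obtains "A = {}" | a b where "A = block e a b" "proper a b"
  using assms by (auto simp: am_blocks_def proper_iff)

lemma proper_block_ring: "proper a b \<Longrightarrow> block e a b \<in> block_ring e"
  by (auto simp: block_ring_def proper_iff am_blocks_def intro!: hull_inc)

sublocale block_ring: ring_of_sets UNIV "block_ring e"
  unfolding block_ring_def by (rule ring_of_sets_hull)

lemma block_Int:
  "block e a b \<inter> block e a' b' = block e (\<lambda>j. max (a j) (a' j)) (\<lambda>j. min (b j) (b' j))"
  by (auto simp: block_def)

text \<open>A common point makes the new lower bounds strictly smaller than the new upper bounds;
  the sides only shrink, so summability of the positive logarithms is inherited by
  comparison.\<close>

lemma proper_Int:
  assumes P: "proper a b" and Q: "proper a' b'" and ne: "block e a b \<inter> block e a' b' \<noteq> {}"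
  shows "proper (\<lambda>j. max (a j) (a' j)) (\<lambda>j. min (b j) (b' j))"
  unfolding proper_def
proof (intro conjI)
  obtain x where x: "x \<in> block e a b" "x \<in> block e a' b'" using ne by blast
  then have less: "max (a j) (a' j) < min (b j) (b' j)" for j
    by (auto simp: block_def) (meson le_less_trans)+
  have bd: "bounded (range (\<lambda>j. max (f j) (g j)))" "bounded (range (\<lambda>j. min (f j) (g j)))"
    if "bounded (range f)" "bounded (range g)" for f g :: "nat \<Rightarrow> real"
  proof -
    from that obtain B C where "\<And>j. \<bar>f j\<bar> \<le> B" "\<And>j. \<bar>g j\<bar> \<le> C"
      by (auto simp: bounded_iff)
    then have "\<bar>max (f j) (g j)\<bar> \<le> max B C" "\<bar>min (f j) (g j)\<bar> \<le> max B C" for j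
      by (metis le_max_iff_disj max_def, metis le_max_iff_disj min_def)
    then show "bounded (range (\<lambda>j. max (f j) (g j)))" "bounded (range (\<lambda>j. min (f j) (g j)))"
      by (auto simp: bounded_iff)
  qed
  show "block_bounds (\<lambda>j. max (a j) (a' j)) (\<lambda>j. min (b j) (b' j))"
    using P Q less bd by (auto simp: proper_def block_bounds_def)
  show "block e (\<lambda>j. max (a j) (a' j)) (\<lambda>j. min (b j) (b' j)) \<noteq> {}"
    using ne by (simp add: block_Int)
  show "summable (\<lambda>j. max 0 (ln (min (b j) (b' j) - max (a j) (a' j))))"
  proof (rule summable_comparison_test')
    show "summable (\<lambda>j. max 0 (ln (b j - a j)))" using P by (simp add: proper_def)
    fix j
    have "ln (min (b j) (b' j) - max (a j) (a' j)) \<le> ln (b j - a j)"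
      using less[of j] by (subst ln_le_cancel_iff) auto
    then show "norm (max 0 (ln (min (b j) (b' j) - max (a j) (a' j)))) \<le> max 0 (ln (b j - a j))"
      by auto
  qed
qed

lemma am_blocks_Int:
  assumes "A \<in> am_blocks e" "B \<in> am_blocks e"
  shows "A \<inter> B \<in> insert {} (am_blocks e)"
proof (cases "A \<inter> B = {}")
  case False
  then obtain a b a' b' where AB: "A = block e a b" "proper a b" "B = block e a' b'" "proper a' b'"
    using assms by (elim am_blocks_cases) auto
  have "proper (\<lambda>j. max (a j) (a' j)) (\<lambda>j. min (b j) (b' j))"
    using AB False by (intro proper_Int) auto
  then show ?thesis
    unfolding AB block_Int by (auto simp: am_blocks_def proper_iff)
qed simp

text \<open>Coordinatewise overlapping blocks have a common point: the median of a point of the one, a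
  point of the other and a common sequence lies coordinatewise in both blocks and is dominated by
  the two points, hence square summable.\<close>

lemma common_point:
  assumes "finite \<P>" "\<And>a b. (a, b) \<in> \<P> \<Longrightarrow> block e a b \<noteq> {} \<and> z \<in> seq_box a b"
  shows "\<exists>x. \<forall>(a, b)\<in>\<P>. x \<in> block e a b"
  using assms
proof (induction \<P> rule: finite_induct)
  case (insert p \<P>)
  obtain a b where p: "p = (a, b)" by (cases p)
  obtain x where x: "\<And>a b. (a, b) \<in> \<P> \<Longrightarrow> x \<in> block e a b"
    using insert by force
  obtain y where y: "y \<in> block e a b" using insert.prems[of a b] by (auto simp: p)
  let ?m = "\<lambda>k. median (x \<bullet> e k) (y \<bullet> e k) (z k)"
  have sq: "(?m k)\<^sup>2 \<le> (x \<bullet> e k)\<^sup>2 + (y \<bullet> e k)\<^sup>2" for k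
  proof -
    have "\<bar>?m k\<bar> \<le> \<bar>x \<bullet> e k\<bar> \<or> \<bar>?m k\<bar> \<le> \<bar>y \<bullet> e k\<bar>"
      unfolding median_def by linarith
    then have "(?m k)\<^sup>2 \<le> (x \<bullet> e k)\<^sup>2 \<or> (?m k)\<^sup>2 \<le> (y \<bullet> e k)\<^sup>2"
      unfolding abs_le_square_iff .
    moreover have "0 \<le> (x \<bullet> e k)\<^sup>2" "0 \<le> (y \<bullet> e k)\<^sup>2" by simp_all
    ultimately show ?thesis by linarith
  qed
  have "summable (\<lambda>k. (?m k)\<^sup>2)"
  proof (rule summable_comparison_test')
    show "summable (\<lambda>k. (x \<bullet> e k)\<^sup>2 + (y \<bullet> e k)\<^sup>2)"
      by (intro summable_add summable_coord_sq)
    show "norm ((?m k)\<^sup>2) \<le> (x \<bullet> e k)\<^sup>2 + (y \<bullet> e k)\<^sup>2" for k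
      unfolding real_norm_def abs_power2 by (rule sq)
  qed
  then obtain w where w: "\<And>k. w \<bullet> e k = ?m k" by (rule Riesz_Fischer) blast
  have "w \<in> block e a' b'" if "(a', b') \<in> insert p \<P>" for a' b'
  proof -
    have z: "a' k \<le> z k" "z k < b' k" for k
      using insert.prems[of a' b'] that by (auto simp: seq_box_def)
    \<comment> \<open>By induction \<open>x\<close> lies in every old block and \<open>y\<close> in
      the new one. In each block two of the three arguments of the median, namely \<open>z\<close>
      and one of the points, satisfy every coordinate constraint; hence so does the median.\<close>
    have "(x \<in> block e a' b') \<or> (y \<in> block e a' b')"
      using that x y by (auto simp: p)
    then show ?thesis
    proof
      assume *: "x \<in> block e a' b'"
      have "a' k \<le> ?m k \<and> ?m k < b' k" for k
      proof -
        have "a' k \<le> x \<bullet> e k" "x \<bullet> e k < b' k" using * by (auto simp: block_def)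
        with z[of k] show ?thesis unfolding median_def by linarith
      qed
      then show ?thesis by (simp add: block_def w)
    next
      assume *: "y \<in> block e a' b'"
      have "a' k \<le> ?m k \<and> ?m k < b' k" for k
      proof -
        have "a' k \<le> y \<bullet> e k" "y \<bullet> e k < b' k" using * by (auto simp: block_def)
        with z[of k] show ?thesis unfolding median_def by linarith
      qed
      then show ?thesis by (simp add: block_def w)
    qed
  qed
  then show ?case by auto
qed simp

text \<open>The lift of the block ring to subsets of the sequence space, on which countably additive product
  measures exist. A sequence \<open>z\<close> need not be square summable, so its membership in the lift of \<open>S\<close> is
  decided by the points of the Hilbert space that agree with \<open>z\<close> on finitely many coordinates and lie
  in finitely many blocks containing \<open>z\<close>; for \<open>S\<close> in the block ring exactly one of \<open>S\<close> and \<open>- S\<close> is near \<open>z\<close>.\<close>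

definition near :: "(nat \<Rightarrow> real) \<Rightarrow> 'e set \<Rightarrow> bool" where
  "near z S \<longleftrightarrow> (\<exists>J \<P>. finite J \<and> finite \<P> \<and>
     (\<forall>(a, b)\<in>\<P>. block e a b \<noteq> {} \<and> z \<in> seq_box a b) \<and>
     (\<forall>x. (\<forall>j\<in>J. x \<bullet> e j = z j) \<longrightarrow> (\<forall>(a, b)\<in>\<P>. x \<in> block e a b) \<longrightarrow> x \<in> S))"

text \<open>A finite condition around \<open>z\<close> is always met: take a common point of the
  finitely many blocks and overwrite its finitely many prescribed coordinates with those of
  \<open>z\<close>. It stays in the blocks because \<open>z\<close> lies in their boxes.\<close>

lemma not_near_empty: "\<not> near z {}"
proof
  assume "near z {}"
  then obtain J \<P> where J: "finite J" "finite \<P>"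
    and ne: "\<forall>(a, b)\<in>\<P>. block e a b \<noteq> {} \<and> z \<in> seq_box a b"
    and no: "\<forall>x. (\<forall>j\<in>J. x \<bullet> e j = z j) \<longrightarrow> (\<forall>(a, b)\<in>\<P>. x \<in> block e a b) \<longrightarrow> x \<in> {}"
    unfolding near_def by (elim exE conjE)
  have J3: "block e a b \<noteq> {} \<and> z \<in> seq_box a b" if "(a, b) \<in> \<P>" for a b
    using ne that by blast
  obtain x where x: "\<forall>(a, b)\<in>\<P>. x \<in> block e a b"
    using common_point[OF J(2) J3] by blast
  let ?y = "x + (\<Sum>k\<in>J. (z k - x \<bullet> e k) *\<^sub>R e k)"
  have y: "?y \<bullet> e j = (if j \<in> J then z j else x \<bullet> e j)" for j
    by (simp add: inner_add_left inner_sum_basis[OF J(1)])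
  have "\<forall>j\<in>J. ?y \<bullet> e j = z j" by (simp add: y)
  moreover have "\<forall>(a, b)\<in>\<P>. ?y \<in> block e a b"
  proof (intro ballI, clarify)
    fix a b assume "(a, b) \<in> \<P>"
    with x J3 have "x \<in> block e a b" "z \<in> seq_box a b" by auto
    then show "?y \<in> block e a b" unfolding block_def seq_box_def mem_Collect_eq y by simp
  qed
  ultimately show False using no by blast
qed

lemma near_mono: "near z S \<Longrightarrow> S \<subseteq> T \<Longrightarrow> near z T"
  unfolding near_def by (meson subsetD)

lemma near_Int:
  assumes "near z S" "near z T"
  shows "near z (S \<inter> T)"
proof -
  obtain J \<P> where 1: "finite J" "finite \<P>"
    "\<forall>(a, b)\<in>\<P>. block e a b \<noteq> {} \<and> z \<in> seq_box a b"
    "\<forall>x. (\<forall>j\<in>J. x \<bullet> e j = z j) \<longrightarrow> (\<forall>(a, b)\<in>\<P>. x \<in> block e a b) \<longrightarrow> x \<in> S"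
    using assms(1) unfolding near_def by blast
  obtain K \<Q> where 2: "finite K" "finite \<Q>"
    "\<forall>(a, b)\<in>\<Q>. block e a b \<noteq> {} \<and> z \<in> seq_box a b"
    "\<forall>x. (\<forall>j\<in>K. x \<bullet> e j = z j) \<longrightarrow> (\<forall>(a, b)\<in>\<Q>. x \<in> block e a b) \<longrightarrow> x \<in> T"
    using assms(2) unfolding near_def by blast
  show ?thesis
    unfolding near_def
    using 1 2 by (intro exI[of _ "J \<union> K"] exI[of _ "\<P> \<union> \<Q>"]) auto
qed

lemma near_contradiction: "near z S \<Longrightarrow> near z (- S) \<Longrightarrow> False"
  using near_Int[of z S "- S"] not_near_empty by simp

lemma near_UNIV: "near z UNIV"
  unfolding near_def by (intro exI[of _ "{}"]) simp

text \<open>Explains the two kinds of conditions in \<open>near\<close>: membership in a box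
  involves all coordinates and is certified by the block itself, whereas non-membership is certified
  by a single violating coordinate.\<close>

lemma near_block_iff:
  assumes "block e a b \<noteq> {}"
  shows "near z (block e a b) \<longleftrightarrow> z \<in> seq_box a b"
    and "near z (- block e a b) \<longleftrightarrow> z \<notin> seq_box a b"
proof -
  have 1: "near z (block e a b)" if "z \<in> seq_box a b"
    unfolding near_def using that assms
    by (intro exI[of _ "{}"] exI[of _ "{(a, b)}"]) auto
  have 2: "near z (- block e a b)" if notin: "z \<notin> seq_box a b"
  proof -
    obtain j where "\<not> (a j \<le> z j \<and> z j < b j)" using notin by (auto simp: seq_box_def)
    then show ?thesis
      unfolding near_def
      by (intro exI[of _ "{j}"] exI[of _ "{}"]) (auto simp: block_def intro!: exI[of _ j])
  qed
  show "near z (block e a b) \<longleftrightarrow> z \<in> seq_box a b" "near z (- block e a b) \<longleftrightarrow> z \<notin> seq_box a b"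
    using 1 2 near_contradiction by blast+
qed

text \<open>The sets near \<open>z\<close> form a proper filter; on the ring it behaves like an
  ultrafilter, because generators are decided and unions and differences preserve this. Hence
  \<open>lift\<close> respects all ring operations.\<close>

lemma near_decided:
  assumes "A \<in> block_ring e"
  shows "near z A \<or> near z (- A)"
  using assms unfolding block_ring_def
proof (induction rule: ring_hull_induct)
  case (basic A)
  then show ?case
    by (cases rule: am_blocks_cases) (auto simp: near_UNIV near_block_iff proper_def)
next
  case (union A B)
  then show ?case
    by (metis Compl_Un near_Int near_mono sup_ge1 sup_ge2)
next
  case (diff A B)
  have "- A \<subseteq> - (A - B)" "B \<subseteq> - (A - B)" "A - B = A \<inter> - B" by auto
  with diff show ?case by (metis near_Int near_mono)
qed (simp add: near_UNIV)

definition lift :: "'e set \<Rightarrow> (nat \<Rightarrow> real) set" where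
  "lift A = {z. near z A}"

lemma lift_empty [simp]: "lift {} = {}"
  by (simp add: lift_def not_near_empty)

lemma lift_Int: "lift (A \<inter> B) = lift A \<inter> lift B"
  by (auto simp: lift_def intro: near_Int near_mono)

lemma lift_Un:
  assumes "A \<in> block_ring e" "B \<in> block_ring e"
  shows "lift (A \<union> B) = lift A \<union> lift B"
proof -
  have "near z A \<or> near z B" if "near z (A \<union> B)" for z
  proof (rule ccontr)
    assume "\<not> ?thesis"
    then have "near z (- A \<inter> - B)" using near_decided assms by (blast intro: near_Int)
    with that show False using near_contradiction by (metis Compl_Un)
  qed
  then show ?thesis by (auto simp: lift_def intro: near_mono)
qed

lemma lift_Diff:
  assumes "A \<in> block_ring e" "B \<in> block_ring e"
  shows "lift (A - B) = lift A - lift B"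
proof -
  have "lift (A - B) = lift A \<inter> lift (- B)"
    by (simp add: Diff_eq lift_Int)
  also have "lift (- B) = - lift B"
    using near_decided[OF assms(2)] near_contradiction by (auto simp: lift_def)
  finally show ?thesis by (simp add: Diff_eq)
qed

lemma lift_block: "block e a b \<noteq> {} \<Longrightarrow> lift (block e a b) = seq_box a b"
  by (auto simp: lift_def near_block_iff)

lemma seq_box_measurable: "seq_box a b \<in> sets (PiM UNIV (\<lambda>_. borel))"
proof -
  have "seq_box a b = {z \<in> space (PiM UNIV (\<lambda>_::nat. borel)). \<forall>j. a j \<le> z j \<and> z j < b j}"
    by (simp add: seq_box_def space_PiM)
  also have "\<dots> \<in> sets (PiM UNIV (\<lambda>_. borel))" by measurable
  finally show ?thesis .
qed

lemma lift_measurable: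
  assumes "A \<in> block_ring e"
  shows "lift A \<in> sets (PiM UNIV (\<lambda>_. borel))"
  using assms unfolding block_ring_def
proof (induction rule: ring_hull_induct)
  case (basic A)
  then show ?case
    by (cases rule: am_blocks_cases) (auto simp: lift_block proper_def seq_box_measurable)
qed (auto simp: lift_Un lift_Diff simp flip: block_ring_def)

end

section \<open>Products of uniform distributions carried to boxes\<close>

definition unit_uniform :: "real measure" where
  "unit_uniform = uniform_measure lborel {0..<1}"

definition cube :: "(nat \<Rightarrow> real) measure" where
  "cube = PiM UNIV (\<lambda>_. unit_uniform)"

text \<open>It pushes \<open>cube\<close> forward to the product of the uniform distributions on the
  sides. Working with probabilities and multiplying by \<open>vol a b\<close> afterwards avoids
  infinite products of Lebesgue measures.\<close>

definition affine_seq :: "(nat \<Rightarrow> real) \<Rightarrow> (nat \<Rightarrow> real) \<Rightarrow> (nat \<Rightarrow> real) \<Rightarrow> nat \<Rightarrow> real" where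
  "affine_seq a b \<omega> = (\<lambda>j. a j + (b j - a j) * \<omega> j)"

lemma prob_space_unit_uniform: "prob_space unit_uniform"
  unfolding unit_uniform_def by (rule prob_space_uniform_measure) auto

lemma sets_unit_uniform [measurable_cong, simp]: "sets unit_uniform = sets borel"
  by (simp add: unit_uniform_def)

lemma space_cube [simp]: "space cube = UNIV"
  by (simp add: cube_def space_PiM unit_uniform_def)

interpretation cube: prob_space cube
  unfolding cube_def by (intro prob_space_PiM prob_space_unit_uniform)

lemma affine_seq_measurable: "affine_seq a b \<in> measurable cube (PiM UNIV (\<lambda>_. borel))"
  unfolding affine_seq_def cube_def
  by (rule measurable_PiM_single') (auto simp: space_PiM)

lemma affine_seq_vimage_measurable:
  "S \<in> sets (PiM UNIV (\<lambda>_. borel)) \<Longrightarrow> affine_seq a b -` S \<in> sets cube"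
  using measurable_sets[OF affine_seq_measurable[of a b], of S] by simp

text \<open>Each factor is the uniform probability that the coordinate falls into the other side;
  the measure of an infinite product set is the limit of the finite products.\<close>

lemma measure_affine_seq_box:
  assumes "\<And>j. a j < b j"
  shows "(\<lambda>n. \<Prod>j<n. max 0 (min (b j) (b' j) - max (a j) (a' j)) / (b j - a j))
           \<longlonglongrightarrow> measure cube (affine_seq a b -` seq_box a' b')"
proof -
  interpret sequence_space unit_uniform
    using prob_space_unit_uniform
    by (auto simp: sequence_space_def product_prob_space_def product_prob_space_axioms_def
        product_sigma_finite_def intro: prob_space_imp_sigma_finite)
  let ?E = "\<lambda>j. {(a' j - a j) / (b j - a j) ..< (b' j - a j) / (b j - a j)}"
  have m: "measure unit_uniform (?E j) = max 0 (min (b j) (b' j) - max (a j) (a' j)) / (b j - a j)" for j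
  proof -
    have pos: "0 < b j - a j" using assms[of j] by simp
    let ?l = "max 0 ((a' j - a j) / (b j - a j))"
    let ?u = "min 1 ((b' j - a j) / (b j - a j))"
    have "measure unit_uniform (?E j) = measure lborel ({0..<1} \<inter> ?E j) / measure lborel {0..<1::real}"
      unfolding unit_uniform_def by (rule measure_uniform_measure) auto
    also have "{0..<1} \<inter> ?E j = {?l..<?u}" by auto
    also have "measure lborel {0..<1::real} = 1" by simp
    also have "measure lborel {?l..<?u} = max 0 (?u - ?l)"
      by (cases "?l \<le> ?u") auto
    also have "?u = (min (b j) (b' j) - a j) / (b j - a j)"
      using pos by (auto simp: min_def field_simps)
    also have "?l = (max (a j) (a' j) - a j) / (b j - a j)"
      using pos by (auto simp: max_def field_simps)
    also have "(min (b j) (b' j) - a j) / (b j - a j) - (max (a j) (a' j) - a j) / (b j - a j) =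
        (min (b j) (b' j) - max (a j) (a' j)) / (b j - a j)"
      by (simp add: diff_divide_distrib)
    also have "max 0 \<dots> = max 0 (min (b j) (b' j) - max (a j) (a' j)) / (b j - a j)"
      using pos by (auto simp: max_def divide_le_0_iff zero_le_divide_iff)
    finally show ?thesis by simp
  qed
  have "affine_seq a b -` seq_box a' b' = Pi UNIV ?E"
    using assms by (auto simp: affine_seq_def seq_box_def Pi_iff field_simps)
  moreover have "(\<lambda>n. \<Prod>j\<le>n. measure unit_uniform (?E j)) \<longlonglongrightarrow> measure cube (Pi UNIV ?E)"
    unfolding cube_def by (rule measure_PiM_countable) auto
  \<comment> \<open>The products in the fact just obtained run over \<open>j \<le> n\<close>, those
    in the claim over \<open>j < n\<close>; the limit is moved by one index.\<close>
  ultimately show ?thesis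
    by (subst filterlim_sequentially_Suc[symmetric]) (simp add: m lessThan_Suc_atMost)
qed

context orthonormal_seq
begin

text \<open>Each block carries the image of the product measure; these measures agree on intersections and
  are glued along finite covers.\<close>

definition chart :: "(nat \<Rightarrow> real) \<times> (nat \<Rightarrow> real) \<Rightarrow> 'e set \<Rightarrow> real" where
  "chart = (\<lambda>(a, b) A. vol a b * measure cube (affine_seq a b -` lift A))"

lemma chart_nonneg: "proper a b \<Longrightarrow> 0 \<le> chart (a, b) A"
  by (simp add: chart_def vol_nonneg)

lemma chart_empty [simp]: "chart p {} = 0"
  by (simp add: chart_def split: prod.split)

lemma chart_Un:
  assumes "A \<in> block_ring e" "B \<in> block_ring e" "A \<inter> B = {}"
  shows "chart p (A \<union> B) = chart p A + chart p B"
proof -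
  obtain a b where p: "p = (a, b)" by (cases p)
  have "lift A \<inter> lift B = {}" using assms(3) by (simp flip: lift_Int)
  then have "measure cube (affine_seq a b -` lift A \<union> affine_seq a b -` lift B) =
      measure cube (affine_seq a b -` lift A) + measure cube (affine_seq a b -` lift B)"
    using assms by (intro cube.finite_measure_Union affine_seq_vimage_measurable lift_measurable) auto
  then show ?thesis
    using assms by (simp add: chart_def p lift_Un distrib_left)
qed

text \<open>Volume times probability cancels factor by factor into the sides of the inner block. The
  cancellation happens before passing to the limit, so a vanishing \<open>vol a b\<close> causes no
  trouble.\<close>

lemma chart_block:
  assumes P: "proper a b" and Q: "proper a' b'" and sub: "block e a' b' \<subseteq> block e a b"
  shows "chart (a, b) (block e a' b') = vol a' b'"
proof (rule LIMSEQ_unique)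
  have bd: "a j \<le> a' j" "b' j \<le> b j" for j
  proof -
    obtain x where x: "x \<in> block e a' b'" using Q by (auto simp: proper_def)
    \<comment> \<open>Inclusion of blocks forces inclusion of each side: replace the
      \<open>j\<close>-th coordinate of a point of the inner block by an arbitrary \<open>s\<close>
      of its side.\<close>
    have *: "a j \<le> s \<and> s < b j" if "a' j \<le> s" "s < b' j" for s
    proof -
      let ?y = "x + (s - x \<bullet> e j) *\<^sub>R e j"
      have "?y \<bullet> e k = (if k = j then s else x \<bullet> e k)" for k
        by (simp add: inner_add_left orth)
      then have "?y \<in> block e a' b'" using x that by (auto simp: block_def)
      with sub have "?y \<in> block e a b" by blast
      then show ?thesis by (auto simp: block_def inner_add_left orth dest: spec[of _ j])
    qed
    show "a j \<le> a' j" using *[of "a' j"] proper_less[OF Q, of j] by simp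
    show "b' j \<le> b j"
    proof (rule dense_le_bounded[OF proper_less[OF Q, of j]])
      show "s \<le> b j" if "a' j < s" "s < b' j" for s using *[of s] that by simp
    qed
  qed
  have lim: "(\<lambda>n. \<Prod>j<n. max 0 (min (b j) (b' j) - max (a j) (a' j)) / (b j - a j))
      \<longlonglongrightarrow> measure cube (affine_seq a b -` seq_box a' b')"
    by (rule measure_affine_seq_box) (rule proper_less[OF P])
  have "(\<lambda>n. (\<Prod>j<n. b j - a j) * (\<Prod>j<n. max 0 (min (b j) (b' j) - max (a j) (a' j)) / (b j - a j)))
      \<longlonglongrightarrow> chart (a, b) (block e a' b')"
    using tendsto_mult[OF proper_vol[OF P] lim] Q by (simp add: chart_def lift_block proper_def)
  moreover have "(\<Prod>j<n. b j - a j) * (\<Prod>j<n. max 0 (min (b j) (b' j) - max (a j) (a' j)) / (b j - a j)) =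
      (\<Prod>j<n. b' j - a' j)" for n
    unfolding prod.distrib[symmetric]
  proof (intro prod.cong refl)
    fix j
    have "min (b j) (b' j) = b' j" "max (a j) (a' j) = a' j" "0 < b j - a j" "0 < b' j - a' j"
      using bd[of j] proper_less[OF P, of j] proper_less[OF Q, of j] by auto
    then show "(b j - a j) * (max 0 (min (b j) (b' j) - max (a j) (a' j)) / (b j - a j)) = b' j - a' j"
      by simp
  qed
  ultimately show "(\<lambda>n. \<Prod>j<n. b' j - a' j) \<longlonglongrightarrow> chart (a, b) (block e a' b')"
    by simp
qed (rule proper_vol[OF Q])

lemma block_ring_eqI:
  fixes \<mu> \<nu> :: "'e set \<Rightarrow> real"
  assumes "A \<in> block_ring e"
    and "additive (block_ring e) \<mu>" "additive (block_ring e) \<nu>"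
    and eq: "\<And>a b. proper a b \<Longrightarrow> \<mu> (block e a b) = \<nu> (block e a b)"
  shows "\<mu> A = \<nu> A"
proof -
  have e0: "\<mu> {} = \<nu> {}"
    using assms(2,3)[unfolded additive_def, THEN bspec, THEN bspec, of "{}" "{}"] by simp
  have "\<mu> A = \<nu> A" if "A \<in> am_blocks e" for A
    using that by (cases rule: am_blocks_cases) (auto simp: eq e0)
  then show ?thesis
    by (intro additive_hull_eqI[OF assms(1)[unfolded block_ring_def] am_blocks_Int
          assms(2,3)[unfolded block_ring_def]])
qed

text \<open>The charts agree on a block only if both contain it. Intersecting with \<open>?S\<close>
  arranges this for every block and keeps additivity, so uniqueness applies; on blocks both charts
  give the volume of a triple intersection.\<close>

lemma chart_eq:
  assumes A: "A \<in> block_ring e" and P: "proper a b" and Q: "proper a' b'"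
    and sub: "A \<subseteq> block e a b" "A \<subseteq> block e a' b'"
  shows "chart (a, b) A = chart (a', b') A"
proof -
  let ?S = "block e a b \<inter> block e a' b'"
  have S: "?S \<in> block_ring e"
    using P Q by (intro block_ring.Int proper_block_ring)
  have add: "additive (block_ring e) (\<lambda>A. chart p (A \<inter> ?S))" for p
    unfolding additive_def
  proof (intro ballI impI)
    fix A B assume "A \<in> block_ring e" "B \<in> block_ring e" "A \<inter> B = {}"
    then show "chart p ((A \<union> B) \<inter> ?S) = chart p (A \<inter> ?S) + chart p (B \<inter> ?S)"
      unfolding Int_Un_distrib2 using block_ring.Int[OF _ S] by (intro chart_Un) auto
  qed
  have "chart (a, b) (A \<inter> ?S) = chart (a', b') (A \<inter> ?S)"
  proof (rule block_ring_eqI[OF A add add])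
    fix c d assume R: "proper c d"
    show "chart (a, b) (block e c d \<inter> ?S) = chart (a', b') (block e c d \<inter> ?S)"
    proof (cases "block e c d \<inter> ?S = {}")
      case False
      have "proper (\<lambda>j. max (a j) (a' j)) (\<lambda>j. min (b j) (b' j))"
        using False by (intro proper_Int[OF P Q]) auto
      from proper_Int[OF R this]
      have "proper (\<lambda>j. max (c j) (max (a j) (a' j))) (\<lambda>j. min (d j) (min (b j) (b' j)))"
        using False by (auto simp: block_Int)
      moreover have "block e c d \<inter> ?S =
          block e (\<lambda>j. max (c j) (max (a j) (a' j))) (\<lambda>j. min (d j) (min (b j) (b' j)))"
        by (simp add: block_Int)
      ultimately show ?thesis
        using chart_block[OF P, of "\<lambda>j. max (c j) (max (a j) (a' j))"]
          chart_block[OF Q, of "\<lambda>j. max (c j) (max (a j) (a' j))"]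
        by (metis (no_types, lifting) Int_lower1 Int_lower2 order_trans)
    qed simp
  qed
  moreover have "A \<inter> ?S = A" using sub by blast
  ultimately show ?thesis by simp
qed

section \<open>Gluing the charts along finite covers\<close>

fun glue :: "((nat \<Rightarrow> real) \<times> (nat \<Rightarrow> real)) list \<Rightarrow> 'e set \<Rightarrow> real" where
  "glue [] A = 0"
| "glue (p # ps) A = chart p (A \<inter> block e (fst p) (snd p)) + glue ps (A - block e (fst p) (snd p))"

definition cover :: "((nat \<Rightarrow> real) \<times> (nat \<Rightarrow> real)) list \<Rightarrow> 'e set \<Rightarrow> bool" where
  "cover ps A \<longleftrightarrow> (\<forall>p\<in>set ps. proper (fst p) (snd p)) \<and> A \<subseteq> (\<Union>p\<in>set ps. block e (fst p) (snd p))"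

lemma cover_Cons:
  "cover (p # ps) A \<longleftrightarrow> proper (fst p) (snd p) \<and> cover ps (A - block e (fst p) (snd p))"
  by (auto simp: cover_def)

lemma cover_subset: "cover ps A \<Longrightarrow> B \<subseteq> A \<Longrightarrow> cover ps B"
  by (auto simp: cover_def)

lemma cover_exists:
  assumes "A \<in> block_ring e"
  shows "\<exists>ps. cover ps A"
  using assms unfolding block_ring_def
proof (induction rule: ring_hull_induct)
  case (basic A)
  then show ?case
  proof (cases rule: am_blocks_cases)
    case (2 a b)
    then show ?thesis by (intro exI[of _ "[(a, b)]"]) (simp add: cover_def)
  qed (auto simp: cover_def intro: exI[of _ "[]"])
next
  case (union A B)
  then obtain ps qs where "cover ps A" "cover qs B" by blast
  then show ?case by (intro exI[of _ "ps @ qs"]) (auto simp: cover_def)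
next
  case (diff A B)
  then show ?case by (meson cover_subset Diff_subset)
qed (auto simp: cover_def intro: exI[of _ "[]"])

lemma glue_empty [simp]: "glue ps {} = 0"
  by (induction ps) auto

lemma glue_nonneg: "cover ps A \<Longrightarrow> 0 \<le> glue ps A"
proof (induction ps arbitrary: A)
  case (Cons p ps)
  then show ?case using chart_nonneg[of "fst p" "snd p"] by (auto simp: cover_Cons intro: add_nonneg_nonneg)
qed simp

lemma glue_Un:
  assumes "A \<in> block_ring e" "B \<in> block_ring e" "A \<inter> B = {}" "cover ps (A \<union> B)"
  shows "glue ps (A \<union> B) = glue ps A + glue ps B"
  using assms
proof (induction ps arbitrary: A B)
  case (Cons p ps)
  let ?P = "block e (fst p) (snd p)"
  have P: "?P \<in> block_ring e" using Cons.prems(4) by (auto simp: cover_Cons proper_block_ring)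
  have "chart p ((A \<inter> ?P) \<union> (B \<inter> ?P)) = chart p (A \<inter> ?P) + chart p (B \<inter> ?P)"
    using Cons.prems P by (intro chart_Un) auto
  moreover have "glue ps ((A - ?P) \<union> (B - ?P)) = glue ps (A - ?P) + glue ps (B - ?P)"
    using Cons.prems P by (intro Cons.IH) (auto simp: cover_Cons Un_Diff)
  ultimately show ?case by (simp add: Int_Un_distrib2 Un_Diff)
qed simp

text \<open>The pieces cut out by the cover all lie in one block, whose chart may replace every
  other chart by \<open>chart_eq\<close> and then adds the pieces up.\<close>

lemma glue_eq_chart:
  assumes "A \<in> block_ring e" "cover ps A" "proper a b" "A \<subseteq> block e a b"
  shows "glue ps A = chart (a, b) A"
  using assms
proof (induction ps arbitrary: A)
  case Nil
  then show ?case by (simp add: cover_def)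
next
  case (Cons p ps)
  let ?P = "block e (fst p) (snd p)"
  have p: "proper (fst p) (snd p)" using Cons.prems by (simp add: cover_Cons)
  then have P: "?P \<in> block_ring e" by (rule proper_block_ring)
  have "chart (fst p, snd p) (A \<inter> ?P) = chart (a, b) (A \<inter> ?P)"
    using Cons.prems p P by (intro chart_eq) auto
  moreover have "glue ps (A - ?P) = chart (a, b) (A - ?P)"
    using Cons.prems P by (intro Cons.IH) (auto simp: cover_Cons)
  moreover have "chart (a, b) ((A \<inter> ?P) \<union> (A - ?P)) = chart (a, b) (A \<inter> ?P) + chart (a, b) (A - ?P)"
    using Cons.prems P by (intro chart_Un) auto
  ultimately show ?case by (simp add: Int_Diff_Un)
qed

text \<open>Independence of the cover, by peeling the head \<open>?Q\<close> off the second one.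
  Inside \<open>?Q\<close> the first gluing is the chart of \<open>?Q\<close>; outside, the
  induction hypothesis applies.\<close>

lemma glue_eq:
  assumes "A \<in> block_ring e" "cover ps A" "cover qs A"
  shows "glue ps A = glue qs A"
  using assms
proof (induction qs arbitrary: A)
  case Nil
  then show ?case by (simp add: cover_def)
next
  case (Cons q qs)
  let ?Q = "block e (fst q) (snd q)"
  have q: "proper (fst q) (snd q)" using Cons.prems by (simp add: cover_Cons)
  then have Q: "?Q \<in> block_ring e" by (rule proper_block_ring)
  have "glue ps ((A \<inter> ?Q) \<union> (A - ?Q)) = glue ps (A \<inter> ?Q) + glue ps (A - ?Q)"
    using Cons.prems Q by (intro glue_Un) (auto simp: Int_Diff_Un)
  moreover have "glue ps (A \<inter> ?Q) = chart (fst q, snd q) (A \<inter> ?Q)"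
    using Cons.prems Q q by (intro glue_eq_chart) (auto elim: cover_subset)
  moreover have "glue ps (A - ?Q) = glue qs (A - ?Q)"
    using Cons.prems Q by (intro Cons.IH) (auto simp: cover_Cons elim: cover_subset)
  ultimately show ?case by (simp add: Int_Diff_Un)
qed

definition glued :: "'e set \<Rightarrow> real" where
  "glued A = glue (SOME ps. cover ps A) A"

lemma glued_eq:
  assumes "A \<in> block_ring e" "cover ps A"
  shows "glued A = glue ps A"
  unfolding glued_def by (rule glue_eq[OF assms(1) someI[of "\<lambda>ps. cover ps A"]]) (rule assms(2))+

lemma glued_Un:
  assumes "A \<in> block_ring e" "B \<in> block_ring e" "A \<inter> B = {}"
  shows "glued (A \<union> B) = glued A + glued B"
proof -
  obtain ps where ps: "cover ps (A \<union> B)"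
    using cover_exists[of "A \<union> B"] assms by blast
  then have "cover ps A" "cover ps B" by (auto elim: cover_subset)
  then show ?thesis
    using assms ps glue_Un[OF assms ps] by (simp add: glued_eq[of _ ps] block_ring.Un)
qed

lemma glued_block: "proper a b \<Longrightarrow> glued (block e a b) = vol a b"
  using glued_eq[OF proper_block_ring, of a b "[(a, b)]"] chart_block[of a b a b]
  by (simp add: cover_def)

section \<open>Translation invariance and existence of the block measure\<close>

lemma block_shift: "(\<lambda>x. x + h) ` block e a b = block e (\<lambda>j. a j + h \<bullet> e j) (\<lambda>j. b j + h \<bullet> e j)"
proof -
  have "x \<in> (\<lambda>x. x + h) ` block e a b \<longleftrightarrow> x - h \<in> block e a b" for x
    by (metis (no_types, lifting) add_diff_cancel diff_add_cancel image_iff)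
  then show ?thesis by (auto simp: block_def inner_diff_left algebra_simps)
qed

lemma proper_shift:
  assumes "proper a b"
  shows "proper (\<lambda>j. a j + h \<bullet> e j) (\<lambda>j. b j + h \<bullet> e j)"
proof -
  have "bounded (range (\<lambda>j. f j + h \<bullet> e j))" if f: "bounded (range f)" for f :: "nat \<Rightarrow> real"
  proof -
    obtain B where "\<And>j. \<bar>f j\<bar> \<le> B" using f by (auto simp: bounded_iff)
    then have "\<bar>f j + h \<bullet> e j\<bar> \<le> B + norm h" for j
      using abs_coord_le[of h j] by (metis abs_triangle_ineq add_mono order_trans)
    then show ?thesis by (auto simp: bounded_iff)
  qed
  then show ?thesis
    using assms by (auto simp: proper_def block_bounds_def simp flip: block_shift)
qed

lemma block_ring_shift:
  assumes "A \<in> block_ring e"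
  shows "(\<lambda>x. x + h) ` A \<in> block_ring e"
  using assms unfolding block_ring_def
proof (induction rule: ring_hull_induct)
  case (basic A)
  then show ?case
    by (cases rule: am_blocks_cases)
      (auto simp: block_shift proper_shift proper_block_ring simp flip: block_ring_def)
next
  case (diff A B)
  then show ?case by (auto simp: image_set_diff simp flip: block_ring_def)
qed (auto simp: image_Un simp flip: block_ring_def)

lemma is_block_measure_exists: "\<exists>\<mu>. is_block_measure e \<mu>"
proof
  have add: "additive (block_ring e) glued" by (simp add: additive_def glued_Un)
  show "is_block_measure e glued"
    unfolding is_block_measure_def
  proof (intro conjI ballI allI impI)
    show "0 \<le> glued A" if "A \<in> block_ring e" for A
      using cover_exists[OF that] glued_eq[OF that] glue_nonneg by metis
    \<comment> \<open>Both sides are additive in \<open>A\<close>, so blocks suffice, and a shift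
      does not change the lengths of the sides.\<close>
    show "glued ((\<lambda>x. x + h) ` A) = glued A" if A: "A \<in> block_ring e" for A h
    proof (rule block_ring_eqI[OF A _ add])
      show "additive (block_ring e) (\<lambda>A. glued ((\<lambda>x. x + h) ` A))"
        unfolding additive_def image_Un
        by (auto intro!: glued_Un block_ring_shift)
      fix a b assume "proper a b"
      then show "glued ((\<lambda>x. x + h) ` block e a b) = glued (block e a b)"
        by (simp add: block_shift glued_block proper_shift) (simp add: vol_def)
    qed
    show "glued {} = 0" using glued_Un[of "{}" "{}"] by simp
    show "glued (block e a b) = lim (\<lambda>n. \<Prod>j<n. b j - a j)"
      if "abs_measurable e a b" "block e a b \<noteq> {}" for a b
      using that glued_block[of a b] by (simp add: proper_iff vol_def)
  qed (rule add)
qed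

end

section \<open>The completed content\<close>

context content
begin

text \<open>Together with \<open>outer\<close>, the abstract counterpart of
  \<open>completed_ring\<close> and \<open>lam\<close>, so that the completion is studied for any
  content.\<close>

definition jordan :: "'a set set" where
  "jordan = {A. \<forall>\<epsilon>>0. \<exists>B\<in>R. \<exists>C\<in>R. B \<subseteq> A \<and> A \<subseteq> C \<and> \<mu> (C - B) < \<epsilon>}"

definition outer :: "'a set \<Rightarrow> real" where
  "outer A = Inf {\<mu> C |C. C \<in> R \<and> A \<subseteq> C}"

lemma jordanE:
  assumes "A \<in> jordan" "0 < \<epsilon>"
  obtains B C where "B \<in> R" "C \<in> R" "B \<subseteq> A" "A \<subseteq> C" "\<mu> (C - B) < \<epsilon>" "\<mu> C < \<mu> B + \<epsilon>"
proof -
  obtain B C where BC: "B \<in> R" "C \<in> R" "B \<subseteq> A" "A \<subseteq> C" "\<mu> (C - B) < \<epsilon>"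
    using assms by (auto simp: jordan_def)
  then have "\<mu> (C - B) = \<mu> C - \<mu> B" by (intro content_Diff) auto
  with BC show ?thesis by (intro that) auto
qed

lemma ring_of_sets_jordan: "ring_of_sets UNIV jordan"
  unfolding ring_of_sets_iff
proof (intro conjI ballI)
  show "{} \<in> jordan" by (auto simp: jordan_def intro!: bexI[of _ "{}"])
  fix A A' assume A: "A \<in> jordan" "A' \<in> jordan"
  have *: "\<exists>B\<in>R. \<exists>C\<in>R. B \<subseteq> A \<union> A' \<and> A \<union> A' \<subseteq> C \<and> \<mu> (C - B) < \<epsilon>"
    "\<exists>B\<in>R. \<exists>C\<in>R. B \<subseteq> A - A' \<and> A - A' \<subseteq> C \<and> \<mu> (C - B) < \<epsilon>" if "0 < \<epsilon>" for \<epsilon>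
  proof -
    have e2: "0 < \<epsilon> / 2" using that by simp
    obtain B C where BC: "B \<in> R" "C \<in> R" "B \<subseteq> A" "A \<subseteq> C" "\<mu> (C - B) < \<epsilon> / 2"
      using A(1) e2 by (rule jordanE)
    obtain B' C' where BC': "B' \<in> R" "C' \<in> R" "B' \<subseteq> A'" "A' \<subseteq> C'" "\<mu> (C' - B') < \<epsilon> / 2"
      using A(2) e2 by (rule jordanE)
    \<comment> \<open>The gap between inner and outer approximation, for the union as well as for
      the difference, lies in the union of the two given gaps.\<close>
    have small: "\<mu> S < \<epsilon>" if "S \<in> R" "S \<subseteq> (C - B) \<union> (C' - B')" for S
    proof -
      have "\<mu> S \<le> \<mu> ((C - B) \<union> (C' - B'))"
        using that BC BC' by (intro content_mono) auto
      also have "\<dots> \<le> \<mu> (C - B) + \<mu> (C' - B')"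
        using BC BC' by (intro content_Un_le) auto
      finally show ?thesis using BC BC' by simp
    qed
    show "\<exists>B\<in>R. \<exists>C\<in>R. B \<subseteq> A \<union> A' \<and> A \<union> A' \<subseteq> C \<and> \<mu> (C - B) < \<epsilon>"
      using BC BC' by (intro bexI[of _ "B \<union> B'"] bexI[of _ "C \<union> C'"] conjI small) auto
    show "\<exists>B\<in>R. \<exists>C\<in>R. B \<subseteq> A - A' \<and> A - A' \<subseteq> C \<and> \<mu> (C - B) < \<epsilon>"
      using BC BC' by (intro bexI[of _ "B - C'"] bexI[of _ "C - B'"] conjI small) auto
  qed
  show "A \<union> A' \<in> jordan" "A - A' \<in> jordan"
    using * by (simp_all add: jordan_def)
qed simp

lemma outer_le: "C \<in> R \<Longrightarrow> A \<subseteq> C \<Longrightarrow> outer A \<le> \<mu> C"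
  unfolding outer_def
proof (rule cInf_lower)
  show "bdd_below {\<mu> C |C. C \<in> R \<and> A \<subseteq> C}"
  proof (rule bdd_belowI[of _ 0])
    fix x assume "x \<in> {\<mu> C |C. C \<in> R \<and> A \<subseteq> C}"
    then obtain C where "C \<in> R" "x = \<mu> C" by blast
    then show "0 \<le> x" by (simp add: nonneg)
  qed
qed blast

lemma outer_ge:
  assumes "A \<in> jordan" "B \<in> R" "B \<subseteq> A"
  shows "\<mu> B \<le> outer A"
  unfolding outer_def
proof (rule cInf_greatest)
  obtain C where "C \<in> R" "A \<subseteq> C" by (rule jordanE[OF assms(1) zero_less_one])
  then show "{\<mu> C |C. C \<in> R \<and> A \<subseteq> C} \<noteq> {}" by auto
next
  fix x assume "x \<in> {\<mu> C |C. C \<in> R \<and> A \<subseteq> C}"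
  then show "\<mu> B \<le> x" using assms by (auto intro!: content_mono)
qed

lemma subset_jordan: "R \<subseteq> jordan"
proof
  fix A assume "A \<in> R"
  then show "A \<in> jordan" unfolding jordan_def by (auto intro!: bexI[of _ A])
qed

lemma outer_eq: "A \<in> R \<Longrightarrow> outer A = \<mu> A"
  using outer_le[of A A] outer_ge[of A A] subset_jordan by auto

lemma content_jordan: "content jordan outer"
proof -
  interpret J: ring_of_sets UNIV jordan by (rule ring_of_sets_jordan)
  show ?thesis
  proof
    show "0 \<le> outer A" if "A \<in> jordan" for A
      using outer_ge[OF that, of "{}"] by simp
    show "Measure_Space.additive jordan outer"
      unfolding additive_def
    proof (intro ballI impI)
      fix A A' assume A: "A \<in> jordan" "A' \<in> jordan" "A \<inter> A' = {}"
      have Un: "A \<union> A' \<in> jordan" using A by blast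
      \<comment> \<open>Both quantities lie between \<open>\<mu> B + \<mu> B'\<close> and
        \<open>\<mu> C + \<mu> C'\<close>, which differ by less than
        \<open>\<epsilon>\<close>.\<close>
      have "\<bar>outer (A \<union> A') - (outer A + outer A')\<bar> \<le> \<epsilon>" if "0 < \<epsilon>" for \<epsilon>
      proof -
        have e2: "0 < \<epsilon> / 2" using that by simp
        obtain B C where BC: "B \<in> R" "C \<in> R" "B \<subseteq> A" "A \<subseteq> C" "\<mu> C < \<mu> B + \<epsilon> / 2"
          using A(1) e2 by (rule jordanE)
        obtain B' C' where BC': "B' \<in> R" "C' \<in> R" "B' \<subseteq> A'" "A' \<subseteq> C'" "\<mu> C' < \<mu> B' + \<epsilon> / 2"
          using A(2) e2 by (rule jordanE)
        have "\<mu> (B \<union> B') \<le> outer (A \<union> A')"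
          using BC BC' by (intro outer_ge Un) auto
        moreover have "\<mu> (B \<union> B') = \<mu> B + \<mu> B'"
          using BC BC' A(3) by (intro content_Un) auto
        moreover have "outer (A \<union> A') \<le> \<mu> (C \<union> C')"
          using BC BC' by (intro outer_le) auto
        moreover have "\<mu> (C \<union> C') \<le> \<mu> C + \<mu> C'"
          using BC BC' by (intro content_Un_le) auto
        moreover have "\<mu> B \<le> outer A" "outer A \<le> \<mu> C" "\<mu> B' \<le> outer A'" "outer A' \<le> \<mu> C'"
          using BC BC' A by (auto intro: outer_ge outer_le)
        ultimately show ?thesis using BC(5) BC'(5) by linarith
      qed
      then have "\<bar>outer (A \<union> A') - (outer A + outer A')\<bar> \<le> 0"
        by (rule field_le_epsilon) simp
      then show "outer (A \<union> A') = outer A + outer A'" by simp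
    qed
  qed
qed

end

context orthonormal_seq
begin

lemma is_block_measure: "is_block_measure e (block_measure e)"
  unfolding block_measure_def by (rule someI_ex[OF is_block_measure_exists])

sublocale bm: content "block_ring e" "block_measure e"
  using is_block_measure by unfold_locales (auto simp: is_block_measure_def)

lemma block_measure_block: "proper a b \<Longrightarrow> block_measure e (block e a b) = vol a b"
  using is_block_measure by (auto simp: is_block_measure_def proper_iff vol_def)

lemma block_measure_shift:
  "A \<in> block_ring e \<Longrightarrow> block_measure e ((\<lambda>x. x + h) ` A) = block_measure e A"
  using is_block_measure by (auto simp: is_block_measure_def)

lemma completed_ring_eq: "completed_ring e = bm.jordan"
  by (auto simp: completed_ring_def bm.jordan_def)

lemma lam_eq: "lam e = bm.outer"
  by (auto simp: lam_def bm.outer_def)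

sublocale L: content "completed_ring e" "lam e"
  unfolding completed_ring_eq lam_eq by (rule bm.content_jordan)

lemma completed_ring_shift:
  assumes "A \<in> completed_ring e"
  shows "(\<lambda>x. x + h) ` A \<in> completed_ring e"
  unfolding completed_ring_def
proof (intro CollectI allI impI)
  fix \<epsilon> :: real assume "0 < \<epsilon>"
  then obtain B C where BC: "B \<in> block_ring e" "C \<in> block_ring e" "B \<subseteq> A" "A \<subseteq> C"
    "block_measure e (C - B) < \<epsilon>"
    using assms unfolding completed_ring_def by blast
  have "(\<lambda>x. x + h) ` C - (\<lambda>x. x + h) ` B = (\<lambda>x. x + h) ` (C - B)"
    by (auto simp: image_set_diff)
  then have "block_measure e ((\<lambda>x. x + h) ` C - (\<lambda>x. x + h) ` B) < \<epsilon>"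
    using BC by (simp add: block_measure_shift block_ring.Diff)
  with BC show "\<exists>B\<in>block_ring e. \<exists>C\<in>block_ring e. B \<subseteq> (\<lambda>x. x + h) ` A \<and> (\<lambda>x. x + h) ` A \<subseteq> C \<and>
      block_measure e (C - B) < \<epsilon>"
    by (intro bexI[of _ "(\<lambda>x. x + h) ` B"] bexI[of _ "(\<lambda>x. x + h) ` C"] conjI image_mono)
      (auto intro: block_ring_shift)
qed

text \<open>Shifted outer approximations are again outer approximations. The reverse inequality is
  this one for \<open>- h\<close>, applied to the shifted set.\<close>

lemma lam_shift_le:
  assumes "A \<in> completed_ring e"
  shows "lam e ((\<lambda>x. x + h) ` A) \<le> lam e A"
proof (rule field_le_epsilon)
  fix \<epsilon> :: real assume "0 < \<epsilon>"
  with assms obtain B C where BC: "B \<in> block_ring e" "C \<in> block_ring e" "B \<subseteq> A" "A \<subseteq> C"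
    "block_measure e C < block_measure e B + \<epsilon>"
    unfolding completed_ring_eq by (rule bm.jordanE)
  have "lam e ((\<lambda>x. x + h) ` A) \<le> block_measure e ((\<lambda>x. x + h) ` C)"
    unfolding lam_eq using BC by (intro bm.outer_le block_ring_shift image_mono)
  also have "\<dots> < block_measure e B + \<epsilon>" using BC by (simp add: block_measure_shift)
  also have "block_measure e B \<le> lam e A"
    unfolding lam_eq using BC assms by (intro bm.outer_ge) (auto simp: completed_ring_eq)
  finally show "lam e ((\<lambda>x. x + h) ` A) \<le> lam e A + \<epsilon>" by simp
qed

lemma lam_shift:
  assumes "A \<in> completed_ring e"
  shows "lam e ((\<lambda>x. x + h) ` A) = lam e A"
proof (rule antisym)
  show "lam e A \<le> lam e ((\<lambda>x. x + h) ` A)"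
    using lam_shift_le[OF completed_ring_shift[OF assms, of h], of "- h"] by (simp add: image_image)
qed (rule lam_shift_le[OF assms])

section \<open>The seminorm on simple functions\<close>

lemma simple_functions_iff: "f \<in> simple_functions e \<longleftrightarrow> simple_on (completed_ring e) f"
proof
  assume "f \<in> simple_functions e"
  then show "simple_on (completed_ring e) f"
    unfolding simple_functions_def by (force intro!: L.simple_on_sum L.simple_on_indicator simp del: sum_mult_indicator)
next
  assume f: "simple_on (completed_ring e) f"
  then have fin: "finite (range f - {0})" by (simp add: simple_on_def)
  then obtain c where c: "bij_betw c {..<card (range f - {0})} (range f - {0})"
    using ex_bij_betw_nat_finite[OF fin] by (auto simp: atLeast0LessThan)
  define n where "n = card (range f - {0})"
  have inj: "c i \<noteq> c j" if "i < n" "j < n" "i \<noteq> j" for i j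
    using c that by (auto simp: bij_betw_def inj_on_def n_def)
  have mem: "c k \<in> range f - {0}" if "k < n" for k
    using c that by (auto simp: bij_betw_def n_def)
  have "f x = (\<Sum>k<n. c k * indicator (f -` {c k}) x)" for x
  proof -
    have "(\<Sum>k<n. c k * indicator (f -` {c k}) x) = (\<Sum>u\<in>range f - {0}. u * indicator (f -` {u}) x)"
      using sum.reindex_bij_betw[OF c, of "\<lambda>u. u * indicator (f -` {u}) x"] by (simp add: n_def)
    also have "\<dots> = (\<Sum>u\<in>range f - {0}. if u = f x then f x else 0)"
      by (intro sum.cong) (auto simp: indicator_def)
    also have "\<dots> = f x" using fin by simp
    finally show ?thesis by simp
  qed
  moreover have "disjoint_family_on (\<lambda>k. f -` {c k}) {..<n}"
    unfolding disjoint_family_on_def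
  proof (intro ballI impI)
    fix i j assume "i \<in> {..<n}" "j \<in> {..<n}" "i \<noteq> j"
    then have "c i \<noteq> c j" by (intro inj) auto
    then show "f -` {c i} \<inter> f -` {c j} = {}" by auto
  qed
  moreover have "\<forall>k<n. f -` {c k} \<in> completed_ring e"
    using f mem by (auto simp: simple_on_def)
  ultimately show "f \<in> simple_functions e"
    unfolding simple_functions_def
    by (intro CollectI exI[of _ n] exI[of _ c] exI[of _ "\<lambda>k. f -` {c k}"] conjI ext)
qed

lemma snorm_eq: "snorm e f = L.l2norm f"
  by (simp add: snorm_def L.l2norm_def simple_sum_def mult.commute)

text \<open>The two index sets differ harmlessly: pairs of values that are never attained together
  have an empty level set, and pairs with one zero component have product 0.\<close>

lemma sinner_eq:
  assumes f: "f \<in> simple_functions e" and g: "g \<in> simple_functions e"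
  shows "sinner e f g = L.l2inner f g"
proof -
  let ?t = "\<lambda>(u, v). lam e ((\<lambda>x. (f x, g x)) -` {(u, v)}) *\<^sub>R (u * cnj v)"
  let ?I = "(range f - {0}) \<times> (range g - {0})"
  have fin: "finite (range f)" "finite (range g)"
    using f g by (auto simp: simple_functions_iff simple_on_def)
  have sub: "range (\<lambda>x. (f x, g x)) \<subseteq> range f \<times> range g" by auto
  have "sinner e f g = (\<Sum>w\<in>?I. ?t w)"
    unfolding sinner_def sum.cartesian_product
  proof (intro sum.cong refl)
    fix w :: "complex \<times> complex"
    obtain u v where w: "w = (u, v)" by (cases w)
    have "(\<lambda>x. (f x, g x)) -` {(u, v)} = f -` {u} \<inter> g -` {v}" by auto
    then show "(case w of (u, v) \<Rightarrow> u * cnj v * complex_of_real (lam e (f -` {u} \<inter> g -` {v}))) = ?t w"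
      by (simp add: w scaleR_conv_of_real mult.commute)
  qed
  also have "\<dots> = (\<Sum>w\<in>?I \<inter> range (\<lambda>x. (f x, g x)). ?t w)"
  proof (rule sum.mono_neutral_right)
    show "\<forall>i\<in>?I - ?I \<inter> range (\<lambda>x. (f x, g x)). ?t i = 0"
    proof
      fix i assume "i \<in> ?I - ?I \<inter> range (\<lambda>x. (f x, g x))"
      then have notin: "i \<notin> range (\<lambda>x. (f x, g x))" by blast
      have "(\<lambda>x. (f x, g x)) -` {i} = {}"
      proof (rule ccontr)
        assume "(\<lambda>x. (f x, g x)) -` {i} \<noteq> {}"
        then obtain x where "(f x, g x) = i" by auto
        with notin rangeI[of "\<lambda>x. (f x, g x)" x] show False by simp
      qed
      then show "?t i = 0" by (cases i) simp
    qed
  qed (use fin in \<open>auto intro!: finite_cartesian_product\<close>)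
  also have "\<dots> = (\<Sum>w\<in>range (\<lambda>x. (f x, g x)) - {0}. ?t w)"
  proof (rule sum.mono_neutral_left)
    show "finite (range (\<lambda>x. (f x, g x)) - {0})"
      using fin by (intro finite_Diff) (rule finite_subset[OF sub], simp)
  qed (auto simp: zero_prod_def)
  also have "\<dots> = L.l2inner f g"
    by (simp add: L.l2inner_def simple_sum_def case_prod_unfold)
  finally show ?thesis .
qed

lemma simple_add: "f \<in> simple_functions e \<Longrightarrow> g \<in> simple_functions e \<Longrightarrow> (\<lambda>x. f x + g x) \<in> simple_functions e"
  using L.simple_on_comp2[of f g "(+)"] by (simp add: simple_functions_iff)

lemma simple_diff: "f \<in> simple_functions e \<Longrightarrow> g \<in> simple_functions e \<Longrightarrow> (\<lambda>x. f x - g x) \<in> simple_functions e"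
  using L.simple_on_comp2[of f g "(-)"] by (simp add: simple_functions_iff)

lemma simple_mult: "f \<in> simple_functions e \<Longrightarrow> g \<in> simple_functions e \<Longrightarrow> (\<lambda>x. f x * g x) \<in> simple_functions e"
  using L.simple_on_comp2[of f g "(*)"] by (simp add: simple_functions_iff)

lemma simple_scale: "f \<in> simple_functions e \<Longrightarrow> (\<lambda>x. c * f x) \<in> simple_functions e"
  using L.simple_on_comp[of f "(*) c"] by (simp add: simple_functions_iff)

lemma simple_cmod: "f \<in> simple_functions e \<Longrightarrow> (\<lambda>x. complex_of_real (cmod (f x))) \<in> simple_functions e"
  using L.simple_on_comp[of f "\<lambda>u. complex_of_real (cmod u)"] by (simp add: simple_functions_iff)

lemma simple_zero: "(\<lambda>x. 0) \<in> simple_functions e"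
  by (simp add: simple_functions_iff L.simple_on_zero)

lemma simple_indicator: "A \<in> completed_ring e \<Longrightarrow> indicator A \<in> simple_functions e"
  using L.simple_on_indicator[of A 1] by (simp add: simple_functions_iff)

lemma vimage_shift: "(\<lambda>x. f (x - h)) -` S = (\<lambda>x. x + h) ` (f -` S)"
  for f :: "'e \<Rightarrow> complex"
proof -
  have "x \<in> (\<lambda>x. x + h) ` (f -` S) \<longleftrightarrow> x - h \<in> f -` S" for x
    by (metis (no_types, lifting) add_diff_cancel diff_add_cancel image_iff)
  then show ?thesis by auto
qed

lemma range_shift: "range (\<lambda>x. f (x - h)) = range f" for f :: "'e \<Rightarrow> complex"
proof (intro equalityI subsetI)
  fix y assume "y \<in> range f"
  then obtain x where "y = f ((x + h) - h)" by auto
  then show "y \<in> range (\<lambda>x. f (x - h))" by (rule range_eqI)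
qed auto

lemma simple_shift: "f \<in> simple_functions e \<Longrightarrow> (\<lambda>x. f (x - h)) \<in> simple_functions e"
  unfolding simple_functions_iff simple_on_def range_shift vimage_shift
  by (auto intro: completed_ring_shift)

lemma snorm_shift:
  assumes "f \<in> simple_functions e"
  shows "snorm e (\<lambda>x. f (x - h)) = snorm e f"
  unfolding snorm_def range_shift vimage_shift using assms
  by (intro arg_cong[of _ _ sqrt] sum.cong) (auto simp: lam_shift simple_functions_iff simple_on_def)

lemma snorm_nonneg: "f \<in> simple_functions e \<Longrightarrow> 0 \<le> snorm e f"
  by (simp add: snorm_eq simple_functions_iff L.l2norm_nonneg)

lemma snorm_zero [simp]: "snorm e (\<lambda>x. 0) = 0"
  by (simp add: snorm_eq)

lemma snorm_scale: "f \<in> simple_functions e \<Longrightarrow> snorm e (\<lambda>x. c * f x) = cmod c * snorm e f"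
  by (simp add: snorm_eq simple_functions_iff L.l2norm_scale)

lemma snorm_mono:
  "f \<in> simple_functions e \<Longrightarrow> g \<in> simple_functions e \<Longrightarrow> (\<And>x. cmod (f x) \<le> cmod (g x)) \<Longrightarrow>
     snorm e f \<le> snorm e g"
  by (simp add: snorm_eq simple_functions_iff L.l2norm_mono)

lemma snorm_triangle:
  "f \<in> simple_functions e \<Longrightarrow> g \<in> simple_functions e \<Longrightarrow>
     snorm e (\<lambda>x. f x + g x) \<le> snorm e f + snorm e g"
  by (simp add: snorm_eq simple_functions_iff L.l2norm_triangle)

text \<open>Turns pointwise domination into a norm estimate. Moduli are themselves simple functions,
  so monotonicity and the triangle inequality apply to the dominating sum. Three terms are what the
  multiplier estimates produce.\<close>

lemma snorm_le_combination:
  assumes f: "f \<in> simple_functions e" and g: "g \<in> simple_functions e"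
    and h: "h \<in> simple_functions e" and k: "k \<in> simple_functions e"
    and ab: "0 \<le> a" "0 \<le> b"
    and le: "\<And>x. cmod (f x) \<le> cmod (g x) + a * cmod (h x) + b * cmod (k x)"
  shows "snorm e f \<le> snorm e g + a * snorm e h + b * snorm e k"
proof -
  let ?c = "\<lambda>a f x. complex_of_real a * complex_of_real (cmod (f x))"
  have s: "?c a f \<in> simple_functions e" if "f \<in> simple_functions e" for a f
    by (intro simple_scale simple_cmod that)
  have n: "snorm e (?c a f) \<le> a * snorm e f" if "f \<in> simple_functions e" "0 \<le> a" for a f
  proof -
    have "snorm e (\<lambda>x. complex_of_real (cmod (f x))) \<le> snorm e f"
      using that by (intro snorm_mono simple_cmod) auto
    with that show ?thesis by (simp add: snorm_scale simple_cmod mult_left_mono)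
  qed
  have "snorm e f \<le> snorm e (\<lambda>x. (?c 1 g x + ?c a h x) + ?c b k x)"
  proof (rule snorm_mono[OF f])
    fix x
    have "cmod (complex_of_real (cmod (g x) + a * cmod (h x) + b * cmod (k x))) =
        cmod (g x) + a * cmod (h x) + b * cmod (k x)"
      unfolding norm_of_real using ab by (intro abs_of_nonneg add_nonneg_nonneg mult_nonneg_nonneg) auto
    then show "cmod (f x) \<le> cmod ((?c 1 g x + ?c a h x) + ?c b k x)" using le[of x] by simp
  qed (intro simple_add s g h k)
  also have "\<dots> \<le> (snorm e (?c 1 g) + snorm e (?c a h)) + snorm e (?c b k)"
    using snorm_triangle[OF simple_add[OF s[OF g] s[OF h]] s[OF k], of 1 a b]
      snorm_triangle[OF s[OF g] s[OF h], of 1 a] by linarith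
  also have "\<dots> \<le> (1 * snorm e g + a * snorm e h) + b * snorm e k"
    by (intro add_mono n g h k ab zero_le_one)
  finally show ?thesis by simp
qed

lemma snorm_minus_commute:
  assumes "f \<in> simple_functions e" "g \<in> simple_functions e"
  shows "snorm e (\<lambda>x. f x - g x) = snorm e (\<lambda>x. g x - f x)"
  using assms by (intro antisym snorm_mono simple_diff) (simp_all add: norm_minus_commute)

lemma snorm_diff_triangle:
  assumes "f \<in> simple_functions e" "g \<in> simple_functions e" "h \<in> simple_functions e"
  shows "snorm e (\<lambda>x. f x - h x) \<le> snorm e (\<lambda>x. f x - g x) + snorm e (\<lambda>x. g x - h x)"
  using snorm_triangle[OF simple_diff[OF assms(1,2)] simple_diff[OF assms(2,3)]] by simp

lemma snorm_le_diff:
  assumes "f \<in> simple_functions e" "g \<in> simple_functions e"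
  shows "snorm e f \<le> snorm e (\<lambda>x. f x - g x) + snorm e g"
  using snorm_triangle[OF simple_diff[OF assms] assms(2)] by simp

lemma sinner_Cauchy_Schwarz:
  "f \<in> simple_functions e \<Longrightarrow> g \<in> simple_functions e \<Longrightarrow> cmod (sinner e f g) \<le> snorm e f * snorm e g"
  by (simp add: sinner_eq snorm_eq simple_functions_iff L.l2inner_Cauchy_Schwarz)

lemma sinner_self:
  "f \<in> simple_functions e \<Longrightarrow> sinner e f f = complex_of_real ((snorm e f)\<^sup>2)"
  by (simp add: sinner_eq snorm_eq simple_functions_iff L.l2inner_self)

text \<open>Change one argument at a time and apply Cauchy-Schwarz to each change.\<close>

lemma sinner_diff_le:
  assumes "f \<in> simple_functions e" "f' \<in> simple_functions e"
    "g \<in> simple_functions e" "g' \<in> simple_functions e"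
  shows "cmod (sinner e f g - sinner e f' g') \<le>
    snorm e (\<lambda>x. f x - f' x) * snorm e g + snorm e f' * snorm e (\<lambda>x. g x - g' x)"
proof -
  have "sinner e f g - sinner e f' g' = sinner e (\<lambda>x. f x - f' x) g + sinner e f' (\<lambda>x. g x - g' x)"
    using assms by (simp add: sinner_eq simple_diff)
      (simp add: simple_functions_iff L.l2inner_diff_left L.l2inner_diff_right)
  then show ?thesis
    using norm_triangle_ineq[of "sinner e (\<lambda>x. f x - f' x) g" "sinner e f' (\<lambda>x. g x - g' x)"]
      sinner_Cauchy_Schwarz[OF simple_diff[OF assms(1,2)] assms(3)]
      sinner_Cauchy_Schwarz[OF assms(2) simple_diff[OF assms(3,4)]]
    by simp
qed

end

section \<open>The Hilbert space\<close>

context orthonormal_seq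
begin

lemma cauchy_seqs_simple: "X \<in> cauchy_seqs e \<Longrightarrow> X n \<in> simple_functions e"
  by (simp add: cauchy_seqs_def)

lemma cauchy_seqsD:
  assumes "X \<in> cauchy_seqs e" "0 < \<epsilon>"
  obtains N where "\<And>m n. m \<ge> N \<Longrightarrow> n \<ge> N \<Longrightarrow> snorm e (\<lambda>x. X m x - X n x) < \<epsilon>"
proof -
  have "\<exists>N. \<forall>m\<ge>N. \<forall>n\<ge>N. snorm e (\<lambda>x. X m x - X n x) < \<epsilon>"
    using assms unfolding cauchy_seqs_def by blast
  then show ?thesis using that by blast
qed

lemma cauchy_seqs_bounded:
  assumes X: "X \<in> cauchy_seqs e"
  obtains K where "0 < K" "\<And>n. snorm e (X n) \<le> K"
proof -
  obtain N where N: "\<And>m n. m \<ge> N \<Longrightarrow> n \<ge> N \<Longrightarrow> snorm e (\<lambda>x. X m x - X n x) < 1"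
    using cauchy_seqsD[OF X zero_less_one] by blast
  let ?K = "Max ((\<lambda>n. snorm e (X n)) ` {..N}) + 1"
  have "snorm e (X n) \<le> ?K" for n
  proof (cases "n \<le> N")
    case True
    then have "snorm e (X n) \<le> Max ((\<lambda>n. snorm e (X n)) ` {..N})" by (intro Max_ge) auto
    then show ?thesis by simp
  next
    case False
    have "snorm e (X n) \<le> snorm e (\<lambda>x. X n x - X N x) + snorm e (X N)"
      using X by (intro snorm_le_diff cauchy_seqs_simple)
    moreover have "snorm e (X N) \<le> Max ((\<lambda>n. snorm e (X n)) ` {..N})" by (intro Max_ge) auto
    moreover have "snorm e (\<lambda>x. X n x - X N x) < 1" using False by (intro N) auto
    ultimately show ?thesis by linarith
  qed
  moreover have "0 \<le> snorm e (X 0)" using X by (intro snorm_nonneg cauchy_seqs_simple)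
  moreover have "snorm e (X 0) \<le> Max ((\<lambda>n. snorm e (X n)) ` {..N})" by (intro Max_ge) auto
  ultimately show ?thesis by (intro that[of ?K]) linarith+
qed

lemma cauchy_seqsI_null:
  assumes X: "\<And>n. X n \<in> simple_functions e"
    and b: "b \<longlonglongrightarrow> (0 :: real)"
    and le: "\<And>m n. snorm e (\<lambda>x. X m x - X n x) \<le> b m + b n"
  shows "X \<in> cauchy_seqs e"
  unfolding cauchy_seqs_def
proof (intro CollectI conjI allI impI X)
  fix \<epsilon> :: real assume "0 < \<epsilon>"
  then have "0 < \<epsilon> / 2" by simp
  then obtain N where N: "\<And>n. n \<ge> N \<Longrightarrow> \<bar>b n\<bar> < \<epsilon> / 2"
    using LIMSEQ_D[OF b] by fastforce
  have "snorm e (\<lambda>x. X m x - X n x) < \<epsilon>" if "m \<ge> N" "n \<ge> N" for m n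
    using le[of m n] N[OF that(1)] N[OF that(2)] by linarith
  then show "\<exists>N. \<forall>m\<ge>N. \<forall>n\<ge>N. snorm e (\<lambda>x. X m x - X n x) < \<epsilon>" by blast
qed

lemma const_cauchy_seqs: "f \<in> simple_functions e \<Longrightarrow> (\<lambda>n. f) \<in> cauchy_seqs e"
  by (rule cauchy_seqsI_null[of _ "\<lambda>n. 0"]) auto

lemma seq_equiv_iff:
  "(X, Y) \<in> seq_equiv e \<longleftrightarrow> X \<in> cauchy_seqs e \<and> Y \<in> cauchy_seqs e \<and>
     (\<lambda>n. snorm e (\<lambda>x. X n x - Y n x)) \<longlonglongrightarrow> 0"
  by (simp add: seq_equiv_def)

lemma snorm_tendsto_0I:
  assumes "b \<longlonglongrightarrow> 0" "\<And>n. f n \<in> simple_functions e" "\<And>n. snorm e (f n) \<le> b n"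
  shows "(\<lambda>n. snorm e (f n)) \<longlonglongrightarrow> 0"
  using assms by (intro tendsto_sandwich[OF _ _ tendsto_const assms(1)]) (auto simp: snorm_nonneg)

lemma equiv_seq_equiv: "equiv (cauchy_seqs e) (seq_equiv e)"
proof (rule equivI)
  show "seq_equiv e \<subseteq> cauchy_seqs e \<times> cauchy_seqs e" by (auto simp: seq_equiv_def)
  show "refl_on (cauchy_seqs e) (seq_equiv e)" by (auto simp: refl_on_def seq_equiv_iff)
  show "sym (seq_equiv e)"
  proof (rule symI)
    fix X Y assume XY: "(X, Y) \<in> seq_equiv e"
    then have "snorm e (\<lambda>x. Y n x - X n x) = snorm e (\<lambda>x. X n x - Y n x)" for n
      by (intro snorm_minus_commute cauchy_seqs_simple) (auto simp: seq_equiv_iff)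
    with XY show "(Y, X) \<in> seq_equiv e" by (simp add: seq_equiv_iff)
  qed
  show "trans (seq_equiv e)"
  proof (rule transI)
    fix X Y Z assume XYZ: "(X, Y) \<in> seq_equiv e" "(Y, Z) \<in> seq_equiv e"
    then have c: "X \<in> cauchy_seqs e" "Y \<in> cauchy_seqs e" "Z \<in> cauchy_seqs e"
      by (auto simp: seq_equiv_iff)
    have "(\<lambda>n. snorm e (\<lambda>x. X n x - Z n x)) \<longlonglongrightarrow> 0"
    proof (rule snorm_tendsto_0I)
      show "(\<lambda>n. snorm e (\<lambda>x. X n x - Y n x) + snorm e (\<lambda>x. Y n x - Z n x)) \<longlonglongrightarrow> 0"
        using XYZ by (auto simp: seq_equiv_iff intro: tendsto_add_zero)
      show "(\<lambda>x. X n x - Z n x) \<in> simple_functions e" for n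
        using c by (intro simple_diff cauchy_seqs_simple)
      show "snorm e (\<lambda>x. X n x - Z n x) \<le> snorm e (\<lambda>x. X n x - Y n x) + snorm e (\<lambda>x. Y n x - Z n x)" for n
        using c by (intro snorm_diff_triangle cauchy_seqs_simple)
    qed
    with c show "(X, Z) \<in> seq_equiv e" by (simp add: seq_equiv_iff)
  qed
qed

lemma cls_in_hspace: "X \<in> cauchy_seqs e \<Longrightarrow> cls e X \<in> hspace e"
  by (auto simp: hspace_def cls_def intro: quotientI)

lemma cls_eq_iff:
  "X \<in> cauchy_seqs e \<Longrightarrow> Y \<in> cauchy_seqs e \<Longrightarrow> cls e X = cls e Y \<longleftrightarrow> (X, Y) \<in> seq_equiv e"
  unfolding cls_def by (rule eq_equiv_class_iff[OF equiv_seq_equiv])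

lemma hspaceE:
  assumes "u \<in> hspace e"
  obtains X where "X \<in> cauchy_seqs e" "u = cls e X"
  using assms by (auto simp: hspace_def cls_def elim: quotientE)

lemma mem_cls_iff: "Y \<in> cls e X \<longleftrightarrow> (X, Y) \<in> seq_equiv e"
  by (simp add: cls_def)

text \<open>\<open>rep\<close> is an arbitrary choice; this equivalence is all that is ever used
  about it, and it frees the operations on vectors from that choice.\<close>

lemma rep_cls:
  assumes "X \<in> cauchy_seqs e"
  shows "(X, rep (cls e X)) \<in> seq_equiv e"
proof -
  have "X \<in> cls e X" using assms by (simp add: mem_cls_iff seq_equiv_iff)
  then have "rep (cls e X) \<in> cls e X" unfolding rep_def by (rule someI[of "\<lambda>Y. Y \<in> cls e X"])
  then show ?thesis by (simp add: mem_cls_iff)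
qed

lemma rep_cauchy: "X \<in> cauchy_seqs e \<Longrightarrow> rep (cls e X) \<in> cauchy_seqs e"
  using rep_cls by (auto simp: seq_equiv_iff)

lemma convergent_sinner:
  assumes X: "X \<in> cauchy_seqs e" and Y: "Y \<in> cauchy_seqs e"
  shows "convergent (\<lambda>n. sinner e (X n) (Y n))"
proof (rule Cauchy_convergent, rule CauchyI)
  fix \<epsilon> :: real assume "0 < \<epsilon>"
  obtain K where K: "0 < K" "\<And>n. snorm e (X n) \<le> K" using cauchy_seqs_bounded[OF X] by metis
  obtain L where L: "0 < L" "\<And>n. snorm e (Y n) \<le> L" using cauchy_seqs_bounded[OF Y] by metis
  \<comment> \<open>Moving the first argument costs at most a factor \<open>L\<close>, the bound for
    \<open>Y\<close>; moving the second costs \<open>K\<close>, the bound for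
    \<open>X\<close>.\<close>
  let ?r = "\<epsilon> / (K + L)"
  have r: "0 < ?r" using \<open>0 < \<epsilon>\<close> K(1) L(1) by simp
  obtain M where M: "\<And>m n. m \<ge> M \<Longrightarrow> n \<ge> M \<Longrightarrow> snorm e (\<lambda>x. X m x - X n x) < ?r"
    using X r by (rule cauchy_seqsD) blast
  obtain N where N: "\<And>m n. m \<ge> N \<Longrightarrow> n \<ge> N \<Longrightarrow> snorm e (\<lambda>x. Y m x - Y n x) < ?r"
    using Y r by (rule cauchy_seqsD) blast
  have "cmod (sinner e (X m) (Y m) - sinner e (X n) (Y n)) < \<epsilon>" if "m \<ge> max M N" "n \<ge> max M N" for m n
  proof -
    have s: "0 \<le> snorm e (\<lambda>x. X m x - X n x)" "0 \<le> snorm e (\<lambda>x. Y m x - Y n x)"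
      "0 \<le> snorm e (Y m)" "0 \<le> snorm e (X n)"
      by (intro snorm_nonneg simple_diff cauchy_seqs_simple[OF X] cauchy_seqs_simple[OF Y])+
    have "cmod (sinner e (X m) (Y m) - sinner e (X n) (Y n)) \<le>
        snorm e (\<lambda>x. X m x - X n x) * snorm e (Y m) + snorm e (X n) * snorm e (\<lambda>x. Y m x - Y n x)"
      using X Y by (intro sinner_diff_le cauchy_seqs_simple)
    also have "\<dots> \<le> snorm e (\<lambda>x. X m x - X n x) * L + K * snorm e (\<lambda>x. Y m x - Y n x)"
      using s K L by (intro add_mono mult_mono) auto
    also have "\<dots> < ?r * L + K * ?r"
      using M[of m n] N[of m n] that K(1) L(1)
      by (intro add_strict_mono mult_strict_right_mono mult_strict_left_mono) auto
    also have "\<dots> = ?r * (K + L)" by (simp only: distrib_left mult.commute[of K])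
    also have "\<dots> = \<epsilon>" using K(1) L(1) by simp
    finally show ?thesis .
  qed
  then show "\<exists>M. \<forall>m\<ge>M. \<forall>n\<ge>M. cmod (sinner e (X m) (Y m) - sinner e (X n) (Y n)) < \<epsilon>"
    by blast
qed

lemma sinner_diff_tendsto_0:
  assumes XX: "(X, X') \<in> seq_equiv e" and YY: "(Y, Y') \<in> seq_equiv e"
  shows "(\<lambda>n. sinner e (X n) (Y n) - sinner e (X' n) (Y' n)) \<longlonglongrightarrow> 0"
proof -
  have c: "X \<in> cauchy_seqs e" "X' \<in> cauchy_seqs e" "Y \<in> cauchy_seqs e" "Y' \<in> cauchy_seqs e"
    using XX YY by (auto simp: seq_equiv_iff)
  obtain K where K: "0 < K" "\<And>n. snorm e (X' n) \<le> K" using cauchy_seqs_bounded[OF c(2)] by metis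
  obtain L where L: "0 < L" "\<And>n. snorm e (Y n) \<le> L" using cauchy_seqs_bounded[OF c(3)] by metis
  have le: "norm (sinner e (X n) (Y n) - sinner e (X' n) (Y' n)) \<le>
      snorm e (\<lambda>x. X n x - X' n x) * L + K * snorm e (\<lambda>x. Y n x - Y' n x)" for n
  proof -
    have s: "0 \<le> snorm e (\<lambda>x. X n x - X' n x)" "0 \<le> snorm e (\<lambda>x. Y n x - Y' n x)"
      "0 \<le> snorm e (Y n)" "0 \<le> snorm e (X' n)"
      by (intro snorm_nonneg simple_diff c[THEN cauchy_seqs_simple])+
    have "norm (sinner e (X n) (Y n) - sinner e (X' n) (Y' n)) \<le>
        snorm e (\<lambda>x. X n x - X' n x) * snorm e (Y n) + snorm e (X' n) * snorm e (\<lambda>x. Y n x - Y' n x)"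
      using c by (intro sinner_diff_le cauchy_seqs_simple)
    also have "\<dots> \<le> snorm e (\<lambda>x. X n x - X' n x) * L + K * snorm e (\<lambda>x. Y n x - Y' n x)"
      using s K L by (intro add_mono mult_mono) auto
    finally show ?thesis .
  qed
  show ?thesis
  proof (rule Lim_null_comparison[OF always_eventually])
    show "\<forall>n. norm (sinner e (X n) (Y n) - sinner e (X' n) (Y' n)) \<le>
      snorm e (\<lambda>x. X n x - X' n x) * L + K * snorm e (\<lambda>x. Y n x - Y' n x)" using le by blast
    show "(\<lambda>n. snorm e (\<lambda>x. X n x - X' n x) * L + K * snorm e (\<lambda>x. Y n x - Y' n x)) \<longlonglongrightarrow> 0"
      using XX YY by (intro tendsto_add_zero tendsto_mult_left_zero tendsto_mult_right_zero)
        (auto simp: seq_equiv_iff)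
  qed
qed

text \<open>The \<open>lim\<close> in the definition is meaningful by convergence along the chosen
  representatives; passing to other representatives changes the terms by a null sequence.\<close>

lemma hinner_cls:
  assumes X: "X \<in> cauchy_seqs e" and Y: "Y \<in> cauchy_seqs e"
  shows "(\<lambda>n. sinner e (X n) (Y n)) \<longlonglongrightarrow> hinner e (cls e X) (cls e Y)"
proof -
  have "(\<lambda>n. sinner e (rep (cls e X) n) (rep (cls e Y) n)) \<longlonglongrightarrow> hinner e (cls e X) (cls e Y)"
    using convergent_sinner[OF rep_cauchy[OF X] rep_cauchy[OF Y]]
    by (simp add: hinner_def convergent_LIMSEQ_iff)
  from tendsto_add[OF sinner_diff_tendsto_0[OF rep_cls[OF X] rep_cls[OF Y]] this]
  show ?thesis by simp
qed

lemma snorm_diff_abs_le: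
  assumes "f \<in> simple_functions e" "f' \<in> simple_functions e"
    "g \<in> simple_functions e" "g' \<in> simple_functions e"
  shows "\<bar>snorm e (\<lambda>x. f x - g x) - snorm e (\<lambda>x. f' x - g' x)\<bar> \<le>
     snorm e (\<lambda>x. f x - f' x) + snorm e (\<lambda>x. g x - g' x)"
proof -
  have "snorm e (\<lambda>x. f x - g x) \<le> snorm e (\<lambda>x. f x - f' x) + snorm e (\<lambda>x. f' x - g x)"
    "snorm e (\<lambda>x. f' x - g x) \<le> snorm e (\<lambda>x. f' x - g' x) + snorm e (\<lambda>x. g' x - g x)"
    "snorm e (\<lambda>x. f' x - g' x) \<le> snorm e (\<lambda>x. f' x - f x) + snorm e (\<lambda>x. f x - g' x)"
    "snorm e (\<lambda>x. f x - g' x) \<le> snorm e (\<lambda>x. f x - g x) + snorm e (\<lambda>x. g x - g' x)"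
    using assms by (auto intro: snorm_diff_triangle)
  then show ?thesis
    using snorm_minus_commute[OF assms(1,2)] snorm_minus_commute[OF assms(3,4)] by linarith
qed

lemma convergent_snorm_diff:
  assumes X: "X \<in> cauchy_seqs e" and Y: "Y \<in> cauchy_seqs e"
  shows "convergent (\<lambda>n. snorm e (\<lambda>x. X n x - Y n x))"
proof (rule Cauchy_convergent, rule CauchyI)
  fix \<epsilon> :: real assume "0 < \<epsilon>"
  then have r: "0 < \<epsilon> / 2" by simp
  obtain M where M: "\<And>m n. m \<ge> M \<Longrightarrow> n \<ge> M \<Longrightarrow> snorm e (\<lambda>x. X m x - X n x) < \<epsilon> / 2"
    using X r by (rule cauchy_seqsD) blast
  obtain N where N: "\<And>m n. m \<ge> N \<Longrightarrow> n \<ge> N \<Longrightarrow> snorm e (\<lambda>x. Y m x - Y n x) < \<epsilon> / 2"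
    using Y r by (rule cauchy_seqsD) blast
  have "norm (snorm e (\<lambda>x. X m x - Y m x) - snorm e (\<lambda>x. X n x - Y n x)) < \<epsilon>"
    if "m \<ge> max M N" "n \<ge> max M N" for m n
    using snorm_diff_abs_le[of "X m" "X n" "Y m" "Y n"] M[of m n] N[of m n] that X Y
    by (simp add: cauchy_seqs_simple)
  then show "\<exists>M. \<forall>m\<ge>M. \<forall>n\<ge>M. norm (snorm e (\<lambda>x. X m x - Y m x) - snorm e (\<lambda>x. X n x - Y n x)) < \<epsilon>"
    by blast
qed

lemma hdist_cls:
  assumes X: "X \<in> cauchy_seqs e" and Y: "Y \<in> cauchy_seqs e"
  shows "(\<lambda>n. snorm e (\<lambda>x. X n x - Y n x)) \<longlonglongrightarrow> hdist e (cls e X) (cls e Y)"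
proof -
  let ?X = "rep (cls e X)" and ?Y = "rep (cls e Y)"
  have c: "?X \<in> cauchy_seqs e" "?Y \<in> cauchy_seqs e" using X Y by (auto intro: rep_cauchy)
  have 1: "(\<lambda>n. snorm e (\<lambda>x. ?X n x - ?Y n x)) \<longlonglongrightarrow> hdist e (cls e X) (cls e Y)"
    using convergent_snorm_diff[OF c] by (simp add: hdist_def convergent_LIMSEQ_iff)
  have 2: "(\<lambda>n. snorm e (\<lambda>x. X n x - Y n x) - snorm e (\<lambda>x. ?X n x - ?Y n x)) \<longlonglongrightarrow> 0"
  proof (rule Lim_null_comparison[OF always_eventually])
    show "\<forall>n. norm (snorm e (\<lambda>x. X n x - Y n x) - snorm e (\<lambda>x. ?X n x - ?Y n x)) \<le>
        snorm e (\<lambda>x. X n x - ?X n x) + snorm e (\<lambda>x. Y n x - ?Y n x)"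
      unfolding real_norm_def using X Y c by (intro allI snorm_diff_abs_le cauchy_seqs_simple)
    show "(\<lambda>n. snorm e (\<lambda>x. X n x - ?X n x) + snorm e (\<lambda>x. Y n x - ?Y n x)) \<longlonglongrightarrow> 0"
      using rep_cls[OF X] rep_cls[OF Y] by (intro tendsto_add_zero) (auto simp: seq_equiv_iff)
  qed
  from tendsto_add[OF 2 1] show ?thesis by simp
qed

lemma hdist_eq_0_iff:
  assumes "u \<in> hspace e" "v \<in> hspace e"
  shows "hdist e u v = 0 \<longleftrightarrow> u = v"
proof -
  obtain X Y where XY: "X \<in> cauchy_seqs e" "u = cls e X" "Y \<in> cauchy_seqs e" "v = cls e Y"
    using assms by (metis hspaceE)
  then show ?thesis
    using hdist_cls[of X Y] by (auto simp: cls_eq_iff seq_equiv_iff dest: LIMSEQ_unique)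
qed

lemma hdist_nonneg:
  assumes "u \<in> hspace e" "v \<in> hspace e"
  shows "0 \<le> hdist e u v"
proof -
  obtain X Y where XY: "X \<in> cauchy_seqs e" "u = cls e X" "Y \<in> cauchy_seqs e" "v = cls e Y"
    using assms by (metis hspaceE)
  show ?thesis
    unfolding XY using XY
    by (intro LIMSEQ_le_const[OF hdist_cls]) (auto intro!: snorm_nonneg simple_diff cauchy_seqs_simple)
qed

text \<open>The intermediate vector \<open>w\<close> stands first in both distances, matching
  approximants compared with two candidate limits.\<close>

lemma hdist_triangle:
  assumes "u \<in> hspace e" "v \<in> hspace e" "w \<in> hspace e"
  shows "hdist e u v \<le> hdist e w u + hdist e w v"
proof -
  obtain X Y Z where XYZ: "X \<in> cauchy_seqs e" "u = cls e X" "Y \<in> cauchy_seqs e" "v = cls e Y"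
    "Z \<in> cauchy_seqs e" "w = cls e Z"
    using assms by (metis hspaceE)
  have s: "X n \<in> simple_functions e" "Y n \<in> simple_functions e" "Z n \<in> simple_functions e" for n
    using XYZ by (auto intro: cauchy_seqs_simple)
  have "snorm e (\<lambda>x. X n x - Y n x) \<le> snorm e (\<lambda>x. Z n x - X n x) + snorm e (\<lambda>x. Z n x - Y n x)" for n
    using snorm_diff_triangle[OF s(1) s(3) s(2), of n n n] snorm_minus_commute[OF s(1) s(3), of n n]
    by simp
  then show ?thesis
    unfolding XYZ
    using LIMSEQ_le[OF hdist_cls[OF XYZ(1,3)] tendsto_add[OF hdist_cls[OF XYZ(5,1)] hdist_cls[OF XYZ(5,3)]]]
    by blast
qed

lemma cls_zero_in_hspace: "cls e (\<lambda>n x. 0) \<in> hspace e"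
  by (intro cls_in_hspace const_cauchy_seqs simple_zero)

lemma cls_eq_zero_iff:
  assumes "X \<in> cauchy_seqs e"
  shows "cls e X = cls e (\<lambda>n x. 0) \<longleftrightarrow> (\<lambda>n. snorm e (X n)) \<longlonglongrightarrow> 0"
  using assms const_cauchy_seqs[OF simple_zero] by (simp add: cls_eq_iff seq_equiv_iff)

text \<open>Definiteness of the inner product; it makes the weak integral unique, by testing a
  candidate against itself.\<close>

lemma hinner_self_cls:
  assumes X: "X \<in> cauchy_seqs e"
  shows "hinner e (cls e X) (cls e X) = 0 \<longleftrightarrow> cls e X = cls e (\<lambda>n x. 0)"
proof -
  have "(\<lambda>n. complex_of_real ((snorm e (X n))\<^sup>2)) \<longlonglongrightarrow> hinner e (cls e X) (cls e X)"
    using hinner_cls[OF X X] X by (simp add: sinner_self cauchy_seqs_simple)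
  then have "hinner e (cls e X) (cls e X) = 0 \<longleftrightarrow> (\<lambda>n. complex_of_real ((snorm e (X n))\<^sup>2)) \<longlonglongrightarrow> 0"
    by (metis LIMSEQ_unique)
  also have "\<dots> \<longleftrightarrow> (\<lambda>n. (snorm e (X n))\<^sup>2) \<longlonglongrightarrow> 0"
    using tendsto_of_real_iff[of "\<lambda>n. (snorm e (X n))\<^sup>2" 0 sequentially, where ?'a = complex]
    by simp
  also have "\<dots> \<longleftrightarrow> (\<lambda>n. snorm e (X n)) \<longlonglongrightarrow> 0"
  proof
    assume "(\<lambda>n. (snorm e (X n))\<^sup>2) \<longlonglongrightarrow> 0"
    from tendsto_real_sqrt[OF this] show "(\<lambda>n. snorm e (X n)) \<longlonglongrightarrow> 0"
      using X by (simp add: snorm_nonneg cauchy_seqs_simple)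
  qed (auto intro: tendsto_power_zero)
  finally show ?thesis using cls_eq_zero_iff[OF X] by simp
qed

text \<open>Lets homogeneity of an operator show that it fixes the zero vector.\<close>

lemma hscale_0: "hscale e 0 u = cls e (\<lambda>n x. 0)"
  by (simp add: hscale_def)

section \<open>Multiplication operators\<close>

lemma upper_null_add:
  assumes "upper_null e G" "upper_null e H"
  shows "upper_null e (\<lambda>n x. G n x + H n x)"
proof -
  obtain Z where Z: "\<And>n. Z n \<in> simple_functions e" "\<And>n x. cmod (G n x) \<le> cmod (Z n x)"
    "(\<lambda>n. snorm e (Z n)) \<longlonglongrightarrow> 0"
    using assms(1) unfolding upper_null_def by blast
  obtain W where W: "\<And>n. W n \<in> simple_functions e" "\<And>n x. cmod (H n x) \<le> cmod (W n x)"
    "(\<lambda>n. snorm e (W n)) \<longlonglongrightarrow> 0"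
    using assms(2) unfolding upper_null_def by blast
  \<comment> \<open>Moduli are added because \<open>Z n + W n\<close> itself could cancel and then
    fail to dominate.\<close>
  let ?V = "\<lambda>n x. complex_of_real (cmod (Z n x)) + complex_of_real (cmod (W n x))"
  have V: "?V n \<in> simple_functions e" for n by (intro simple_add simple_cmod Z W)
  have "cmod (G n x + H n x) \<le> cmod (?V n x)" for n x
    using Z(2)[of n x] W(2)[of n x] norm_triangle_ineq[of "G n x" "H n x"]
    by (simp flip: of_real_add)
  moreover have "(\<lambda>n. snorm e (?V n)) \<longlonglongrightarrow> 0"
  proof (rule snorm_tendsto_0I)
    show "(\<lambda>n. snorm e (Z n) + snorm e (W n)) \<longlonglongrightarrow> 0"
      by (rule tendsto_add_zero[OF Z(3) W(3)])
    have "snorm e (\<lambda>x. complex_of_real (cmod (Z n x))) \<le> snorm e (Z n)"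
      "snorm e (\<lambda>x. complex_of_real (cmod (W n x))) \<le> snorm e (W n)" for n
      using Z(1) W(1) by (auto intro!: snorm_mono simple_cmod)
    then show "snorm e (?V n) \<le> snorm e (Z n) + snorm e (W n)" for n
      by (rule order_trans[OF snorm_triangle[OF simple_cmod[OF Z(1)] simple_cmod[OF W(1)]] add_mono])
  qed (rule V)
  ultimately show ?thesis using V unfolding upper_null_def by (intro exI[of _ ?V]) blast
qed

lemma upper_null_mono:
  assumes "upper_null e G" "\<And>n x. cmod (H n x) \<le> cmod (G n x)"
  shows "upper_null e H"
  using assms unfolding upper_null_def by (meson order_trans)

text \<open>By monotonicity of \<open>snorm\<close>, the upper seminorm adds nothing on simple
  functions; this converts comparisons through nonsimple products back into equality of
  classes.\<close>

lemma upper_null_simple_iff: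
  assumes "\<And>n. X n \<in> simple_functions e"
  shows "upper_null e X \<longleftrightarrow> (\<lambda>n. snorm e (X n)) \<longlonglongrightarrow> 0"
proof
  assume "upper_null e X"
  then obtain Z where Z: "\<And>n. Z n \<in> simple_functions e" "\<And>n x. cmod (X n x) \<le> cmod (Z n x)"
    "(\<lambda>n. snorm e (Z n)) \<longlonglongrightarrow> 0"
    unfolding upper_null_def by blast
  then show "(\<lambda>n. snorm e (X n)) \<longlonglongrightarrow> 0"
    using assms by (intro snorm_tendsto_0I[OF Z(3)] snorm_mono) auto
next
  assume "(\<lambda>n. snorm e (X n)) \<longlonglongrightarrow> 0"
  with assms show "upper_null e X" unfolding upper_null_def by (intro exI[of _ X]) auto
qed

text \<open>A class of functions on which \<open>mult_op\<close> is under control: contractive, and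
  uniformly close to simple functions on every set of the completed ring. The Gaussian factors
  belong to it although they are in general not simple.\<close>

definition multiplier :: "('e \<Rightarrow> real) \<Rightarrow> bool" where
  "multiplier p \<longleftrightarrow> (\<forall>x. \<bar>p x\<bar> \<le> 1) \<and>
     (\<forall>A\<in>completed_ring e. \<forall>\<epsilon>>0. \<exists>s\<in>simple_functions e. \<forall>x\<in>A. cmod (complex_of_real (p x) - s x) \<le> \<epsilon>)"

lemma simple_support: "f \<in> simple_functions e \<Longrightarrow> f -` (- {0}) \<in> completed_ring e"
  by (simp add: simple_functions_iff L.simple_on_vimage)

text \<open>The approximation of \<open>p\<close> is needed only on the support of \<open>f\<close>,
  which is a set of the completed ring; the error is therefore relative to the modulus of
  \<open>f\<close>.\<close>

lemma multiplier_approx: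
  assumes p: "multiplier p" and f: "f \<in> simple_functions e" and "0 < \<epsilon>"
  obtains g where "g \<in> simple_functions e"
    "\<And>x. cmod (complex_of_real (p x) * f x - g x) \<le> \<epsilon> * cmod (f x)"
proof -
  obtain s where s: "s \<in> simple_functions e"
    "\<And>x. x \<in> f -` (- {0}) \<Longrightarrow> cmod (complex_of_real (p x) - s x) \<le> \<epsilon>"
    using p[unfolded multiplier_def, THEN conjunct2, THEN bspec, OF simple_support[OF f]] \<open>0 < \<epsilon>\<close>
    by metis
  show ?thesis
  proof (rule that)
    show "(\<lambda>x. s x * f x) \<in> simple_functions e" by (rule simple_mult[OF s(1) f])
    fix x
    have "cmod (complex_of_real (p x) * f x - s x * f x) = cmod (complex_of_real (p x) - s x) * cmod (f x)"
      by (simp add: left_diff_distrib flip: norm_mult)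
    also have "\<dots> \<le> \<epsilon> * cmod (f x)"
      using s(2)[of x] by (cases "f x = 0") (auto intro: mult_right_mono)
    finally show "cmod (complex_of_real (p x) * f x - s x * f x) \<le> \<epsilon> * cmod (f x)" .
  qed
qed

lemma multiplier_bound: "multiplier p \<Longrightarrow> cmod (complex_of_real (p x) * z) \<le> cmod z"
  unfolding multiplier_def by (simp add: norm_mult mult_left_le_one_le)

text \<open>Approximate \<open>p * X n\<close> with relative error \<open>1 / (n + 1)\<close>. As
  the norms of \<open>X n\<close> are bounded, the errors vanish, and contractivity carries the
  Cauchy property from \<open>X\<close> to \<open>Y\<close>.\<close>

lemma multiplier_exists:
  assumes p: "multiplier p" and X: "X \<in> cauchy_seqs e"
  obtains Y where "Y \<in> cauchy_seqs e" "upper_null e (\<lambda>n x. complex_of_real (p x) * X n x - Y n x)"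
proof -
  have Xs: "X n \<in> simple_functions e" for n using X by (rule cauchy_seqs_simple)
  have "\<exists>g. g \<in> simple_functions e \<and>
      (\<forall>x. cmod (complex_of_real (p x) * X n x - g x) \<le> inverse (real (Suc n)) * cmod (X n x))" for n
    by (rule multiplier_approx[OF p Xs[of n], of "inverse (real (Suc n))"]) auto
  then obtain Y where Y: "\<And>n. Y n \<in> simple_functions e"
    "\<And>n x. cmod (complex_of_real (p x) * X n x - Y n x) \<le> inverse (real (Suc n)) * cmod (X n x)"
    by metis
  obtain K where K: "0 < K" "\<And>n. snorm e (X n) \<le> K" using cauchy_seqs_bounded[OF X] by metis
  let ?Z = "\<lambda>n x. complex_of_real (inverse (real (Suc n))) * X n x"
  have Zs: "?Z n \<in> simple_functions e" for n by (intro simple_scale Xs)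
  have Zn: "snorm e (?Z n) \<le> inverse (real (Suc n)) * K" for n
    using K by (simp add: snorm_scale[OF Xs] norm_inverse norm_mult divide_right_mono mult_left_mono del: of_nat_Suc of_real_inverse)
  have lim: "(\<lambda>n. inverse (real (Suc n)) * K) \<longlonglongrightarrow> 0"
    by (intro tendsto_mult_left_zero LIMSEQ_inverse_real_of_nat)
  have Z0: "(\<lambda>n. snorm e (?Z n)) \<longlonglongrightarrow> 0"
    by (rule snorm_tendsto_0I[OF lim Zs Zn])
  have YZ: "cmod (complex_of_real (p x) * X n x - Y n x) \<le> cmod (?Z n x)" for n x
    using Y(2)[of x n] by (simp add: norm_mult norm_inverse del: of_nat_Suc)
  have un: "upper_null e (\<lambda>n x. complex_of_real (p x) * X n x - Y n x)"
    unfolding upper_null_def using Zs YZ Z0 by (intro exI[of _ ?Z]) blast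
  have "Y \<in> cauchy_seqs e"
    unfolding cauchy_seqs_def
  proof (intro CollectI conjI allI impI Y(1))
    fix \<epsilon> :: real assume "0 < \<epsilon>"
    then have \<epsilon>3: "0 < \<epsilon> / 3" by simp
    obtain M where M: "\<And>m n. m \<ge> M \<Longrightarrow> n \<ge> M \<Longrightarrow> snorm e (\<lambda>x. X m x - X n x) < \<epsilon> / 3"
      using X \<epsilon>3 by (rule cauchy_seqsD) blast
    obtain N where N: "\<And>n. n \<ge> N \<Longrightarrow> snorm e (?Z n) < \<epsilon> / 3"
      using LIMSEQ_D[OF Z0 \<epsilon>3] by fastforce
    have "snorm e (\<lambda>x. Y m x - Y n x) < \<epsilon>" if "m \<ge> max M N" "n \<ge> max M N" for m n
    proof -
      have "snorm e (\<lambda>x. Y m x - Y n x) \<le>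
          snorm e (?Z m) + 1 * snorm e (?Z n) + 1 * snorm e (\<lambda>x. X m x - X n x)"
      proof (rule snorm_le_combination)
        fix x
        let ?y = "\<lambda>n. complex_of_real (p x) * X n x - Y n x"
        have "Y m x - Y n x = ?y n - ?y m + complex_of_real (p x) * (X m x - X n x)"
          by (simp add: algebra_simps)
        also have "cmod \<dots> \<le> (cmod (?y n) + cmod (?y m)) + cmod (complex_of_real (p x) * (X m x - X n x))"
          by (rule norm_triangle_le[OF add_mono[OF norm_triangle_ineq4 order_refl]])
        also have "\<dots> \<le> (cmod (?Z n x) + cmod (?Z m x)) + cmod (X m x - X n x)"
          by (intro add_mono YZ multiplier_bound[OF p])
        finally show "cmod (Y m x - Y n x) \<le> cmod (?Z m x) + 1 * cmod (?Z n x) + 1 * cmod (X m x - X n x)"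
          by simp
      qed (intro simple_diff Y(1) Xs Zs zero_le_one)+
      also have "\<dots> < \<epsilon>"
        using N[of m] N[of n] M[of m n] that by simp
      finally show ?thesis .
    qed
    then show "\<exists>N. \<forall>m\<ge>N. \<forall>n\<ge>N. snorm e (\<lambda>x. Y m x - Y n x) < \<epsilon>" by blast
  qed
  then show ?thesis using un by (rule that)
qed

text \<open>The description is unique because
  \<open>Y - Y' = (Y - p * X) + p * (X - X') + (p * X' - Y')\<close>, where each summand is null in
  the upper seminorm.\<close>

lemma mult_op_cls:
  assumes p: "multiplier p" and X: "X \<in> cauchy_seqs e" and Y: "Y \<in> cauchy_seqs e"
    and un: "upper_null e (\<lambda>n x. complex_of_real (p x) * X n x - Y n x)"
  shows "mult_op e p (cls e X) = cls e Y"
  unfolding mult_op_def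
proof (rule the_equality)
  show "cls e Y \<in> hspace e \<and>
    (\<exists>X\<in>cls e X. \<exists>Y\<in>cls e Y. upper_null e (\<lambda>n x. complex_of_real (p x) * X n x - Y n x))"
    using X Y un
    by (intro conjI cls_in_hspace bexI[of _ X] bexI[of _ Y]) (auto simp: mem_cls_iff seq_equiv_iff)
next
  fix v assume v: "v \<in> hspace e \<and>
    (\<exists>X\<in>cls e X. \<exists>Y\<in>v. upper_null e (\<lambda>n x. complex_of_real (p x) * X n x - Y n x))"
  then obtain V where V: "V \<in> cauchy_seqs e" "v = cls e V" by (auto elim: hspaceE)
  from v obtain X' Y' where X': "(X, X') \<in> seq_equiv e" and Y': "(V, Y') \<in> seq_equiv e"
    and un': "upper_null e (\<lambda>n x. complex_of_real (p x) * X' n x - Y' n x)"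
    by (auto simp: V mem_cls_iff)
  have c: "X' \<in> cauchy_seqs e" "Y' \<in> cauchy_seqs e" using X' Y' by (auto simp: seq_equiv_iff)
  have "upper_null e (\<lambda>n x. X n x - X' n x)"
    using X' X c by (subst upper_null_simple_iff) (auto simp: seq_equiv_iff intro: simple_diff cauchy_seqs_simple)
  then have "upper_null e (\<lambda>n x. complex_of_real (p x) * (X n x - X' n x))"
    by (rule upper_null_mono) (rule multiplier_bound[OF p])
  moreover have "upper_null e (\<lambda>n x. Y n x - complex_of_real (p x) * X n x)"
    using un by (rule upper_null_mono) (simp add: norm_minus_commute)
  ultimately have "upper_null e (\<lambda>n x. ((Y n x - complex_of_real (p x) * X n x) +
      complex_of_real (p x) * (X n x - X' n x)) + (complex_of_real (p x) * X' n x - Y' n x))"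
    by (intro upper_null_add un')
  then have "upper_null e (\<lambda>n x. Y n x - Y' n x)"
    by (simp add: algebra_simps)
  then have "(\<lambda>n. snorm e (\<lambda>x. Y n x - Y' n x)) \<longlonglongrightarrow> 0"
    using Y c by (subst (asm) upper_null_simple_iff) (auto intro: simple_diff cauchy_seqs_simple)
  then have "cls e Y = cls e Y'" using Y c by (simp add: cls_eq_iff seq_equiv_iff)
  moreover have "cls e V = cls e Y'" using V c Y' by (simp add: cls_eq_iff)
  ultimately show "v = cls e Y" using V by simp
qed

text \<open>Uniform convergence on sets of the completed ring yields strong convergence: fix one
  \<open>X m\<close> close to the tail of \<open>X\<close>. On its support the convergence is
  uniform, and on \<open>X n - X m\<close> the crude bound 2 for the difference of the multipliers
  is enough.\<close>

lemma hdist_mult_op_tendsto: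
  assumes p: "\<And>N. multiplier (p N)" and q: "multiplier q"
    and unif: "\<And>A \<epsilon>. A \<in> completed_ring e \<Longrightarrow> 0 < \<epsilon> \<Longrightarrow>
                 \<forall>\<^sub>F N in sequentially. \<forall>x\<in>A. \<bar>p N x - q x\<bar> \<le> \<epsilon>"
    and u: "u \<in> hspace e"
  shows "(\<lambda>N. hdist e (mult_op e (p N) u) (mult_op e q u)) \<longlonglongrightarrow> 0"
proof -
  obtain X where X: "X \<in> cauchy_seqs e" "u = cls e X" using u by (rule hspaceE)
  have Xs: "X n \<in> simple_functions e" for n using X by (auto intro: cauchy_seqs_simple)
  obtain Y where Y: "Y \<in> cauchy_seqs e" "upper_null e (\<lambda>n x. complex_of_real (q x) * X n x - Y n x)"
    using multiplier_exists[OF q X(1)] .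
  have "\<exists>Y. Y \<in> cauchy_seqs e \<and> upper_null e (\<lambda>n x. complex_of_real (p N x) * X n x - Y n x)" for N
    using multiplier_exists[OF p X(1)] by metis
  then obtain P where P: "\<And>N. P N \<in> cauchy_seqs e"
    "\<And>N. upper_null e (\<lambda>n x. complex_of_real (p N x) * X n x - P N n x)"
    by metis
  have Ps: "P N n \<in> simple_functions e" and Ys: "Y n \<in> simple_functions e" for N n
    using P(1) Y(1) by (auto intro: cauchy_seqs_simple)
  have eq: "mult_op e (p N) u = cls e (P N)" "mult_op e q u = cls e Y" for N
    unfolding X(2) by (intro mult_op_cls p q X P Y)+
  obtain K where K: "0 < K" "\<And>n. snorm e (X n) \<le> K" using cauchy_seqs_bounded[OF X(1)] by metis
  have nonneg: "0 \<le> hdist e (cls e (P N)) (cls e Y)" for N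
    by (intro hdist_nonneg cls_in_hspace P Y)
  have "(\<lambda>N. hdist e (cls e (P N)) (cls e Y)) \<longlonglongrightarrow> 0"
  proof (rule tendstoI)
    fix \<epsilon> :: real assume "0 < \<epsilon>"
    \<comment> \<open>Three such parts get used: two from the crude bound 2 on
      \<open>X n - X m\<close>, one from the uniform bound on the support of
      \<open>X m\<close>.\<close>
    let ?r = "\<epsilon> / 5"
    have r: "0 < ?r" "0 < ?r / K" using \<open>0 < \<epsilon>\<close> K(1) by auto
    obtain m where m: "\<And>n. n \<ge> m \<Longrightarrow> snorm e (\<lambda>x. X n x - X m x) < ?r"
      using X(1) r(1) by (rule cauchy_seqsD) blast
    have "\<forall>\<^sub>F N in sequentially. \<forall>x\<in>X m -` (- {0}). \<bar>p N x - q x\<bar> \<le> ?r / K"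
      using simple_support[OF Xs] r(2) by (rule unif)
    then show "\<forall>\<^sub>F N in sequentially. dist (hdist e (cls e (P N)) (cls e Y)) 0 < \<epsilon>"
    proof eventually_elim
      case (elim N)
      have W: "cmod (complex_of_real (p N x - q x) * X n x) \<le> 2 * cmod (X n x - X m x) + ?r / K * cmod (X m x)" for n x
      proof -
        have b: "\<bar>p N x - q x\<bar> \<le> 2"
          using p[of N] q unfolding multiplier_def by (metis abs_triangle_ineq4 add_mono one_add_one order_trans)
        have "cmod (complex_of_real (p N x - q x) * X n x) \<le>
            cmod (complex_of_real (p N x - q x) * (X n x - X m x)) + cmod (complex_of_real (p N x - q x) * X m x)"
          using norm_triangle_ineq[of "complex_of_real (p N x - q x) * (X n x - X m x)"
              "complex_of_real (p N x - q x) * X m x"] by (simp add: algebra_simps)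
        also have "cmod (complex_of_real (p N x - q x) * (X n x - X m x)) \<le> 2 * cmod (X n x - X m x)"
          unfolding norm_mult norm_of_real using b by (intro mult_right_mono) auto
        also have "cmod (complex_of_real (p N x - q x) * X m x) \<le> ?r / K * cmod (X m x)"
        proof (cases "X m x = 0")
          case False
          then have "\<bar>p N x - q x\<bar> \<le> ?r / K" using elim by simp
          then show ?thesis unfolding norm_mult norm_of_real by (rule mult_right_mono) simp
        qed simp
        finally show ?thesis by simp
      qed
      have "upper_null e (\<lambda>n x. P N n x - complex_of_real (p N x) * X n x)"
        using P(2)[of N] by (rule upper_null_mono) (simp add: norm_minus_commute)
      from upper_null_add[OF this Y(2)]
      obtain Z where Z: "\<And>n. Z n \<in> simple_functions e"
        "\<And>n x. cmod ((P N n x - complex_of_real (p N x) * X n x) + (complex_of_real (q x) * X n x - Y n x))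
            \<le> cmod (Z n x)"
        "(\<lambda>n. snorm e (Z n)) \<longlonglongrightarrow> 0"
        unfolding upper_null_def by blast
      have le: "snorm e (\<lambda>x. P N n x - Y n x) \<le> snorm e (Z n) + 3 * ?r" if "n \<ge> m" for n
      proof -
        have "snorm e (\<lambda>x. P N n x - Y n x) \<le>
            snorm e (Z n) + 2 * snorm e (\<lambda>x. X n x - X m x) + ?r / K * snorm e (X m)"
        proof (rule snorm_le_combination)
          fix x
          have "P N n x - Y n x = ((P N n x - complex_of_real (p N x) * X n x) +
              (complex_of_real (q x) * X n x - Y n x)) + complex_of_real (p N x - q x) * X n x"
            by (simp add: algebra_simps)
          also have "cmod \<dots> \<le> cmod (Z n x) + (2 * cmod (X n x - X m x) + ?r / K * cmod (X m x))"
            by (rule norm_triangle_le[OF add_mono[OF Z(2) W]])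
          finally show "cmod (P N n x - Y n x) \<le>
              cmod (Z n x) + 2 * cmod (X n x - X m x) + ?r / K * cmod (X m x)" by simp
        next
          show "0 \<le> ?r / K" using r(2) by simp
        qed (intro simple_diff Ps Ys Xs Z zero_le_numeral)+
        moreover have "?r / K * snorm e (X m) \<le> ?r / K * K"
          using r(2) by (intro mult_left_mono K(2)) simp
        moreover have "?r / K * K = ?r" using K(1) by simp
        ultimately show ?thesis using m[OF that] by linarith
      qed
      have "hdist e (cls e (P N)) (cls e Y) \<le> 0 + 3 * ?r"
        by (rule LIMSEQ_le[OF hdist_cls[OF P(1) Y(1)] tendsto_add[OF Z(3) tendsto_const]])
          (use le in blast)
      also have "\<dots> < \<epsilon>" using \<open>0 < \<epsilon>\<close> by simp
      finally show ?case using nonneg[of N] by simp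
    qed
  qed
  then show ?thesis by (simp add: eq)
qed

lemma mult_op_in_hspace:
  assumes "multiplier p" "u \<in> hspace e"
  shows "mult_op e p u \<in> hspace e"
proof -
  obtain X where X: "X \<in> cauchy_seqs e" "u = cls e X" using assms(2) by (rule hspaceE)
  obtain Y where Y: "Y \<in> cauchy_seqs e" "upper_null e (\<lambda>n x. complex_of_real (p x) * X n x - Y n x)"
    using multiplier_exists[OF assms(1) X(1)] .
  show ?thesis
    unfolding X(2) mult_op_cls[OF assms(1) X(1) Y] by (rule cls_in_hspace[OF Y(1)])
qed

end

section \<open>Multiplication by Gaussian functions\<close>

lemma summable_weighted:
  fixes d y :: "nat \<Rightarrow> real"
  assumes "summable d" "\<And>k. 0 \<le> d k" "\<And>k. \<bar>y k\<bar> \<le> B"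
  shows "summable (\<lambda>k. d k * y k)"
proof (rule summable_comparison_test')
  show "summable (\<lambda>k. d k * B)" using assms(1) by (rule summable_mult2)
  show "norm (d k * y k) \<le> d k * B" for k
    using assms(2)[of k] assms(3)[of k] by (simp add: abs_mult mult_left_mono)
qed

lemma exp_neg_diff_le:
  fixes a b :: real
  assumes "0 \<le> a" "0 \<le> b"
  shows "\<bar>exp (- a) - exp (- b)\<bar> \<le> \<bar>a - b\<bar>"
proof -
  have *: "exp (- a) - exp (- b) \<le> b - a" if "0 \<le> a" "a \<le> b" for a b :: real
  proof -
    have "exp (- a) - exp (- b) = exp (- a) * (1 - exp (a - b))"
      by (simp add: right_diff_distrib flip: exp_add)
    also have "\<dots> \<le> 1 * (1 - exp (a - b))"
      using that by (intro mult_right_mono) auto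
    also have "\<dots> = 1 - exp (a - b)" by simp
    also have "\<dots> \<le> b - a" using exp_ge_add_one_self[of "a - b"] by linarith
    finally show ?thesis .
  qed
  show ?thesis
    using *[of a b] *[of b a] assms by (cases "a \<le> b") auto
qed

context orthonormal_seq
begin

text \<open>Here the requirement that the bounds lie in \<open>\<ell>\<^sub>\<infinity>\<close>
  takes effect; it makes the tails of a weighted sum of squared coordinates uniformly small on each
  set.\<close>

lemma coords_bounded:
  assumes "A \<in> completed_ring e"
  obtains M where "0 \<le> M" "\<And>x k. x \<in> A \<Longrightarrow> \<bar>x \<bullet> e k\<bar> \<le> M"
proof -
  have ring: "\<exists>M. \<forall>x\<in>C. \<forall>k. \<bar>x \<bullet> e k\<bar> \<le> M" if "C \<in> block_ring e" for C
    using that unfolding block_ring_def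
  proof (induction rule: ring_hull_induct)
    case (basic C)
    then show ?case
    proof (cases rule: am_blocks_cases)
      case (2 a b)
      then obtain K L where KL: "\<And>j. \<bar>a j\<bar> \<le> K" "\<And>j. \<bar>b j\<bar> \<le> L"
        by (auto simp: proper_def block_bounds_def bounded_iff)
      have "\<bar>x \<bullet> e k\<bar> \<le> max K L" if "x \<in> C" for x k
      proof -
        have "a k \<le> x \<bullet> e k" "x \<bullet> e k < b k" using that 2 by (auto simp: block_def)
        with KL[of k] show ?thesis by linarith
      qed
      then show ?thesis by blast
    qed simp
  next
    case (union A B)
    then obtain K L where "\<forall>x\<in>A. \<forall>k. \<bar>x \<bullet> e k\<bar> \<le> K" "\<forall>x\<in>B. \<forall>k. \<bar>x \<bullet> e k\<bar> \<le> L" by blast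
    then show ?case by (intro exI[of _ "max K L"]) (auto intro: le_max_iff_disj[THEN iffD2])
  next
    case (diff A B)
    then show ?case by blast
  qed simp
  obtain C where C: "C \<in> block_ring e" "A \<subseteq> C"
    using bm.jordanE[OF assms[unfolded completed_ring_eq] zero_less_one] by metis
  from ring[OF C(1)] obtain M where "\<forall>x\<in>C. \<forall>k. \<bar>x \<bullet> e k\<bar> \<le> M" ..
  with C(2) show ?thesis by (intro that[of "max 0 M"]) (auto intro: le_max_iff_disj[THEN iffD2])
qed

section \<open>Coordinate slabs and rounded coordinates\<close>

lemma block_Int_slab:
  "block e a b \<inter> {x. c \<le> x \<bullet> e k \<and> x \<bullet> e k < d} =
     block e (a(k := max (a k) c)) (b(k := min (b k) d))"
  by (auto simp: block_def)

lemma proper_slab: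
  assumes P: "proper a b" and ne: "block e (a(k := max (a k) c)) (b(k := min (b k) d)) \<noteq> {}"
  shows "proper (a(k := max (a k) c)) (b(k := min (b k) d))"
proof -
  let ?a = "a(k := max (a k) c)" and ?b = "b(k := min (b k) d)"
  obtain x where x: "x \<in> block e ?a ?b" using ne by blast
  have less: "?a j < ?b j" for j
  proof -
    have "?a j \<le> x \<bullet> e j \<and> x \<bullet> e j < ?b j" using x unfolding block_def by blast
    then show ?thesis by linarith
  qed
  have bd: "bounded (range (f(k := v)))" if "bounded (range f)" for f :: "nat \<Rightarrow> real" and v
  proof (rule bounded_subset)
    show "bounded (insert v (range f))" using that by simp
  qed auto
  have "summable (\<lambda>j. max 0 (ln (?b j - ?a j)))"
  proof (rule summable_comparison_test')
    show "summable (\<lambda>j. max 0 (ln (b j - a j)))" using P by (simp add: proper_def)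
    fix j
    have "ln (?b j - ?a j) \<le> ln (b j - a j)"
      using less[of j] by (subst ln_le_cancel_iff) (auto split: if_splits)
    then show "norm (max 0 (ln (?b j - ?a j))) \<le> max 0 (ln (b j - a j))" by auto
  qed
  then show ?thesis
    using P ne less bd unfolding proper_def block_bounds_def by blast
qed

text \<open>Stands in for measurability of the coordinates. A slab alone belongs to no ring here,
  but cutting a block by it gives a block or the empty set.\<close>

lemma completed_ring_slab:
  assumes "A \<in> completed_ring e"
  shows "A \<inter> {x. c \<le> x \<bullet> e k \<and> x \<bullet> e k < d} \<in> completed_ring e"
proof -
  let ?S = "{x. c \<le> x \<bullet> e k \<and> x \<bullet> e k < d}"
  have ring: "C \<inter> ?S \<in> block_ring e" if "C \<in> block_ring e" for C
    using that unfolding block_ring_def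
  proof (induction rule: ring_hull_induct)
    case (basic C)
    then show ?case
    proof (cases rule: am_blocks_cases)
      case (2 a b)
      then show ?thesis
        using proper_slab[of a b k c d] proper_block_ring
        by (cases "block e (a(k := max (a k) c)) (b(k := min (b k) d)) = {}")
          (auto simp: block_Int_slab simp flip: block_ring_def)
    qed (simp flip: block_ring_def)
  next
    case (union A B)
    then show ?case by (auto simp: Int_Un_distrib2 simp flip: block_ring_def)
  next
    case (diff A B)
    have "(A - B) \<inter> ?S = (A \<inter> ?S) - (B \<inter> ?S)" by blast
    with diff show ?case using block_ring.Diff[unfolded block_ring_def] by simp
  qed (simp flip: block_ring_def)
  show ?thesis
    unfolding completed_ring_def
  proof (intro CollectI allI impI)
    fix \<epsilon> :: real assume "0 < \<epsilon>"
    with assms obtain B C where BC: "B \<in> block_ring e" "C \<in> block_ring e" "B \<subseteq> A" "A \<subseteq> C"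
      "block_measure e (C - B) < \<epsilon>"
      unfolding completed_ring_def by blast
    have "block_measure e (C \<inter> ?S - B \<inter> ?S) \<le> block_measure e (C - B)"
      by (intro bm.content_mono block_ring.Diff ring BC(1,2)) blast
    also note BC(5)
    finally show "\<exists>B\<in>block_ring e. \<exists>C\<in>block_ring e. B \<subseteq> A \<inter> ?S \<and> A \<inter> ?S \<subseteq> C \<and>
        block_measure e (C - B) < \<epsilon>"
      using BC(1-4) ring
      by (intro bexI[of _ "B \<inter> ?S"] bexI[of _ "C \<inter> ?S"] conjI Int_mono subset_refl)
  qed
qed

text \<open>A simple function uniformly close to the coordinate on \<open>A\<close>. The cutoff
  confines the nonzero level sets to \<open>A\<close>, where the coordinate is bounded and hence
  takes only finitely many rounded values.\<close>

definition step :: "'e set \<Rightarrow> real \<Rightarrow> nat \<Rightarrow> 'e \<Rightarrow> real" where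
  "step A \<eta> k x = indicator A x * (\<eta> * \<lfloor>(x \<bullet> e k) / \<eta>\<rfloor>)"

lemma step_approx:
  assumes "0 < \<eta>" "x \<in> A"
  shows "\<bar>x \<bullet> e k - step A \<eta> k x\<bar> \<le> \<eta>"
proof -
  let ?y = "(x \<bullet> e k) / \<eta>"
  have "x \<bullet> e k - step A \<eta> k x = \<eta> * (?y - of_int \<lfloor>?y\<rfloor>)"
    using assms by (simp add: step_def right_diff_distrib)
  moreover have "0 \<le> ?y - of_int \<lfloor>?y\<rfloor>" "?y - of_int \<lfloor>?y\<rfloor> \<le> 1"
    using floor_correct[of ?y] by linarith+
  ultimately show ?thesis
    using assms(1) mult_left_mono[of "?y - of_int \<lfloor>?y\<rfloor>" 1 \<eta>] by (simp add: abs_mult)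
qed

lemma simple_step:
  assumes A: "A \<in> completed_ring e" and \<eta>: "0 < \<eta>"
  shows "simple_on (completed_ring e) (step A \<eta> k)"
  unfolding simple_on_def
proof (intro conjI allI impI)
  obtain M where M: "0 \<le> M" "\<And>x k. x \<in> A \<Longrightarrow> \<bar>x \<bullet> e k\<bar> \<le> M" using coords_bounded[OF A] by metis
  have "range (step A \<eta> k) \<subseteq> insert 0 ((\<lambda>i. \<eta> * real_of_int i) ` {\<lfloor>- M / \<eta>\<rfloor>..\<lfloor>M / \<eta>\<rfloor>})"
  proof (rule image_subsetI)
    fix x
    show "step A \<eta> k x \<in> insert 0 ((\<lambda>i. \<eta> * real_of_int i) ` {\<lfloor>- M / \<eta>\<rfloor>..\<lfloor>M / \<eta>\<rfloor>})"
    proof (cases "x \<in> A")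
      case True
      have "- M / \<eta> \<le> (x \<bullet> e k) / \<eta>"
        using M(2)[OF True, of k] \<eta> by (intro divide_right_mono) linarith+
      moreover have "(x \<bullet> e k) / \<eta> \<le> M / \<eta>"
        using M(2)[OF True, of k] \<eta> by (intro divide_right_mono) linarith+
      ultimately have "\<lfloor>(x \<bullet> e k) / \<eta>\<rfloor> \<in> {\<lfloor>- M / \<eta>\<rfloor>..\<lfloor>M / \<eta>\<rfloor>}" by (auto intro: floor_mono)
      moreover have "step A \<eta> k x = \<eta> * real_of_int \<lfloor>(x \<bullet> e k) / \<eta>\<rfloor>"
        using True by (simp add: step_def)
      ultimately show ?thesis by blast
    qed (simp add: step_def)
  qed
  then show "finite (range (step A \<eta> k))" by (rule finite_subset) simp
next
  fix u :: real assume u: "u \<noteq> 0"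
  show "step A \<eta> k -` {u} \<in> completed_ring e"
  proof (cases "\<exists>i::int. u = \<eta> * i")
    case True
    then obtain i :: int where i: "u = \<eta> * i" by blast
    have "step A \<eta> k x = u \<longleftrightarrow> x \<in> A \<and> \<eta> * i \<le> x \<bullet> e k \<and> x \<bullet> e k < \<eta> * (i + 1)" for x
    proof (cases "x \<in> A")
      case True
      then have "step A \<eta> k x = u \<longleftrightarrow> \<lfloor>(x \<bullet> e k) / \<eta>\<rfloor> = i"
        using \<eta> by (simp add: step_def i)
      also have "\<dots> \<longleftrightarrow> of_int i \<le> (x \<bullet> e k) / \<eta> \<and> (x \<bullet> e k) / \<eta> < of_int i + 1"
        by (rule floor_eq_iff)
      also have "\<dots> \<longleftrightarrow> \<eta> * i \<le> x \<bullet> e k \<and> x \<bullet> e k < \<eta> * (i + 1)"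
        using \<eta> by (simp add: pos_le_divide_eq pos_divide_less_eq mult.commute)
      finally show ?thesis using True by simp
    qed (use u in \<open>simp add: step_def\<close>)
    then have "step A \<eta> k -` {u} = A \<inter> {x. \<eta> * i \<le> x \<bullet> e k \<and> x \<bullet> e k < \<eta> * (i + 1)}"
      by auto
    then show ?thesis using completed_ring_slab[OF A] by simp
  next
    case False
    then have "step A \<eta> k -` {u} = {}"
      using u by (auto simp: step_def indicator_def split: if_splits)
    then show ?thesis by simp
  qed
qed

definition quad :: "(nat \<Rightarrow> real) \<Rightarrow> 'e \<Rightarrow> real" where
  "quad d x = (\<Sum>k. d k * (x \<bullet> e k)\<^sup>2)"

lemma summable_quad:
  assumes "summable d" "\<And>k. 0 \<le> d k"
  shows "summable (\<lambda>k. d k * (x \<bullet> e k)\<^sup>2)"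
proof (rule summable_weighted[OF assms])
  show "\<bar>(x \<bullet> e k)\<^sup>2\<bar> \<le> (norm x)\<^sup>2" for k
    using abs_coord_le[of x k] by (simp add: abs_le_square_iff[symmetric])
qed

lemma quad_nonneg: "summable d \<Longrightarrow> (\<And>k. 0 \<le> d k) \<Longrightarrow> 0 \<le> quad d x"
  unfolding quad_def by (intro suminf_nonneg summable_quad) auto

lemma quad_tail_le:
  assumes d: "summable d" "\<And>k. 0 \<le> d k" and M: "\<And>k. \<bar>x \<bullet> e k\<bar> \<le> M"
  shows "\<bar>quad d x - (\<Sum>k<N. d k * (x \<bullet> e k)\<^sup>2)\<bar> \<le> M\<^sup>2 * (\<Sum>k. d (k + N))"
proof -
  have s: "summable (\<lambda>k. d k * (x \<bullet> e k)\<^sup>2)" by (rule summable_quad[OF d])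
  have sN: "summable (\<lambda>k. d (k + N) * (x \<bullet> e (k + N))\<^sup>2)" using s by (rule summable_ignore_initial_segment)
  have dN: "summable (\<lambda>k. d (k + N))" using d(1) by (rule summable_ignore_initial_segment)
  have "quad d x - (\<Sum>k<N. d k * (x \<bullet> e k)\<^sup>2) = (\<Sum>k. d (k + N) * (x \<bullet> e (k + N))\<^sup>2)"
    unfolding quad_def using suminf_minus_initial_segment[OF s, of N] by simp
  moreover have "0 \<le> (\<Sum>k. d (k + N) * (x \<bullet> e (k + N))\<^sup>2)"
    using d by (intro suminf_nonneg sN) auto
  moreover have "(\<Sum>k. d (k + N) * (x \<bullet> e (k + N))\<^sup>2) \<le> (\<Sum>k. d (k + N) * M\<^sup>2)"
  proof (rule suminf_le[OF _ sN])
    show "summable (\<lambda>k. d (k + N) * M\<^sup>2)" using dN by (rule summable_mult2)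
    fix k
    have "(x \<bullet> e (k + N))\<^sup>2 \<le> M\<^sup>2"
      using power_mono[OF M[of "k + N"], of 2] by simp
    then show "d (k + N) * (x \<bullet> e (k + N))\<^sup>2 \<le> d (k + N) * M\<^sup>2"
      using d(2) by (rule mult_left_mono)
  qed
  moreover have "(\<Sum>k. d (k + N) * M\<^sup>2) = M\<^sup>2 * (\<Sum>k. d (k + N))"
    using suminf_mult2[OF dN, of "M\<^sup>2"] by (simp add: mult.commute)
  ultimately show ?thesis by simp
qed

lemma quad_le:
  assumes "summable d" "\<And>k. 0 \<le> d k" "\<And>k. \<bar>x \<bullet> e k\<bar> \<le> M"
  shows "quad d x \<le> M\<^sup>2 * suminf d"
  using quad_tail_le[OF assms, of 0] by simp

text \<open>Drop the tail of the quadratic form, which is uniformly small on \<open>A\<close>, and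
  round the finitely many remaining coordinates to a grid. Since \<open>exp (- a)\<close> is
  1-Lipschitz for nonnegative \<open>a\<close>, both errors pass to the exponential.\<close>

lemma multiplier_gauss:
  assumes d: "summable d" "\<And>k. 0 \<le> d k" and t: "0 \<le> t"
  shows "multiplier (\<lambda>x. exp (- (t / 2 * quad d x)))"
  unfolding multiplier_def
proof (intro conjI allI ballI impI)
  show "\<bar>exp (- (t / 2 * quad d x))\<bar> \<le> 1" for x
    using quad_nonneg[OF d, of x] t by simp
next
  fix A \<epsilon> assume A: "A \<in> completed_ring e" and "(0::real) < \<epsilon>"
  obtain M where M: "0 \<le> M" "\<And>x k. x \<in> A \<Longrightarrow> \<bar>x \<bullet> e k\<bar> \<le> M" using coords_bounded[OF A] by metis
  \<comment> \<open>One \<open>\<delta>\<close> is for the tail and one for the rounding; the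
    Lipschitz estimate turns them into \<open>t * \<delta> \<le> \<epsilon>\<close>. Adding 1 covers
    \<open>t = 0\<close>.\<close>
  define \<delta> where "\<delta> = \<epsilon> / (t + 1)"
  have \<delta>: "0 < \<delta>" "t / 2 * (\<delta> + \<delta>) \<le> \<epsilon>"
  proof -
    show "0 < \<delta>" using \<open>0 < \<epsilon>\<close> t by (simp add: \<delta>_def)
    then have "t / 2 * (\<delta> + \<delta>) \<le> (t + 1) * \<delta>" by (simp add: distrib_right)
    also have "\<dots> = \<epsilon>" using t by (simp add: \<delta>_def)
    finally show "t / 2 * (\<delta> + \<delta>) \<le> \<epsilon>" .
  qed
  obtain N where N: "M\<^sup>2 * (\<Sum>k. d (k + N)) \<le> \<delta>"
  proof -
    have "(\<lambda>N. M\<^sup>2 * (\<Sum>k. d (k + N))) \<longlonglongrightarrow> M\<^sup>2 * 0"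
      by (intro tendsto_mult tendsto_const suminf_exist_split2 d)
    then have "\<forall>\<^sub>F N in sequentially. M\<^sup>2 * (\<Sum>k. d (k + N)) < \<delta>"
      using \<delta>(1) by (intro order_tendstoD(2)) auto
    then obtain N where "M\<^sup>2 * (\<Sum>k. d (k + N)) < \<delta>"
      using eventually_happens'[OF sequentially_bot] by blast
    then show ?thesis by (intro that less_imp_le)
  qed
  define S where "S = (\<Sum>k<N. d k)"
  have S: "0 \<le> S" unfolding S_def using d by (intro sum_nonneg) auto
  \<comment> \<open>A difference of squares factors into a difference of size \<open>\<eta>\<close>
    and a sum of size \<open>2 * M + \<eta>\<close>, hence the cap at 1. The weights contribute
    \<open>S\<close>, and \<open>S + 1\<close> keeps the divisor positive.\<close>
  define \<eta> where "\<eta> = min 1 (\<delta> / ((2 * M + 1) * (S + 1)))"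
  have pos: "0 < (2 * M + 1) * (S + 1)" using M(1) S by (intro mult_pos_pos) auto
  have \<eta>: "0 < \<eta>" "\<eta> \<le> 1" using \<delta>(1) pos by (auto simp: \<eta>_def)
  have \<eta>S: "\<eta> * (2 * M + 1) * S \<le> \<delta>"
  proof -
    have "\<eta> * (2 * M + 1) * S \<le> \<eta> * ((2 * M + 1) * (S + 1))"
      using \<eta> M(1) S by (simp add: mult.assoc mult_left_mono)
    also have "\<dots> \<le> \<delta> / ((2 * M + 1) * (S + 1)) * ((2 * M + 1) * (S + 1))"
      using pos by (intro mult_right_mono) (auto simp: \<eta>_def)
    also have "\<dots> = \<delta>" using pos by (metis nonzero_divide_eq_eq order_less_irrefl)
    finally show ?thesis .
  qed
  let ?\<sigma> = "\<lambda>x. \<Sum>k<N. d k * (step A \<eta> k x)\<^sup>2"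
  let ?s = "\<lambda>x. complex_of_real (indicator A x * exp (- (t / 2 * ?\<sigma> x)))"
  have "simple_on (completed_ring e) (\<lambda>x. d k * (step A \<eta> k x)\<^sup>2)" for k
    using L.simple_on_comp[OF simple_step[OF A \<eta>(1), of k], of "\<lambda>u. d k * u\<^sup>2"] by simp
  then have \<sigma>: "simple_on (completed_ring e) ?\<sigma>" by (rule L.simple_on_sum)
  have ind: "simple_on (completed_ring e) (indicator A :: 'e \<Rightarrow> real)"
    using L.simple_on_indicator[OF A, of "1::real"] by simp
  have s: "?s \<in> simple_functions e"
    unfolding simple_functions_iff
    by (rule L.simple_on_comp2[OF ind \<sigma>, of "\<lambda>u v. complex_of_real (u * exp (- (t / 2 * v)))"]) simp
  show "\<exists>s\<in>simple_functions e. \<forall>x\<in>A. cmod (complex_of_real (exp (- (t / 2 * quad d x))) - s x) \<le> \<epsilon>"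
  proof (intro bexI[OF _ s] ballI)
    fix x assume x: "x \<in> A"
    have sq: "\<bar>(x \<bullet> e k)\<^sup>2 - (step A \<eta> k x)\<^sup>2\<bar> \<le> \<eta> * (2 * M + 1)" for k
    proof -
      have 1: "\<bar>x \<bullet> e k - step A \<eta> k x\<bar> \<le> \<eta>" by (rule step_approx[OF \<eta>(1) x])
      have 2: "\<bar>x \<bullet> e k + step A \<eta> k x\<bar> \<le> 2 * M + 1" using 1 M(2)[OF x, of k] \<eta>(2) by linarith
      have "\<bar>(x \<bullet> e k)\<^sup>2 - (step A \<eta> k x)\<^sup>2\<bar> = \<bar>x \<bullet> e k - step A \<eta> k x\<bar> * \<bar>x \<bullet> e k + step A \<eta> k x\<bar>"
        by (simp add: power2_eq_square square_diff_square_factored mult.commute flip: abs_mult)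
      also have "\<dots> \<le> \<eta> * (2 * M + 1)" using 1 2 \<eta>(1) by (intro mult_mono) auto
      finally show ?thesis .
    qed
    have "\<bar>(\<Sum>k<N. d k * (x \<bullet> e k)\<^sup>2) - ?\<sigma> x\<bar> \<le> (\<Sum>k<N. \<bar>d k * (x \<bullet> e k)\<^sup>2 - d k * (step A \<eta> k x)\<^sup>2\<bar>)"
      unfolding sum_subtractf[symmetric] by (rule sum_abs)
    also have "\<dots> \<le> (\<Sum>k<N. d k * (\<eta> * (2 * M + 1)))"
    proof (rule sum_mono)
      fix k
      show "\<bar>d k * (x \<bullet> e k)\<^sup>2 - d k * (step A \<eta> k x)\<^sup>2\<bar> \<le> d k * (\<eta> * (2 * M + 1))"
        unfolding right_diff_distrib[symmetric] abs_mult
        using d(2)[of k] sq[of k] by (simp add: mult_left_mono)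
    qed
    also have "\<dots> = \<eta> * (2 * M + 1) * S" by (simp add: S_def sum_distrib_right[symmetric] mult.commute)
    also note \<eta>S
    finally have "\<bar>quad d x - ?\<sigma> x\<bar> \<le> \<delta> + \<delta>"
      using quad_tail_le[OF d M(2)[OF x], of N] N by linarith
    then have "t / 2 * \<bar>quad d x - ?\<sigma> x\<bar> \<le> t / 2 * (\<delta> + \<delta>)"
      using t by (intro mult_left_mono) auto
    then have "\<bar>t / 2 * quad d x - t / 2 * ?\<sigma> x\<bar> \<le> t / 2 * (\<delta> + \<delta>)"
      unfolding right_diff_distrib[symmetric] abs_mult using t by simp
    moreover have "\<bar>exp (- (t / 2 * quad d x)) - exp (- (t / 2 * ?\<sigma> x))\<bar> \<le> \<bar>t / 2 * quad d x - t / 2 * ?\<sigma> x\<bar>"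
      using t d quad_nonneg[OF d, of x]
      by (intro exp_neg_diff_le mult_nonneg_nonneg sum_nonneg) auto
    ultimately have "\<bar>exp (- (t / 2 * quad d x)) - exp (- (t / 2 * ?\<sigma> x))\<bar> \<le> \<epsilon>"
      using \<delta>(2) by linarith
    then show "cmod (complex_of_real (exp (- (t / 2 * quad d x))) - ?s x) \<le> \<epsilon>"
      using x by (simp add: norm_of_real flip: of_real_diff)
  qed
qed

text \<open>Exhibits the approximants in \<open>U_hat_op\<close> as Gaussian multipliers with
  truncated weights, so one lemma covers them and their limit.\<close>

lemma quad_truncate: "quad (\<lambda>k. if k \<le> N then d k else 0) x = (\<Sum>k\<le>N. d k * (x \<bullet> e k)\<^sup>2)"
proof -
  have "quad (\<lambda>k. if k \<le> N then d k else 0) x = (\<Sum>k\<le>N. (if k \<le> N then d k else 0) * (x \<bullet> e k)\<^sup>2)"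
    unfolding quad_def by (rule suminf_finite) auto
  then show ?thesis by simp
qed

text \<open>The truncated exponents converge uniformly on each set of the completed ring, so the
  strong limit is multiplication by the full Gaussian factor; the triangle inequality gives
  uniqueness of the limit.\<close>

lemma U_hat_op_eq:
  assumes d: "summable (\<lambda>k. D (e k) \<bullet> e k)" "\<And>k. 0 \<le> D (e k) \<bullet> e k" and t: "0 \<le> t"
    and u: "u \<in> hspace e"
  shows "U_hat_op e D t u = mult_op e (\<lambda>x. exp (- (t / 2 * quad (\<lambda>k. D (e k) \<bullet> e k) x))) u"
proof -
  let ?d = "\<lambda>k. D (e k) \<bullet> e k"
  let ?p = "\<lambda>N x. exp (- (t / 2) * (\<Sum>k\<le>N. (D (e k) \<bullet> e k) * (x \<bullet> e k)\<^sup>2))"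
  let ?q = "\<lambda>x. exp (- (t / 2 * quad ?d x))"
  have p: "multiplier (?p N)" for N
  proof -
    have "summable (\<lambda>k. if k \<le> N then ?d k else 0)"
      by (rule summable_finite[of "{..N}"]) auto
    from multiplier_gauss[OF this _ t] show ?thesis
      by (simp add: quad_truncate d)
  qed
  have q: "multiplier ?q" by (rule multiplier_gauss[OF d t])
  have unif: "\<forall>\<^sub>F N in sequentially. \<forall>x\<in>A. \<bar>?p N x - ?q x\<bar> \<le> \<epsilon>"
    if A: "A \<in> completed_ring e" and "0 < \<epsilon>" for A \<epsilon>
  proof -
    obtain M where M: "0 \<le> M" "\<And>x k. x \<in> A \<Longrightarrow> \<bar>x \<bullet> e k\<bar> \<le> M" using coords_bounded[OF A] by metis
    have "(\<lambda>N. t / 2 * (M\<^sup>2 * (\<Sum>k. ?d (k + N)))) \<longlonglongrightarrow> t / 2 * (M\<^sup>2 * 0)"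
      by (intro tendsto_mult tendsto_const suminf_exist_split2 d)
    \<comment> \<open>The partial sums include the index \<open>N\<close>, so the tail starts at
      \<open>Suc N\<close>.\<close>
    then have "(\<lambda>N. t / 2 * (M\<^sup>2 * (\<Sum>k. ?d (k + Suc N)))) \<longlonglongrightarrow> t / 2 * (M\<^sup>2 * 0)"
      by (rule LIMSEQ_Suc)
    then have "\<forall>\<^sub>F N in sequentially. t / 2 * (M\<^sup>2 * (\<Sum>k. ?d (k + Suc N))) < \<epsilon>"
      using \<open>0 < \<epsilon>\<close> by (intro order_tendstoD(2)) auto
    then show ?thesis
    proof eventually_elim
      case (elim N)
      show ?case
      proof
        fix x assume x: "x \<in> A"
        let ?s = "\<Sum>k\<le>N. ?d k * (x \<bullet> e k)\<^sup>2"
        have "\<bar>?p N x - ?q x\<bar> \<le> \<bar>t / 2 * ?s - t / 2 * quad ?d x\<bar>"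
          using exp_neg_diff_le[of "t / 2 * ?s" "t / 2 * quad ?d x"] t d quad_nonneg[OF d, of x]
          by (simp add: sum_nonneg)
        also have "\<dots> = t / 2 * \<bar>quad ?d x - (\<Sum>k<Suc N. ?d k * (x \<bullet> e k)\<^sup>2)\<bar>"
          unfolding right_diff_distrib[symmetric] abs_mult lessThan_Suc_atMost
          using t by (simp add: abs_minus_commute)
        also have "\<dots> \<le> t / 2 * (M\<^sup>2 * (\<Sum>k. ?d (k + Suc N)))"
          using t by (intro mult_left_mono quad_tail_le[OF d M(2)[OF x]]) auto
        finally show "\<bar>?p N x - ?q x\<bar> \<le> \<epsilon>" using elim by linarith
      qed
    qed
  qed
  have lim: "(\<lambda>N. hdist e (mult_op e (?p N) u) (mult_op e ?q u)) \<longlonglongrightarrow> 0"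
    by (rule hdist_mult_op_tendsto[OF p q unif u])
  show ?thesis
    unfolding U_hat_op_def
  proof (rule the_equality)
    show "mult_op e ?q u \<in> hspace e \<and> (\<lambda>N. hdist e (mult_op e (?p N) u) (mult_op e ?q u)) \<longlonglongrightarrow> 0"
      using lim mult_op_in_hspace[OF q u] by blast
  next
    fix g assume g: "g \<in> hspace e \<and> (\<lambda>N. hdist e (mult_op e (?p N) u) g) \<longlonglongrightarrow> 0"
    have "hdist e g (mult_op e ?q u) \<le> 0 + 0"
    proof (rule LIMSEQ_le[OF tendsto_const tendsto_add])
      show "(\<lambda>N. hdist e (mult_op e (?p N) u) g) \<longlonglongrightarrow> 0" using g by blast
      show "(\<lambda>N. hdist e (mult_op e (?p N) u) (mult_op e ?q u)) \<longlonglongrightarrow> 0" by (rule lim)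
      show "\<exists>N. \<forall>n\<ge>N. hdist e g (mult_op e ?q u) \<le>
          hdist e (mult_op e (?p n) u) g + hdist e (mult_op e (?p n) u) (mult_op e ?q u)"
        using g by (intro exI allI impI hdist_triangle mult_op_in_hspace p q u) auto
    qed
    moreover have "0 \<le> hdist e g (mult_op e ?q u)"
      using g by (intro hdist_nonneg mult_op_in_hspace q u) auto
    ultimately show "g = mult_op e ?q u"
      using g hdist_eq_0_iff[of g "mult_op e ?q u"] mult_op_in_hspace[OF q u] by auto
  qed
qed

text \<open>The multiplication semigroup is strongly continuous at \<open>0\<close>, so it cannot annihilate a
  nonzero vector for all small times.\<close>

lemma gauss_mult_eq_0_imp:
  assumes d: "summable d" "\<And>k. 0 \<le> d k" and r: "0 < r" and X: "X \<in> cauchy_seqs e"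
    and zero: "\<And>t. 0 < t \<Longrightarrow> t \<le> r \<Longrightarrow>
      mult_op e (\<lambda>x. exp (- (t / 2 * quad d x))) (cls e X) = cls e (\<lambda>n x. 0)"
  shows "cls e X = cls e (\<lambda>n x. 0)"
proof -
  have Xs: "X n \<in> simple_functions e" for n using X by (rule cauchy_seqs_simple)
  obtain K where K: "0 < K" "\<And>n. snorm e (X n) \<le> K" using cauchy_seqs_bounded[OF X] by metis
  have "(\<lambda>n. snorm e (X n)) \<longlonglongrightarrow> 0"
  proof (rule LIMSEQ_I)
    fix \<epsilon> :: real assume "0 < \<epsilon>"
    \<comment> \<open>Three errors of size \<open>s\<close> arise below: from the dominating
      \<open>Z n\<close>, from \<open>X m - X n\<close>, and from the factor
      \<open>1 - ?p\<close>.\<close>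
    define s where "s = \<epsilon> / 4"
    have s: "0 < s" "0 < s / K" using \<open>0 < \<epsilon>\<close> K(1) by (auto simp: s_def)
    obtain N where N: "\<And>m n. m \<ge> N \<Longrightarrow> n \<ge> N \<Longrightarrow> snorm e (\<lambda>x. X m x - X n x) < s"
      using X s(1) by (rule cauchy_seqsD) blast
    have "snorm e (X m) < \<epsilon>" if m: "m \<ge> N" for m
    proof -
      obtain M where M: "0 \<le> M" "\<And>x k. x \<in> X m -` (- {0}) \<Longrightarrow> \<bar>x \<bullet> e k\<bar> \<le> M"
        using coords_bounded[OF simple_support[OF Xs[of m]]] by blast
      \<comment> \<open>The order of choices matters: \<open>m\<close> fixes the support and its
        coordinate bound \<open>M\<close>, then \<open>t\<close> is small enough for
        \<open>1 - ?p\<close> to be at most \<open>s / K\<close> on that support, and only then is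
        \<open>n\<close> chosen, depending on \<open>t\<close>.\<close>
      define t where "t = min r (s / K / (M\<^sup>2 * suminf d + 1))"
      have pos: "0 < M\<^sup>2 * suminf d + 1"
        using suminf_nonneg[OF d] by (intro add_nonneg_pos mult_nonneg_nonneg) auto
      have t: "0 < t" "t \<le> r" using r divide_pos_pos[OF s(2) pos] unfolding t_def by auto
      have tM: "t * (M\<^sup>2 * suminf d) \<le> s / K"
      proof -
        have "t * (M\<^sup>2 * suminf d) \<le> t * (M\<^sup>2 * suminf d + 1)" using t(1) by simp
        also have "\<dots> \<le> s / K / (M\<^sup>2 * suminf d + 1) * (M\<^sup>2 * suminf d + 1)"
          using pos by (intro mult_right_mono) (auto simp: t_def)
        also have "\<dots> = s / K" using pos by (metis nonzero_divide_eq_eq order_less_irrefl)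
        finally show ?thesis .
      qed
      let ?p = "\<lambda>x. exp (- (t / 2 * quad d x))"
      have p: "multiplier ?p" using t(1) by (intro multiplier_gauss[OF d]) simp
      obtain Y where Y: "Y \<in> cauchy_seqs e" "upper_null e (\<lambda>n x. complex_of_real (?p x) * X n x - Y n x)"
        using multiplier_exists[OF p X] .
      have "cls e Y = cls e (\<lambda>n x. 0)" using zero[OF t] mult_op_cls[OF p X Y] by simp
      then have "upper_null e Y"
        using Y(1) by (simp add: cls_eq_zero_iff upper_null_simple_iff cauchy_seqs_simple)
      from upper_null_add[OF Y(2) this]
      have "upper_null e (\<lambda>n x. complex_of_real (?p x) * X n x)" by simp
      then obtain Z where Z: "\<And>n. Z n \<in> simple_functions e"
        "\<And>n x. cmod (complex_of_real (?p x) * X n x) \<le> cmod (Z n x)"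
        "(\<lambda>n. snorm e (Z n)) \<longlonglongrightarrow> 0"
        unfolding upper_null_def by blast
      have "\<forall>\<^sub>F n in sequentially. snorm e (Z n) < s"
        by (rule order_tendstoD(2)[OF Z(3) s(1)])
      then obtain N' where N': "\<And>n. n \<ge> N' \<Longrightarrow> snorm e (Z n) < s"
        unfolding eventually_sequentially by blast
      define n where "n = max N N'"
      have n: "n \<ge> N" "snorm e (Z n) < s" using N' by (auto simp: n_def)
      have "snorm e (X m) \<le> snorm e (Z n) + 1 * snorm e (\<lambda>x. X m x - X n x) + s / K * snorm e (X m)"
      proof (rule snorm_le_combination)
        fix x
        have 1: "\<bar>1 - ?p x\<bar> * cmod (X m x) \<le> s / K * cmod (X m x)"
        proof (cases "X m x = 0")
          case False
          then have "quad d x \<le> M\<^sup>2 * suminf d" by (intro quad_le[OF d] M(2)) simp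
          moreover have "\<bar>1 - ?p x\<bar> \<le> t / 2 * quad d x"
            using exp_neg_diff_le[of 0 "t / 2 * quad d x"] quad_nonneg[OF d, of x] t(1) by simp
          moreover have "t / 2 * quad d x \<le> t * (M\<^sup>2 * suminf d)"
          proof (rule mult_mono)
            show "quad d x \<le> M\<^sup>2 * suminf d" by fact
          qed (use t(1) quad_nonneg[OF d, of x] in auto)
          ultimately show ?thesis using tM by (intro mult_right_mono) auto
        qed simp
        \<comment> \<open>The first summand is controlled by the assumption that the multiplier
          annihilates the vector, the second by the Cauchy property, the third by the smallness of
          \<open>t\<close>.\<close>
        have "X m x = complex_of_real (?p x) * X n x + complex_of_real (?p x) * (X m x - X n x) +
            complex_of_real (1 - ?p x) * X m x"
          by (simp add: algebra_simps)
        also have "cmod \<dots> \<le> cmod (complex_of_real (?p x) * X n x) +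
            cmod (complex_of_real (?p x) * (X m x - X n x)) + cmod (complex_of_real (1 - ?p x) * X m x)"
          by (rule norm_triangle_le[OF add_mono[OF norm_triangle_ineq order_refl]])
        also have "\<dots> \<le> cmod (Z n x) + cmod (X m x - X n x) + s / K * cmod (X m x)"
        proof (intro add_mono Z(2) multiplier_bound[OF p])
          show "cmod (complex_of_real (1 - ?p x) * X m x) \<le> s / K * cmod (X m x)"
            unfolding norm_mult norm_of_real by (rule 1)
        qed
        finally show "cmod (X m x) \<le> cmod (Z n x) + 1 * cmod (X m x - X n x) + s / K * cmod (X m x)" by simp
      next
        show "0 \<le> s / K" using s(2) by simp
      qed (intro simple_diff Xs Z zero_le_one)+
      moreover have "s / K * snorm e (X m) \<le> s / K * K" using s(2) K(2) by (intro mult_left_mono) auto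
      moreover have "s / K * K = s" using K(1) by simp
      ultimately show ?thesis using n(2) N[OF m n(1)] \<open>0 < \<epsilon>\<close> by (simp add: s_def)
    qed
    then show "\<exists>N. \<forall>n\<ge>N. norm (snorm e (X n) - 0) < \<epsilon>"
      using snorm_nonneg[OF Xs] by (intro exI[of _ N]) auto
  qed
  then show ?thesis using cls_eq_zero_iff[OF X] by simp
qed

end

section \<open>Diagonal operators and Gaussian measures\<close>

context orthonormal_seq
begin

text \<open>The semigroups are indexed by operators, so the sequence of eigenvalues has to be
  realized by one; \<open>diag_sums\<close> justifies the description.\<close>

definition diag :: "(nat \<Rightarrow> real) \<Rightarrow> 'e \<Rightarrow> 'e" where
  "diag d x = (THE y. (\<lambda>k. (d k * (x \<bullet> e k)) *\<^sub>R e k) sums y)"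

lemma diag_sums:
  assumes "summable d" "\<And>k. 0 \<le> d k"
  shows "(\<lambda>k. (d k * (x \<bullet> e k)) *\<^sub>R e k) sums diag d x"
proof -
  have le: "d k \<le> suminf d" for k
    using sum_le_suminf[OF assms(1), of "{k}"] assms(2) by simp
  have "summable (\<lambda>k. (d k * (x \<bullet> e k))\<^sup>2)"
  proof (rule summable_comparison_test')
    show "summable (\<lambda>k. (suminf d)\<^sup>2 * (x \<bullet> e k)\<^sup>2)"
      by (rule summable_mult[OF summable_coord_sq])
    fix k
    have "(d k)\<^sup>2 \<le> (suminf d)\<^sup>2" using le[of k] assms(2)[of k] by (rule power_mono)
    then show "norm ((d k * (x \<bullet> e k))\<^sup>2) \<le> (suminf d)\<^sup>2 * (x \<bullet> e k)\<^sup>2"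
      by (simp add: power_mult_distrib mult_right_mono)
  qed
  then obtain y where "(\<lambda>n. \<Sum>k<n. (d k * (x \<bullet> e k)) *\<^sub>R e k) \<longlonglongrightarrow> y"
    by (rule Riesz_Fischer)
  then have y: "(\<lambda>k. (d k * (x \<bullet> e k)) *\<^sub>R e k) sums y" by (simp add: sums_def)
  then show ?thesis unfolding diag_def by (rule theI) (rule sums_unique2[OF _ y])
qed

lemma diag_inner_sums:
  assumes "summable d" "\<And>k. 0 \<le> d k"
  shows "(\<lambda>k. d k * (x \<bullet> e k) * (y \<bullet> e k)) sums (diag d x \<bullet> y)"
proof -
  have "(\<lambda>n. (\<Sum>k<n. (d k * (x \<bullet> e k)) *\<^sub>R e k) \<bullet> y) \<longlonglongrightarrow> diag d x \<bullet> y"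
    using diag_sums[OF assms, of x] by (intro tendsto_inner tendsto_const) (simp add: sums_def)
  moreover have "(\<Sum>k<n. (d k * (x \<bullet> e k)) *\<^sub>R e k) \<bullet> y = (\<Sum>k<n. d k * (x \<bullet> e k) * (y \<bullet> e k))" for n
    unfolding inner_sum_left by (simp add: inner_commute)
  ultimately show ?thesis by (simp add: sums_def)
qed

lemma diag_basis:
  assumes "summable d" "\<And>k. 0 \<le> d k"
  shows "diag d (e k) = d k *\<^sub>R e k"
proof -
  have "(\<lambda>j. (d j * (e k \<bullet> e j)) *\<^sub>R e j) sums (\<Sum>j\<in>{k}. (d j * (e k \<bullet> e j)) *\<^sub>R e j)"
    by (rule sums_finite) (auto simp: orth)
  then have "(\<lambda>j. (d j * (e k \<bullet> e j)) *\<^sub>R e j) sums (d k *\<^sub>R e k)" by (simp add: orth)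
  with diag_sums[OF assms, of "e k"] show ?thesis by (rule sums_unique2)
qed

lemma diag_quad:
  assumes "summable d" "\<And>k. 0 \<le> d k"
  shows "diag d x \<bullet> x = quad d x"
  using sums_unique[OF diag_inner_sums[OF assms, of x x]]
  by (simp add: quad_def power2_eq_square mult.assoc)

lemma bounded_linear_diag:
  assumes d: "summable d" "\<And>k. 0 \<le> d k"
  shows "bounded_linear (diag d)"
proof
  fix x y
  have "(\<lambda>k. (d k * ((x + y) \<bullet> e k)) *\<^sub>R e k) sums (diag d x + diag d y)"
    using sums_add[OF diag_sums[OF d, of x] diag_sums[OF d, of y]]
    by (simp add: inner_add_left distrib_left scaleR_left_distrib)
  with diag_sums[OF d, of "x + y"] show "diag d (x + y) = diag d x + diag d y" by (rule sums_unique2)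
next
  fix r x
  have "(\<lambda>k. (d k * ((r *\<^sub>R x) \<bullet> e k)) *\<^sub>R e k) sums (r *\<^sub>R diag d x)"
    using bounded_linear.sums[OF bounded_linear_scaleR_right diag_sums[OF d, of x], of r]
    by (simp add: mult.left_commute)
  with diag_sums[OF d, of "r *\<^sub>R x"] show "diag d (r *\<^sub>R x) = r *\<^sub>R diag d x" by (rule sums_unique2)
next
  have "norm (diag d x) \<le> norm x * suminf d" for x
  proof (rule LIMSEQ_le_const2)
    show "(\<lambda>n. norm (\<Sum>k<n. (d k * (x \<bullet> e k)) *\<^sub>R e k)) \<longlonglongrightarrow> norm (diag d x)"
      using diag_sums[OF d, of x] by (intro tendsto_norm) (simp add: sums_def)
    have "norm (\<Sum>k<n. (d k * (x \<bullet> e k)) *\<^sub>R e k) \<le> norm x * suminf d" for n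
    proof -
      have "norm (\<Sum>k<n. (d k * (x \<bullet> e k)) *\<^sub>R e k) \<le> (\<Sum>k<n. norm x * d k)"
      proof (rule sum_norm_le)
        fix k
        show "norm ((d k * (x \<bullet> e k)) *\<^sub>R e k) \<le> norm x * d k"
          using d(2)[of k] abs_coord_le[of x k] by (simp add: abs_mult mult.commute[of "norm x"] mult_left_mono)
      qed
      also have "\<dots> \<le> norm x * suminf d"
        unfolding sum_distrib_left[symmetric] using d by (intro mult_left_mono sum_le_suminf) auto
      finally show ?thesis .
    qed
    then show "\<exists>N. \<forall>n\<ge>N. norm (\<Sum>k<n. (d k * (x \<bullet> e k)) *\<^sub>R e k) \<le> norm x * suminf d" by blast
  qed
  then show "\<exists>K. \<forall>x. norm (diag d x) \<le> norm x * K" by blast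
qed

lemma nonneg_operator_diag:
  assumes d: "summable d" "\<And>k. 0 \<le> d k"
  shows "nonneg_operator (diag d)"
  unfolding nonneg_operator_def
proof (intro conjI allI)
  show "bounded_linear (diag d)" by (rule bounded_linear_diag[OF d])
  fix x y
  have "(\<lambda>k. d k * (x \<bullet> e k) * (y \<bullet> e k)) sums (diag d y \<bullet> x)"
    using diag_inner_sums[OF d, of y x] by (simp add: mult_ac)
  then show "diag d x \<bullet> y = x \<bullet> diag d y"
    using sums_unique2[OF diag_inner_sums[OF d, of x y]] by (simp add: inner_commute)
  show "0 \<le> diag d x \<bullet> x" by (simp add: diag_quad[OF d] quad_nonneg[OF d])
qed

lemma nuclear_diag:
  assumes d: "summable d" "\<And>k. 0 \<le> d k"
  shows "nuclear (diag d)"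
  unfolding nuclear_def
  using d diag_sums[OF d]
  by (intro exI[of _ "\<lambda>n. d n *\<^sub>R e n"] exI[of _ e]) simp

text \<open>The measure is the law of the random series with terms
  \<open>(sqrt (w k) * \<omega> k) *\<^sub>R e k\<close> for independent standard normal
  \<open>\<omega> k\<close>. The squared coefficients have total mean \<open>suminf w\<close>, so
  they are almost surely summable and the series converges by \<open>Riesz_Fischer\<close>.
  Existence is needed because \<open>gaussian\<close> is a choice.\<close>

lemma gaussian_exists:
  assumes w: "summable w" "\<And>k. 0 \<le> w k"
  shows "\<exists>M. prob_space M \<and> sets M = sets (borel :: 'e measure) \<and>
    (\<forall>\<xi>. (\<integral>h. iexp (\<xi> \<bullet> h) \<partial>M) = complex_of_real (exp (- quad w \<xi> / 2)))"
proof -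
  interpret std: prob_space std_normal_distribution
    using real_dist_normal_dist by (simp add: real_distribution_def)
  define N where "N = PiM (UNIV :: nat set) (\<lambda>_. std_normal_distribution)"
  interpret N: product_prob_space "\<lambda>_. std_normal_distribution" "UNIV :: nat set"
    by unfold_locales
  interpret N': prob_space N unfolding N_def by (rule N.P.prob_space_axioms)
  have comp [measurable]: "(\<lambda>\<omega>. \<omega> k) \<in> borel_measurable N" for k :: nat
    unfolding N_def by measurable
  have moment: "(\<integral>\<^sup>+\<omega>. ennreal (w k * (\<omega> k)\<^sup>2) \<partial>N) = ennreal (w k)" for k
  proof -
    have "distr N std_normal_distribution (\<lambda>\<omega>. \<omega> k) = std_normal_distribution"
      unfolding N_def by (rule N.PiM_component) simp
    moreover have "(\<integral>\<^sup>+x. ennreal (w k * x\<^sup>2) \<partial>distr N std_normal_distribution (\<lambda>\<omega>. \<omega> k)) =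
        (\<integral>\<^sup>+\<omega>. ennreal (w k * (\<omega> k)\<^sup>2) \<partial>N)"
      by (rule nn_integral_distr) (auto simp: comp)
    ultimately have "(\<integral>\<^sup>+\<omega>. ennreal (w k * (\<omega> k)\<^sup>2) \<partial>N) =
        (\<integral>\<^sup>+x. ennreal (w k * x\<^sup>2) \<partial>std_normal_distribution)"
      by simp
    also have "\<dots> = ennreal (\<integral>x. w k * x\<^sup>2 \<partial>std_normal_distribution)"
      using std_normal_distribution_even_moments(2)[of 1] w(2)[of k]
      by (intro nn_integral_eq_integral) auto
    also have "(\<integral>x. w k * x\<^sup>2 \<partial>std_normal_distribution) = w k"
      using std_normal_distribution_even_moments(1)[of 1] by (simp add: fact_numeral)
    finally show ?thesis .
  qed
  \<comment> \<open>Off this event the partial sums are set to 0, so the limit exists for every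
    \<open>\<omega>\<close> and its measurability needs no exceptional set.\<close>
  define good where "good \<omega> \<longleftrightarrow> (\<Sum>k. ennreal (w k * (\<omega> k)\<^sup>2)) < top" for \<omega> :: "nat \<Rightarrow> real"
  have good_meas [measurable]: "Measurable.pred N good"
    unfolding good_def by measurable
  have "(\<integral>\<^sup>+\<omega>. (\<Sum>k. ennreal (w k * (\<omega> k)\<^sup>2)) \<partial>N) = (\<Sum>k. ennreal (w k))"
    by (subst nn_integral_suminf) (auto simp: moment)
  also have "\<dots> = ennreal (suminf w)" using w by (intro suminf_ennreal2) auto
  finally have "(\<integral>\<^sup>+\<omega>. (\<Sum>k. ennreal (w k * (\<omega> k)\<^sup>2)) \<partial>N) \<noteq> \<infinity>" by simp
  from nn_integral_PInf_AE[OF _ this]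
  have AE_good: "AE \<omega> in N. good \<omega>"
    by (auto simp: good_def less_top)
  define s where "s n \<omega> = (if good \<omega> then \<Sum>k<n. (sqrt (w k) * \<omega> k) *\<^sub>R e k else 0)" for n \<omega>
  have s_meas [measurable]: "s n \<in> borel_measurable N" for n
    unfolding s_def by measurable
  have "\<exists>x. (\<lambda>n. s n \<omega>) \<longlonglongrightarrow> x" for \<omega>
  proof (cases "good \<omega>")
    case True
    then have "summable (\<lambda>k. w k * (\<omega> k)\<^sup>2)"
      using w by (intro summable_suminf_not_top) (auto simp: good_def)
    then have "summable (\<lambda>k. (sqrt (w k) * \<omega> k)\<^sup>2)"
      using w by (simp add: power_mult_distrib)
    then obtain x where "(\<lambda>n. \<Sum>k<n. (sqrt (w k) * \<omega> k) *\<^sub>R e k) \<longlonglongrightarrow> x" by (rule Riesz_Fischer)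
    with True show ?thesis by (auto simp: s_def)
  qed (auto simp: s_def)
  then obtain X where X: "\<And>\<omega>. (\<lambda>n. s n \<omega>) \<longlonglongrightarrow> X \<omega>" by metis
  have X_meas [measurable]: "X \<in> borel_measurable N"
    by (rule borel_measurable_LIMSEQ_metric[OF s_meas X])
  \<comment> \<open>Only finitely many coordinates occur, so the integral passes to a finite product
    and factors into characteristic functions of the standard normal law.\<close>
  have fin: "(\<integral>\<omega>. iexp (\<xi> \<bullet> s n \<omega>) \<partial>N) = complex_of_real (exp (- (\<Sum>k<n. w k * (\<xi> \<bullet> e k)\<^sup>2) / 2))" for \<xi> n
  proof -
    let ?f = "\<lambda>k x. iexp ((sqrt (w k) * (\<xi> \<bullet> e k)) * x)"
    have "(\<integral>\<omega>. iexp (\<xi> \<bullet> s n \<omega>) \<partial>N) = (\<integral>\<omega>. (\<Prod>k\<in>{..<n}. ?f k (\<omega> k)) \<partial>N)"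
    proof (rule integral_cong_AE)
      show "AE \<omega> in N. iexp (\<xi> \<bullet> s n \<omega>) = (\<Prod>k\<in>{..<n}. ?f k (\<omega> k))"
        using AE_good
      proof eventually_elim
        case (elim \<omega>)
        then show ?case
          by (simp add: s_def inner_sum_right sum_distrib_left exp_sum[symmetric] mult_ac)
      qed
    qed measurable
    also have "\<dots> = (\<integral>\<omega>. (\<Prod>k\<in>{..<n}. ?f k (restrict \<omega> {..<n} k)) \<partial>N)"
      by (intro Bochner_Integration.integral_cong prod.cong) auto
    also have "\<dots> = (\<integral>\<omega>. (\<Prod>k\<in>{..<n}. ?f k (\<omega> k)) \<partial>distr N (PiM {..<n} (\<lambda>_. std_normal_distribution)) (\<lambda>x. restrict x {..<n}))"
    proof (rule integral_distr[symmetric])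
      show "(\<lambda>x. restrict x {..<n}) \<in> measurable N (PiM {..<n} (\<lambda>_. std_normal_distribution))"
        unfolding N_def by (intro measurable_restrict_subset) auto
      show "(\<lambda>\<omega>. \<Prod>k\<in>{..<n}. ?f k (\<omega> k)) \<in> borel_measurable (PiM {..<n} (\<lambda>_. std_normal_distribution))"
      proof (rule borel_measurable_prod)
        fix k assume "k \<in> {..<n}"
        then have "(\<lambda>\<omega>. \<omega> k) \<in> measurable (PiM {..<n} (\<lambda>_. std_normal_distribution)) std_normal_distribution"
          by (rule measurable_component_singleton)
        then have [measurable]: "(\<lambda>\<omega>. \<omega> k) \<in> borel_measurable (PiM {..<n} (\<lambda>_. std_normal_distribution))"
          by simp
        show "(\<lambda>\<omega>. ?f k (\<omega> k)) \<in> borel_measurable (PiM {..<n} (\<lambda>_. std_normal_distribution))"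
          by measurable
      qed
    qed
    also have "distr N (PiM {..<n} (\<lambda>_. std_normal_distribution)) (\<lambda>x. restrict x {..<n}) =
        PiM {..<n} (\<lambda>_. std_normal_distribution)"
      unfolding N_def by (rule N.distr_PiM_restrict_finite) auto
    also have "(\<integral>\<omega>. (\<Prod>k\<in>{..<n}. ?f k (\<omega> k)) \<partial>PiM {..<n} (\<lambda>_. std_normal_distribution)) =
        (\<Prod>k\<in>{..<n}. \<integral>x. ?f k x \<partial>std_normal_distribution)"
      by (rule N.product_integral_prod) (auto intro!: std.integrable_const_bound[where B = 1])
    also have "\<dots> = (\<Prod>k\<in>{..<n}. complex_of_real (exp (- (w k * (\<xi> \<bullet> e k)\<^sup>2) / 2)))"
    proof (intro prod.cong refl)
      fix k
      have "(\<integral>x. ?f k x \<partial>std_normal_distribution) = char std_normal_distribution (sqrt (w k) * (\<xi> \<bullet> e k))"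
        by (simp add: char_def)
      then show "(\<integral>x. ?f k x \<partial>std_normal_distribution) = complex_of_real (exp (- (w k * (\<xi> \<bullet> e k)\<^sup>2) / 2))"
        using w(2)[of k] by (simp add: char_std_normal_distribution power_mult_distrib)
    qed
    also have "\<dots> = complex_of_real (exp (- (\<Sum>k<n. w k * (\<xi> \<bullet> e k)\<^sup>2) / 2))"
      by (simp add: exp_sum[symmetric] sum_negf sum_divide_distrib flip: of_real_prod)
    finally show ?thesis .
  qed
  have char: "(\<integral>\<omega>. iexp (\<xi> \<bullet> X \<omega>) \<partial>N) = complex_of_real (exp (- quad w \<xi> / 2))" for \<xi>
  proof (rule LIMSEQ_unique)
    show "(\<lambda>n. \<integral>\<omega>. iexp (\<xi> \<bullet> s n \<omega>) \<partial>N) \<longlonglongrightarrow> (\<integral>\<omega>. iexp (\<xi> \<bullet> X \<omega>) \<partial>N)"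
    proof (rule integral_dominated_convergence[where w = "\<lambda>_. 1"])
      show "AE \<omega> in N. (\<lambda>n. iexp (\<xi> \<bullet> s n \<omega>)) \<longlonglongrightarrow> iexp (\<xi> \<bullet> X \<omega>)"
        by (intro always_eventually allI tendsto_intros X)
    qed auto
    have "(\<lambda>n. \<Sum>k<n. w k * (\<xi> \<bullet> e k)\<^sup>2) \<longlonglongrightarrow> quad w \<xi>"
      unfolding quad_def using summable_LIMSEQ[OF summable_quad[OF w]] .
    then show "(\<lambda>n. \<integral>\<omega>. iexp (\<xi> \<bullet> s n \<omega>) \<partial>N) \<longlonglongrightarrow> complex_of_real (exp (- quad w \<xi> / 2))"
      unfolding fin by (intro tendsto_intros) auto
  qed
  show ?thesis
  proof (intro exI[of _ "distr N borel X"] conjI allI)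
    show "prob_space (distr N borel X)" by (rule N'.prob_space_distr[OF X_meas])
    show "(\<integral>h. iexp (\<xi> \<bullet> h) \<partial>distr N borel X) = complex_of_real (exp (- quad w \<xi> / 2))" for \<xi>
      by (subst integral_distr) (auto simp: char)
  qed simp
qed

lemma gaussian_diag:
  assumes d: "summable d" "\<And>k. 0 \<le> d k" and t: "0 \<le> t"
  defines "M \<equiv> gaussian (\<lambda>x. t *\<^sub>R diag d x)"
  shows "prob_space M" "sets M = sets borel"
    "(\<integral>h. iexp (\<xi> \<bullet> h) \<partial>M) = complex_of_real (exp (- quad (\<lambda>k. t * d k) \<xi> / 2))"
proof -
  have eq: "(t *\<^sub>R diag d \<xi>) \<bullet> \<xi> = quad (\<lambda>k. t * d k) \<xi>" for \<xi>
    using suminf_mult[OF summable_quad[OF d, of \<xi>], of t]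
    by (simp add: diag_quad[OF d]) (simp add: quad_def mult.assoc)
  have "\<exists>M. prob_space M \<and> sets M = sets (borel :: 'e measure) \<and>
      (\<forall>\<xi>. (\<integral>h. iexp (\<xi> \<bullet> h) \<partial>M) = complex_of_real (exp (- ((t *\<^sub>R diag d \<xi>) \<bullet> \<xi>) / 2)))"
    unfolding eq using d t by (intro gaussian_exists) auto
  from someI_ex[OF this]
  show "prob_space M" "sets M = sets borel"
    "(\<integral>h. iexp (\<xi> \<bullet> h) \<partial>M) = complex_of_real (exp (- quad (\<lambda>k. t * d k) \<xi> / 2))"
    unfolding M_def gaussian_def eq by blast+
qed

end

section \<open>Gaussian averages of shifted cubes\<close>

lemma iexp_add: "iexp (x + y) = iexp x * iexp y"
  by (simp add: exp_add distrib_left)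

lemma one_minus_cos_le: "1 - cos y \<le> \<bar>y\<bar>" for y :: real
proof -
  have "cos y = 1 - 2 * (sin (y / 2))\<^sup>2"
    using cos_double_sin[of "y / 2"] by simp
  then have "1 - cos y = 2 * \<bar>sin (y / 2)\<bar> * \<bar>sin (y / 2)\<bar>" by (simp add: power2_eq_square)
  also have "\<dots> \<le> 2 * \<bar>y / 2\<bar> * 1"
    using abs_sin_x_le_abs_x[of "y / 2"] by (intro mult_mono) auto
  finally show ?thesis by simp
qed

text \<open>The trigonometric majorant of a tent function. Its Gaussian mean at frequency \<open>s\<close> of the order
  of the inverse standard deviation falls below \<open>1\<close> by a multiple of the standard deviation itself,
  whereas \<open>cos\<close> alone would only give the variance.\<close>

lemma tent_le_trig:
  fixes L s y :: real
  assumes "1 \<le> L" "2 \<le> s"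
  shows "max 0 (L - \<bar>y\<bar>) \<le> L * (1 - 1 / (s * L) * (1 - cos (s * y)))"
proof -
  have s: "0 < s" "0 < L" using assms by auto
  have eq: "L * (1 - 1 / (s * L) * (1 - cos (s * y))) = L - (1 - cos (s * y)) / s"
    using s by (simp add: field_simps)
  have "(1 - cos (s * y)) / s \<le> \<bar>s * y\<bar> / s"
    using s one_minus_cos_le by (intro divide_right_mono) auto
  then have 1: "(1 - cos (s * y)) / s \<le> \<bar>y\<bar>" using s by (simp add: abs_mult)
  \<comment> \<open>This bound, where \<open>2 \<le> s\<close> enters, keeps the majorant
    nonnegative and so handles the 0 in the maximum; the previous bound handles the sloping
    part.\<close>
  have "(1 - cos (s * y)) / s \<le> 2 / 2"
    using assms(2) cos_ge_minus_one[of "s * y"] by (intro frac_le) auto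
  with 1 show ?thesis unfolding eq using assms(1) by simp
qed

context orthonormal_seq
begin

text \<open>The quadratic form is additive in orthogonal coordinate directions; this is the trace of
  independence visible in the Fourier transform.\<close>

lemma quad_add_basis:
  assumes w: "summable w" "\<And>k. 0 \<le> w k" and "\<xi> \<bullet> e n = 0"
  shows "quad w (\<xi> + s *\<^sub>R e n) = quad w \<xi> + w n * s\<^sup>2"
proof -
  have c: "(\<xi> + s *\<^sub>R e n) \<bullet> e k = (if k = n then s else \<xi> \<bullet> e k)" for k
    using assms(3) by (auto simp: inner_add_left orth)
  have "quad w (\<xi> + s *\<^sub>R e n) - quad w \<xi> =
      (\<Sum>k. w k * ((\<xi> + s *\<^sub>R e n) \<bullet> e k)\<^sup>2 - w k * (\<xi> \<bullet> e k)\<^sup>2)"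
    unfolding quad_def by (rule suminf_diff[OF summable_quad[OF w] summable_quad[OF w]])
  also have "\<dots> = (\<Sum>k\<in>{n}. w k * ((\<xi> + s *\<^sub>R e n) \<bullet> e k)\<^sup>2 - w k * (\<xi> \<bullet> e k)\<^sup>2)"
    by (rule suminf_finite) (auto simp: c)
  also have "\<dots> = w n * s\<^sup>2" using assms(3) by (simp add: c)
  finally show ?thesis by simp
qed

text \<open>The mean factors as if the coordinates were independent, by expanding cosines into
  exponentials and evaluating each with the Fourier transform.\<close>

lemma integral_trig_product:
  fixes M :: "'e measure" and w s c \<delta> :: "nat \<Rightarrow> real"
  assumes w: "summable w" "\<And>k. 0 \<le> w k"
    and M: "prob_space M" "sets M = sets borel"
    and char: "\<And>\<xi>. (\<integral>h. iexp (\<xi> \<bullet> h) \<partial>M) = complex_of_real (exp (- quad w \<xi> / 2))"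
  defines "G \<equiv> \<lambda>k h. 1 - \<delta> k * (1 - cos (s k * (h \<bullet> e k - c k)))"
  shows "(\<integral>h. (\<Prod>k<n. G k h) \<partial>M) =
    (\<Prod>k<n. 1 - \<delta> k * (1 - exp (- (w k * (s k)\<^sup>2) / 2) * cos (s k * c k)))"
proof -
  interpret prob_space M by (rule M(1))
  have M_borel [measurable_cong]: "sets M = sets borel" by (rule M(2))
  have G_meas [measurable]: "G k \<in> borel_measurable M" for k
    unfolding G_def by measurable
  have G_bound: "\<bar>G k h\<bar> \<le> 1 + 2 * \<bar>\<delta> k\<bar>" for k h
  proof -
    have "\<bar>1 - cos (s k * (h \<bullet> e k - c k))\<bar> \<le> 2"
      using cos_le_one cos_ge_minus_one by (smt (verit))
    then have "\<bar>\<delta> k * (1 - cos (s k * (h \<bullet> e k - c k)))\<bar> \<le> \<bar>\<delta> k\<bar> * 2"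
      unfolding abs_mult by (rule mult_left_mono) simp
    then show ?thesis unfolding G_def by linarith
  qed
  have prod_bound: "\<bar>\<Prod>k<n. G k h\<bar> \<le> (\<Prod>k<n. 1 + 2 * \<bar>\<delta> k\<bar>)" for n h
    unfolding abs_prod by (intro prod_mono) (auto intro: G_bound)
  \<comment> \<open>The induction needs the extra frequency \<open>\<xi>\<close>: splitting off the
    last cosine moves it to \<open>\<xi>\<close> plus or minus \<open>s n *\<^sub>R e n\<close>,
    which remains orthogonal to all \<open>e k\<close> with \<open>k < n\<close>.\<close>
  define I where "I n \<xi> h = iexp (\<xi> \<bullet> h) * complex_of_real (\<Prod>k<n. G k h)" for n \<xi> h
  have int: "integrable M (I n \<xi>)" for n \<xi>
  proof (rule integrable_const_bound[where B = "\<Prod>k<n. 1 + 2 * \<bar>\<delta> k\<bar>"])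
    show "AE h in M. norm (I n \<xi> h) \<le> (\<Prod>k<n. 1 + 2 * \<bar>\<delta> k\<bar>)"
      using prod_bound by (auto simp: I_def norm_mult simp del: of_real_prod)
    show "I n \<xi> \<in> borel_measurable M" unfolding I_def by measurable
  qed
  define E where "E k = 1 - \<delta> k * (1 - exp (- (w k * (s k)\<^sup>2) / 2) * cos (s k * c k))" for k
  have main: "(\<integral>h. I n \<xi> h \<partial>M) = complex_of_real (exp (- quad w \<xi> / 2) * (\<Prod>k<n. E k))"
    if "\<And>k. k < n \<Longrightarrow> \<xi> \<bullet> e k = 0" for n \<xi>
    using that
  proof (induction n arbitrary: \<xi>)
    case 0
    then show ?case by (simp add: I_def char)
  next
    case (Suc n)
    let ?\<xi>p = "\<xi> + s n *\<^sub>R e n" and ?\<xi>m = "\<xi> + (- s n) *\<^sub>R e n"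
    have G_eq: "complex_of_real (G n h) = complex_of_real (1 - \<delta> n) +
        complex_of_real (\<delta> n / 2) * (iexp (- (s n * c n)) * iexp (s n * (e n \<bullet> h)) +
          iexp (s n * c n) * iexp (- (s n * (e n \<bullet> h))))" for h
    proof -
      let ?y = "s n * (h \<bullet> e n - c n)"
      have "complex_of_real (cos ?y) = (iexp ?y + iexp (- ?y)) / 2"
        using cos_exp_eq[of "complex_of_real ?y"] by (simp add: cos_of_real del: of_real_mult of_real_diff)
      moreover have "iexp ?y = iexp (- (s n * c n)) * iexp (s n * (e n \<bullet> h))"
        by (simp add: exp_add[symmetric] algebra_simps inner_commute)
      moreover have "iexp (- ?y) = iexp (s n * c n) * iexp (- (s n * (e n \<bullet> h)))"
        by (simp add: exp_add[symmetric] algebra_simps inner_commute)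
      moreover have "complex_of_real (G n h) = complex_of_real (1 - \<delta> n) +
          complex_of_real (\<delta> n) * complex_of_real (cos ?y)"
        unfolding G_def by (simp add: algebra_simps)
      ultimately show ?thesis by simp
    qed
    have I_eq: "I (Suc n) \<xi> h = complex_of_real (1 - \<delta> n) * I n \<xi> h +
        complex_of_real (\<delta> n / 2) * (iexp (- (s n * c n)) * I n ?\<xi>p h + iexp (s n * c n) * I n ?\<xi>m h)" for h
    proof -
      have p: "iexp (?\<xi>p \<bullet> h) = iexp (\<xi> \<bullet> h) * iexp (s n * (e n \<bullet> h))"
        and m: "iexp (?\<xi>m \<bullet> h) = iexp (\<xi> \<bullet> h) * iexp (- (s n * (e n \<bullet> h)))"
        by (simp_all only: inner_add_left inner_scaleR_left mult_minus_left iexp_add)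
      have "I (Suc n) \<xi> h = iexp (\<xi> \<bullet> h) * complex_of_real (\<Prod>k<n. G k h) * complex_of_real (G n h)"
        by (simp add: I_def mult.assoc)
      then show ?thesis
        unfolding G_eq I_def p m by (simp only: distrib_left distrib_right mult_ac)
    qed
    have orth': "?\<xi>p \<bullet> e k = 0" "?\<xi>m \<bullet> e k = 0" "\<xi> \<bullet> e k = 0" if "k < n" for k
      using Suc.prems[of k] that by (simp_all add: inner_add_left inner_diff_left orth)
    have z: "\<xi> \<bullet> e n = 0" using Suc.prems[of n] by simp
    let ?P = "complex_of_real (\<Prod>k<n. E k)"
    let ?c = "complex_of_real (exp (- quad w \<xi> / 2))"
    let ?g = "complex_of_real (exp (- (w n * (s n)\<^sup>2) / 2))"
    have q: "exp (- quad w ?\<xi>p / 2) = exp (- quad w \<xi> / 2) * exp (- (w n * (s n)\<^sup>2) / 2)"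
      "exp (- quad w ?\<xi>m / 2) = exp (- quad w \<xi> / 2) * exp (- (w n * (s n)\<^sup>2) / 2)"
      using quad_add_basis[OF w z, of "s n"] quad_add_basis[OF w z, of "- s n"]
      by (simp_all add: exp_add[symmetric] field_simps)
    have "(\<integral>h. I (Suc n) \<xi> h \<partial>M) = complex_of_real (1 - \<delta> n) * (\<integral>h. I n \<xi> h \<partial>M) +
        complex_of_real (\<delta> n / 2) * (iexp (- (s n * c n)) * (\<integral>h. I n ?\<xi>p h \<partial>M) +
          iexp (s n * c n) * (\<integral>h. I n ?\<xi>m h \<partial>M))"
      unfolding I_eq by (simp add: int)
    also have "\<dots> = complex_of_real (1 - \<delta> n) * (?c * ?P) +
        complex_of_real (\<delta> n / 2) * (iexp (- (s n * c n)) * (?c * ?g * ?P) + iexp (s n * c n) * (?c * ?g * ?P))"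
      using Suc.IH[of \<xi>] Suc.IH[of ?\<xi>p] Suc.IH[of ?\<xi>m] orth' q by simp
    also have "\<dots> = ?c * ?P * (complex_of_real (1 - \<delta> n) +
        complex_of_real (\<delta> n) * ?g * ((iexp (s n * c n) + iexp (- (s n * c n))) / 2))"
      by (simp add: field_simps)
    also have "(iexp (s n * c n) + iexp (- (s n * c n))) / 2 = complex_of_real (cos (s n * c n))"
      using cos_exp_eq[of "complex_of_real (s n * c n)"] by (simp add: cos_of_real del: of_real_mult)
    also have "?c * ?P * (complex_of_real (1 - \<delta> n) + complex_of_real (\<delta> n) * ?g * complex_of_real (cos (s n * c n))) =
        complex_of_real (exp (- quad w \<xi> / 2) * (\<Prod>k<Suc n. E k))"
      by (simp add: E_def algebra_simps)
    finally show ?case .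
  qed
  have "complex_of_real (\<integral>h. (\<Prod>k<n. G k h) \<partial>M) = (\<integral>h. I n 0 h \<partial>M)"
    by (simp add: I_def del: of_real_prod)
  also have "\<dots> = complex_of_real (\<Prod>k<n. E k)"
    using main[of n 0] by (simp add: quad_def)
  finally show ?thesis by (simp add: E_def del: of_real_prod)
qed

section \<open>Overlaps of a shifted cube with blocks\<close>

definition cube0 :: "'e set" where
  "cube0 = block e (\<lambda>_. - 1 / 2) (\<lambda>_. 1 / 2)"

definition cube_at :: "'e \<Rightarrow> 'e set" where
  "cube_at h = (\<lambda>x. x + h) ` cube0"

lemma proper_cube0: "proper (\<lambda>_. - 1 / 2) (\<lambda>_. 1 / 2)"
proof -
  have "0 \<in> block e (\<lambda>_. - 1 / 2) (\<lambda>_. 1 / 2)" by (simp add: block_def)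
  then show ?thesis by (auto simp: proper_def block_bounds_def)
qed

lemma cube_at_eq: "cube_at h = block e (\<lambda>j. - 1 / 2 + h \<bullet> e j) (\<lambda>j. 1 / 2 + h \<bullet> e j)"
  by (simp add: cube_at_def cube0_def block_shift)

lemma proper_cube_at: "proper (\<lambda>j. - 1 / 2 + h \<bullet> e j) (\<lambda>j. 1 / 2 + h \<bullet> e j)"
  by (rule proper_shift[OF proper_cube0])

lemma cube_at_ring: "cube_at h \<in> block_ring e"
  unfolding cube_at_eq by (rule proper_block_ring[OF proper_cube_at])

lemma ring_completed: "A \<in> block_ring e \<Longrightarrow> A \<in> completed_ring e"
  using bm.subset_jordan by (auto simp: completed_ring_eq)

definition overlap :: "(nat \<Rightarrow> real) \<Rightarrow> (nat \<Rightarrow> real) \<Rightarrow> nat \<Rightarrow> 'e \<Rightarrow> real" where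
  "overlap a b k h = max 0 (min (1 / 2 + h \<bullet> e k) (b k) - max (- 1 / 2 + h \<bullet> e k) (a k))"

lemma overlap_range: "0 \<le> overlap a b k h" "overlap a b k h \<le> 1"
  by (auto simp: overlap_def)

text \<open>For an empty intersection one must exclude that every pair of sides overlaps while only
  square summability fails. Otherwise the lower ends of the overlaps form a sequence in both boxes,
  and \<open>common_point\<close> yields a vector in both blocks.\<close>

lemma prod_overlap_tendsto:
  assumes P: "proper a b"
  shows "(\<lambda>n. \<Prod>k<n. overlap a b k h) \<longlonglongrightarrow> lam e (cube_at h \<inter> block e a b)"
proof (cases "cube_at h \<inter> block e a b = {}")
  case True
  have "\<exists>k. overlap a b k h = 0"
  proof (rule ccontr)
    assume no: "\<nexists>k. overlap a b k h = 0"
    let ?z = "\<lambda>k. max (- 1 / 2 + h \<bullet> e k) (a k)"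
    have "?z k < min (1 / 2 + h \<bullet> e k) (b k)" for k
    proof -
      have "overlap a b k h \<noteq> 0" using no by blast
      then show ?thesis unfolding overlap_def by linarith
    qed
    then have "?z \<in> seq_box (\<lambda>j. - 1 / 2 + h \<bullet> e j) (\<lambda>j. 1 / 2 + h \<bullet> e j)" "?z \<in> seq_box a b"
      by (auto simp: seq_box_def)
    then obtain x where "\<forall>(a, b)\<in>{(\<lambda>j. - 1 / 2 + h \<bullet> e j, \<lambda>j. 1 / 2 + h \<bullet> e j), (a, b)}. x \<in> block e a b"
      using common_point[of "{(\<lambda>j. - 1 / 2 + h \<bullet> e j, \<lambda>j. 1 / 2 + h \<bullet> e j), (a, b)}" ?z]
        P proper_cube_at[of h] unfolding proper_def by auto
    then have "x \<in> cube_at h \<inter> block e a b" by (simp add: cube_at_eq)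
    with True show False by simp
  qed
  then obtain k where k: "overlap a b k h = 0" by blast
  have "\<forall>\<^sub>F n in sequentially. (\<Prod>k<n. overlap a b k h) = 0"
    using eventually_gt_at_top[of k] by eventually_elim (use k in auto)
  then show ?thesis using True by (simp add: tendsto_eventually)
next
  case False
  let ?a = "\<lambda>j. max (- 1 / 2 + h \<bullet> e j) (a j)" and ?b = "\<lambda>j. min (1 / 2 + h \<bullet> e j) (b j)"
  have pr: "proper ?a ?b"
    using False unfolding cube_at_eq by (rule proper_Int[OF proper_cube_at P])
  have "cube_at h \<inter> block e a b = block e ?a ?b" by (simp add: cube_at_eq block_Int)
  then have "lam e (cube_at h \<inter> block e a b) = vol ?a ?b"
    by (simp only: lam_eq bm.outer_eq[OF proper_block_ring[OF pr]] block_measure_block[OF pr])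
  moreover have "overlap a b k h = ?b k - ?a k" for k
    using proper_less[OF pr, of k] unfolding overlap_def by linarith
  ultimately show ?thesis using proper_vol[OF pr] by simp
qed

text \<open>As a function of the shift, the overlap lies below a tent centred at the midpoint of the
  side. Height \<open>L\<close>, the larger of the two side lengths, suffices with slopes 1 and -1,
  and the tent has a trigonometric majorant.\<close>

lemma overlap_le_trig:
  assumes "a k < b k" "2 \<le> s"
  defines "L \<equiv> max 1 (b k - a k)"
  shows "overlap a b k h \<le> L * (1 - 1 / (s * L) * (1 - cos (s * (h \<bullet> e k - (a k + b k) / 2))))"
proof -
  have "overlap a b k h \<le> max 0 (L - \<bar>h \<bullet> e k - (a k + b k) / 2\<bar>)"
  proof -
    let ?x = "min (1 / 2 + h \<bullet> e k) (b k) - max (- 1 / 2 + h \<bullet> e k) (a k)"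
    have *: "x \<le> L - \<bar>y - (p + q) / 2\<bar>"
      if "x \<le> (1 / 2 + y) - p" "x \<le> q - (- 1 / 2 + y)" "1 \<le> L" "q - p \<le> L" for x y p q L :: real
    proof -
      have "\<bar>y - (p + q) / 2\<bar> \<le> L - x"
        using that by (intro abs_leI) (simp_all add: field_simps)
      then show ?thesis by linarith
    qed
    have "?x \<le> L - \<bar>h \<bullet> e k - (a k + b k) / 2\<bar>"
      by (intro * diff_mono min.cobounded1 min.cobounded2 max.cobounded1 max.cobounded2) (simp_all add: L_def)
    then show ?thesis unfolding overlap_def by (rule max.mono[OF order_refl])
  qed
  also have "\<dots> \<le> L * (1 - 1 / (s * L) * (1 - cos (s * (h \<bullet> e k - (a k + b k) / 2))))"
    by (rule tent_le_trig) (use assms in \<open>auto simp: L_def\<close>)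
  finally show ?thesis .
qed

text \<open>From \<open>1 - x \<le> exp (- x)\<close> and the divergence of the harmonic
  series.\<close>

lemma prod_one_minus_harmonic_tendsto_0:
  assumes "0 < (\<beta>::real)" "\<And>k. 0 \<le> g k" "\<And>k. g k \<le> 1 - \<beta> / real (Suc k)"
  shows "(\<lambda>n. \<Prod>k<n. g k) \<longlonglongrightarrow> 0"
proof (rule tendsto_sandwich[OF always_eventually always_eventually tendsto_const])
  show "\<forall>n. 0 \<le> (\<Prod>k<n. g k)" using assms(2) by (auto intro: prod_nonneg)
  show "\<forall>n. (\<Prod>k<n. g k) \<le> exp (- (\<beta> * harm n))"
  proof
    fix n
    have "(\<Prod>k<n. g k) \<le> (\<Prod>k<n. exp (- (\<beta> * inverse (real (Suc k)))))"
    proof (intro prod_mono conjI assms(2))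
      fix k
      have "g k \<le> 1 + - (\<beta> * inverse (real (Suc k)))" using assms(3)[of k] by (simp add: divide_inverse)
      also have "\<dots> \<le> exp (- (\<beta> * inverse (real (Suc k))))" by (rule exp_ge_add_one_self)
      finally show "g k \<le> exp (- (\<beta> * inverse (real (Suc k))))" .
    qed
    also have "\<dots> = exp (- (\<beta> * harm n))"
      by (simp add: harm_altdef sum_distrib_left sum_negf flip: exp_sum)
    finally show "(\<Prod>k<n. g k) \<le> exp (- (\<beta> * harm n))" .
  qed
  have "filterlim (\<lambda>n. \<beta> * harm n :: real) at_top sequentially"
    by (rule filterlim_tendsto_pos_mult_at_top[OF tendsto_const assms(1) harm_at_top])
  then have "filterlim (\<lambda>n. - (\<beta> * harm n)) at_bot sequentially"
    by (simp add: filterlim_uminus_at_bot)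
  then show "(\<lambda>n. exp (- (\<beta> * harm n))) \<longlonglongrightarrow> 0"
    by (rule filterlim_compose[OF exp_at_bot])
qed

text \<open>The square roots of the weights are not summable, which makes the product of the trigonometric
  means diverge to \<open>0\<close>.\<close>

lemma AE_lam_cube_block:
  fixes M :: "'e measure"
  assumes t: "0 < t" "t \<le> 1 / 4"
  defines "w \<equiv> \<lambda>k. t * (1 / (real (Suc k))\<^sup>2)"
  assumes w: "summable w" and M: "prob_space M" "sets M = sets borel"
    and char: "\<And>\<xi>. (\<integral>h. iexp (\<xi> \<bullet> h) \<partial>M) = complex_of_real (exp (- quad w \<xi> / 2))"
    and P: "proper a b"
  shows "(\<lambda>h. lam e (cube_at h \<inter> block e a b)) \<in> borel_measurable M"
    and "AE h in M. lam e (cube_at h \<inter> block e a b) = 0"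
proof -
  interpret prob_space M by (rule M(1))
  have M_borel [measurable_cong]: "sets M = sets borel" by (rule M(2))
  have w0: "0 \<le> w k" for k using t by (simp add: w_def)
  let ?R = "\<lambda>h. lam e (cube_at h \<inter> block e a b)"
  have ov_meas [measurable]: "overlap a b k \<in> borel_measurable M" for k
    unfolding overlap_def by measurable
  show R_meas [measurable]: "?R \<in> borel_measurable M"
    by (rule borel_measurable_LIMSEQ_metric[OF _ prod_overlap_tendsto[OF P]]) measurable
  have R0: "0 \<le> ?R h" for h
    by (rule LIMSEQ_le_const[OF prod_overlap_tendsto[OF P]]) (auto intro!: prod_nonneg overlap_range)
  \<comment> \<open>Each overlap is at most the unit side of the cube, so the partial products
    decrease to the measure.\<close>
  have R_le: "?R h \<le> (\<Prod>k<n. overlap a b k h)" for h n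
  proof (rule decseq_ge[OF _ prod_overlap_tendsto[OF P]])
    show "decseq (\<lambda>n. \<Prod>k<n. overlap a b k h)"
      by (rule decseq_SucI) (auto intro!: mult_left_le prod_nonneg overlap_range)
  qed
  define L where "L k = max 1 (b k - a k)" for k
  \<comment> \<open>The inverse standard deviation of coordinate \<open>k\<close>, so that
    \<open>w k * (s k)\<^sup>2 = 1\<close>; the condition \<open>t \<le> 1 / 4\<close> makes it at
    least 2, as the majorant requires.\<close>
  define s where "s k = real (Suc k) / sqrt t" for k
  define \<delta> where "\<delta> k = 1 / (s k * L k)" for k
  define c where "c k = (a k + b k) / 2" for k
  let ?G = "\<lambda>k h. 1 - \<delta> k * (1 - cos (s k * (h \<bullet> e k - c k)))"
  let ?E = "\<lambda>k. 1 - \<delta> k * (1 - exp (- (w k * (s k)\<^sup>2) / 2) * cos (s k * c k))"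
  have L1: "1 \<le> L k" for k by (simp add: L_def)
  have sqrt_t: "0 < sqrt t" "sqrt t \<le> 1 / 2"
    using t real_sqrt_le_mono[of t "1 / 4"] by (auto simp: real_sqrt_divide)
  have s2: "2 \<le> s k" for k
  proof -
    have "1 / (1 / 2) \<le> real (Suc k) / sqrt t" using sqrt_t by (intro frac_le) auto
    then show ?thesis by (simp add: s_def)
  qed
  have ws: "w k * (s k)\<^sup>2 = 1" for k
    using t by (simp add: w_def s_def power_divide)
  have sL: "2 \<le> s k * L k" for k
    using mult_mono[OF s2[of k] L1[of k]] s2[of k] by simp
  have \<delta>: "0 \<le> \<delta> k" "\<delta> k \<le> 1 / 2" for k
    using sL[of k] by (auto simp: \<delta>_def intro!: frac_le)
  have G_ge: "0 \<le> ?G k h" for k h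
  proof -
    have "0 \<le> 1 - cos (s k * (h \<bullet> e k - c k))" "1 - cos (s k * (h \<bullet> e k - c k)) \<le> 2"
      using cos_ge_minus_one[of "s k * (h \<bullet> e k - c k)"] by auto
    then have "\<delta> k * (1 - cos (s k * (h \<bullet> e k - c k))) \<le> 1 / 2 * 2"
      using \<delta>[of k] by (intro mult_mono) auto
    then show ?thesis by simp
  qed
  \<comment> \<open>Absolute measurability enters here: the heights lost to the majorants multiply
    to at most the exponential of its convergent series.\<close>
  obtain K where K: "0 < K" "\<And>n. (\<Prod>k<n. L k) \<le> K"
  proof
    show "0 < exp (\<Sum>k. max 0 (ln (b k - a k)))" by simp
    fix n
    have "(\<Prod>k<n. L k) = exp (\<Sum>k<n. max 0 (ln (b k - a k)))"
      unfolding exp_sum[OF finite_lessThan]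
    proof (intro prod.cong refl)
      fix k
      have pos: "0 < b k - a k" using proper_less[OF P] by simp
      show "L k = exp (max 0 (ln (b k - a k)))"
      proof (cases "1 \<le> b k - a k")
        case True
        then have "0 \<le> ln (b k - a k)" by simp
        then show ?thesis using True pos by (simp add: L_def max_absorb2)
      next
        case False
        then have "ln (b k - a k) \<le> 0" using pos by simp
        then show ?thesis using False by (simp add: L_def)
      qed
    qed
    also have "\<dots> \<le> exp (\<Sum>k. max 0 (ln (b k - a k)))"
      using P by (auto simp: proper_def intro!: sum_le_suminf)
    finally show "(\<Prod>k<n. L k) \<le> exp (\<Sum>k. max 0 (ln (b k - a k)))" .
  qed
  have R_le_G: "?R h \<le> K * (\<Prod>k<n. ?G k h)" for h n
  proof -
    have "?R h \<le> (\<Prod>k<n. overlap a b k h)" by (rule R_le)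
    also have "\<dots> \<le> (\<Prod>k<n. L k * ?G k h)"
    proof (intro prod_mono conjI overlap_range)
      fix k
      have "a k < b k" by (rule proper_less[OF P])
      from overlap_le_trig[of a k b "s k" h, OF this s2[of k]]
      show "overlap a b k h \<le> L k * ?G k h" by (simp add: L_def \<delta>_def c_def)
    qed
    also have "\<dots> = (\<Prod>k<n. L k) * (\<Prod>k<n. ?G k h)" by (rule prod.distrib)
    also have "\<dots> \<le> K * (\<Prod>k<n. ?G k h)"
      using K(2) G_ge by (intro mult_right_mono prod_nonneg) auto
    finally show ?thesis .
  qed
  have G_le: "?G k h \<le> 1" for k h
    using \<delta>(1)[of k] by simp
  have G_int: "integrable M (\<lambda>h. \<Prod>k<n. ?G k h)" for n
  proof (rule integrable_const_bound[where B = 1])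
    show "AE h in M. norm (\<Prod>k<n. ?G k h) \<le> 1"
      using G_ge G_le by (auto simp: abs_prod abs_of_nonneg intro!: prod_le_1)
  qed measurable
  have R_int: "integrable M ?R"
  proof (rule integrable_const_bound[where B = K])
    show "AE h in M. norm (?R h) \<le> K" using R0 R_le_G[of _ 0] by simp
  qed measurable
  have int_le: "(\<integral>h. ?R h \<partial>M) \<le> K * (\<Prod>k<n. ?E k)" for n
  proof -
    have "(\<integral>h. ?R h \<partial>M) \<le> (\<integral>h. K * (\<Prod>k<n. ?G k h) \<partial>M)"
      using R_le_G by (intro integral_mono R_int integrable_mult_right G_int) auto
    also have "\<dots> = K * (\<integral>h. (\<Prod>k<n. ?G k h) \<partial>M)" by simp
    also have "(\<integral>h. (\<Prod>k<n. ?G k h) \<partial>M) = (\<Prod>k<n. ?E k)"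
      by (rule integral_trig_product[OF w w0 M char])
    finally show ?thesis .
  qed
  \<comment> \<open>A uniform bound on the heights keeps \<open>\<delta> k\<close> at least a
    constant multiple of \<open>1 / (k + 1)\<close>.\<close>
  obtain B where B: "0 < B" "\<And>k. L k \<le> B"
  proof -
    obtain A' B' where AB: "\<And>j. \<bar>a j\<bar> \<le> A'" "\<And>j. \<bar>b j\<bar> \<le> B'"
      using P by (auto simp: proper_def block_bounds_def bounded_iff)
    have "L k \<le> max 1 (A' + B')" for k
      unfolding L_def using AB(1)[of k] AB(2)[of k] by linarith
    then show ?thesis by (intro that[of "max 1 (A' + B')"]) auto
  qed
  \<comment> \<open>With \<open>w k * (s k)\<^sup>2 = 1\<close> the Gaussian damping of the cosine
    is \<open>exp (- 1 / 2)\<close>; \<open>\<kappa>\<close> is the gain that remains for the worst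
    phase, hence for every position of the block.\<close>
  define \<kappa> :: real where "\<kappa> = 1 - exp (- 1 / 2)"
  have \<kappa>: "0 < \<kappa>" by (simp add: \<kappa>_def)
  have "(\<lambda>n. \<Prod>k<n. ?E k) \<longlonglongrightarrow> 0"
  proof (rule prod_one_minus_harmonic_tendsto_0)
    show "0 < \<kappa> * sqrt t / B" using \<kappa> sqrt_t B by simp
    fix k
    have e: "\<bar>exp (- 1 / 2) * cos (s k * c k)\<bar> \<le> exp (- 1 / 2 :: real)"
      unfolding abs_mult using mult_left_mono[OF abs_cos_le_one[of "s k * c k"], of "exp (- 1 / 2)"] by simp
    have e1: "exp (- 1 / 2 :: real) \<le> 1" by simp
    have "\<delta> k * (1 - exp (- 1 / 2) * cos (s k * c k)) \<le> 1 / 2 * 2"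
      using e e1 \<delta>[of k] by (intro mult_mono) linarith+
    then show "0 \<le> ?E k" by (simp add: ws)
    have "\<kappa> * sqrt t / B / real (Suc k) = \<kappa> * (1 / (s k * B))"
      using sqrt_t(1) by (simp add: s_def)
    also have "\<dots> \<le> \<kappa> * \<delta> k"
      unfolding \<delta>_def using \<kappa> s2[of k] L1[of k] B
      by (intro mult_left_mono frac_le mult_pos_pos) auto
    also have "\<dots> \<le> \<delta> k * (1 - exp (- 1 / 2) * cos (s k * c k))"
      unfolding mult.commute[of \<kappa>] using \<delta>(1)[of k] e by (intro mult_left_mono) (auto simp: \<kappa>_def)
    finally show "?E k \<le> 1 - \<kappa> * sqrt t / B / real (Suc k)" by (simp add: ws)
  qed
  then have "(\<lambda>n. K * (\<Prod>k<n. ?E k)) \<longlonglongrightarrow> K * 0" by (intro tendsto_mult tendsto_const)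
  then have "(\<integral>h. ?R h \<partial>M) \<le> K * 0"
    by (rule LIMSEQ_le_const) (use int_le in blast)
  moreover have "0 \<le> (\<integral>h. ?R h \<partial>M)" by (rule integral_nonneg_AE) (simp add: R0)
  ultimately have "(\<integral>h. ?R h \<partial>M) = 0" by simp
  then show "AE h in M. ?R h = 0"
    using integral_nonneg_eq_0_iff_AE[OF R_int] R0 by simp
qed

text \<open>Disjoint unions and proper differences turn into sums and differences of functions of
  \<open>h\<close>, which keep measurability and almost sure vanishing. Outer approximation then
  passes to the completion, uniformly in \<open>h\<close>.\<close>

lemma AE_lam_cube_completed:
  fixes M :: "'e measure"
  assumes block: "\<And>a b. proper a b \<Longrightarrow>
      (\<lambda>h. lam e (cube_at h \<inter> block e a b)) \<in> borel_measurable M \<and>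
      (AE h in M. lam e (cube_at h \<inter> block e a b) = 0)"
    and A: "A \<in> completed_ring e"
  shows "(\<lambda>h. lam e (cube_at h \<inter> A)) \<in> borel_measurable M \<and> (AE h in M. lam e (cube_at h \<inter> A) = 0)"
proof -
  have cr: "cube_at h \<in> completed_ring e" for h by (rule ring_completed[OF cube_at_ring])
  have ring: "(\<lambda>h. lam e (cube_at h \<inter> C)) \<in> borel_measurable M \<and> (AE h in M. lam e (cube_at h \<inter> C) = 0)"
    if "C \<in> block_ring e" for C
    using that unfolding block_ring_def
  proof (induction rule: ring_hull_disjoint_induct)
    case (Int A B)
    then show ?case by (rule am_blocks_Int)
  next
    case (basic C)
    then show ?case by (cases rule: am_blocks_cases) (auto simp: block)
  next
    case (union A B)
    then have AB: "A \<in> completed_ring e" "B \<in> completed_ring e"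
      by (auto intro: ring_completed simp: block_ring_def)
    have "lam e (cube_at h \<inter> (A \<union> B)) = lam e (cube_at h \<inter> A) + lam e (cube_at h \<inter> B)" for h
      unfolding Int_Un_distrib using AB cr union(3) by (intro L.content_Un L.Int) auto
    with union show ?case by auto
  next
    case (diff A B)
    then have AB: "A \<in> completed_ring e" "B \<in> completed_ring e"
      by (auto intro: ring_completed simp: block_ring_def)
    have "lam e (cube_at h \<inter> (A - B)) = lam e (cube_at h \<inter> A) - lam e (cube_at h \<inter> B)" for h
      unfolding Diff_Int_distrib using AB cr diff(3)
      by (intro L.content_Diff L.Int) auto
    with diff show ?case by auto
  qed simp
  have "\<exists>C. C \<in> block_ring e \<and> A \<subseteq> C \<and> lam e (C - A) \<le> inverse (real (Suc n))" for n
  proof -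
    have "0 < inverse (real (Suc n))" by simp
    with A[unfolded completed_ring_eq]
    obtain B C where BC: "B \<in> block_ring e" "C \<in> block_ring e" "B \<subseteq> A" "A \<subseteq> C"
      "block_measure e (C - B) < inverse (real (Suc n))"
      by (rule bm.jordanE)
    have "lam e (C - A) \<le> block_measure e (C - B)"
      unfolding lam_eq using BC by (intro bm.outer_le) auto
    then show ?thesis using BC by auto
  qed
  then obtain C where C: "\<And>n. C n \<in> block_ring e" "\<And>n. A \<subseteq> C n"
    "\<And>n. lam e (C n - A) \<le> inverse (real (Suc n))" by metis
  have Cc: "C n \<in> completed_ring e" for n by (rule ring_completed[OF C(1)])
  have nonneg: "0 \<le> lam e (cube_at h \<inter> A)" for h using cr A by (intro L.nonneg) auto
  have le: "lam e (cube_at h \<inter> A) \<le> lam e (cube_at h \<inter> C n)" for h n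
    using cr A Cc C(2) by (intro L.content_mono L.Int) auto
  have close: "lam e (cube_at h \<inter> C n) \<le> lam e (cube_at h \<inter> A) + inverse (real (Suc n))" for h n
  proof -
    have "lam e (cube_at h \<inter> C n) \<le> lam e ((cube_at h \<inter> A) \<union> (C n - A))"
      using cr A Cc[of n] by (intro L.content_mono) auto
    also have "\<dots> \<le> lam e (cube_at h \<inter> A) + lam e (C n - A)"
      using cr A Cc[of n] by (intro L.content_Un_le) auto
    finally show ?thesis using C(3)[of n] by linarith
  qed
  have lim: "(\<lambda>n. lam e (cube_at h \<inter> C n)) \<longlonglongrightarrow> lam e (cube_at h \<inter> A)" for h
  proof (rule tendsto_sandwich[OF always_eventually always_eventually tendsto_const])
    show "\<forall>n. lam e (cube_at h \<inter> A) \<le> lam e (cube_at h \<inter> C n)" using le by blast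
    show "\<forall>n. lam e (cube_at h \<inter> C n) \<le> lam e (cube_at h \<inter> A) + inverse (real (Suc n))" using close by blast
    show "(\<lambda>n. lam e (cube_at h \<inter> A) + inverse (real (Suc n))) \<longlonglongrightarrow> lam e (cube_at h \<inter> A)"
      using tendsto_add[OF tendsto_const LIMSEQ_inverse_real_of_nat] by simp
  qed
  show ?thesis
  proof
    show "(\<lambda>h. lam e (cube_at h \<inter> A)) \<in> borel_measurable M"
      using ring[OF C(1)] by (intro borel_measurable_LIMSEQ_metric[OF _ lim]) blast
    \<comment> \<open>For vanishing, monotonicity and a single superset from the block ring are
      enough; the limit served measurability.\<close>
    have "AE h in M. lam e (cube_at h \<inter> C 0) = 0" using ring[OF C(1)] by blast
    then show "AE h in M. lam e (cube_at h \<inter> A) = 0"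
      by eventually_elim (use le[of _ 0] nonneg in \<open>metis antisym\<close>)
  qed
qed

section \<open>The cube vector and its Gaussian average\<close>

lemma shift_op_cls:
  assumes X: "X \<in> cauchy_seqs e"
  shows "shift_op e h (cls e X) = cls e (\<lambda>n x. X n (x - h))"
proof -
  have shift_cauchy: "(\<lambda>n x. Y n (x - h)) \<in> cauchy_seqs e" if Y: "Y \<in> cauchy_seqs e" for Y
  proof -
    have "snorm e (\<lambda>x. Y m (x - h) - Y n (x - h)) = snorm e (\<lambda>x. Y m x - Y n x)" for m n
      using snorm_shift[OF simple_diff[OF cauchy_seqs_simple[OF Y] cauchy_seqs_simple[OF Y]]] by simp
    then show ?thesis
      using Y by (auto simp: cauchy_seqs_def intro: simple_shift)
  qed
  let ?X = "rep (cls e X)"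
  have c: "?X \<in> cauchy_seqs e" by (rule rep_cauchy[OF X])
  have "snorm e (\<lambda>x. X n (x - h) - ?X n (x - h)) = snorm e (\<lambda>x. X n x - ?X n x)" for n
    using snorm_shift[OF simple_diff[OF cauchy_seqs_simple[OF X] cauchy_seqs_simple[OF c]]] by simp
  then have "((\<lambda>n x. X n (x - h)), (\<lambda>n x. ?X n (x - h))) \<in> seq_equiv e"
    using rep_cls[OF X] shift_cauchy[OF X] shift_cauchy[OF c] by (simp add: seq_equiv_iff)
  then show ?thesis
    unfolding shift_op_def using cls_eq_iff[OF shift_cauchy[OF X] shift_cauchy[OF c]] by simp
qed

definition cube_vec :: "'e hvec" where
  "cube_vec = cls e (\<lambda>n. indicator cube0)"

lemma cube0_completed: "cube0 \<in> completed_ring e"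
  unfolding cube0_def by (rule ring_completed[OF proper_block_ring[OF proper_cube0]])

lemma cube_vec_cauchy: "(\<lambda>n. indicator cube0) \<in> cauchy_seqs e"
  by (rule const_cauchy_seqs[OF simple_indicator[OF cube0_completed]])

lemma cube_vec_in_hspace: "cube_vec \<in> hspace e"
  unfolding cube_vec_def by (rule cls_in_hspace[OF cube_vec_cauchy])

lemma range_indicator_minus_0:
  "A \<noteq> {} \<Longrightarrow> range (indicator A :: 'b \<Rightarrow> complex) - {0} = {1}"
  by (auto simp: indicator_def image_iff)

lemma vimage_indicator_1: "(indicator A :: 'b \<Rightarrow> complex) -` {1} = A"
  by (auto simp: indicator_def split: if_splits)

lemma cube_vec_nonzero: "cube_vec \<noteq> cls e (\<lambda>n x. 0)"
proof
  assume "cube_vec = cls e (\<lambda>n x. 0)"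
  then have "(\<lambda>n. snorm e (indicator cube0)) \<longlonglongrightarrow> 0"
    unfolding cube_vec_def using cls_eq_zero_iff[OF cube_vec_cauchy] by simp
  then have "snorm e (indicator cube0) = 0" by (simp add: LIMSEQ_const_iff)
  moreover have "lam e cube0 = 1"
  proof -
    have "lam e cube0 = vol (\<lambda>_. - 1 / 2) (\<lambda>_. 1 / 2)"
      unfolding cube0_def
      by (simp only: lam_eq bm.outer_eq[OF proper_block_ring[OF proper_cube0]] block_measure_block[OF proper_cube0])
    also have "\<dots> = 1" by (simp add: vol_def)
    finally show ?thesis .
  qed
  moreover have "cube0 \<noteq> {}" using proper_cube0 by (simp add: proper_def cube0_def)
  ultimately show False
    by (simp add: snorm_def range_indicator_minus_0 vimage_indicator_1)
qed

lemma shift_cube_vec: "shift_op e h cube_vec = cls e (\<lambda>n. indicator (cube_at h))"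
proof -
  have "indicator cube0 (x - h) = (indicator (cube_at h) x :: complex)" for x
  proof -
    have "x - h \<in> cube0 \<longleftrightarrow> x \<in> cube_at h"
      unfolding cube_at_def by (metis (no_types, lifting) add_diff_cancel diff_add_cancel image_iff)
    then show ?thesis by (simp add: indicator_def)
  qed
  then show ?thesis
    unfolding cube_vec_def shift_op_cls[OF cube_vec_cauchy] by simp
qed

text \<open>A vector is given by countably many simple functions with finitely many level sets each,
  so countably many null events of shifts are discarded; outside them every approximating inner
  product is 0.\<close>

lemma AE_hinner_shift_cube_vec:
  fixes M :: "'e measure"
  assumes null: "\<And>A. A \<in> completed_ring e \<Longrightarrow>
      (\<lambda>h. lam e (cube_at h \<inter> A)) \<in> borel_measurable M \<and> (AE h in M. lam e (cube_at h \<inter> A) = 0)"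
    and \<phi>: "\<phi> \<in> hspace e"
  shows "(\<lambda>h. hinner e (shift_op e h cube_vec) \<phi>) \<in> borel_measurable M"
    and "AE h in M. hinner e (shift_op e h cube_vec) \<phi> = 0"
proof -
  obtain Y where Y: "Y \<in> cauchy_seqs e" "\<phi> = cls e Y" using \<phi> by (rule hspaceE)
  have Ys: "simple_on (completed_ring e) (Y n)" for n
    using cauchy_seqs_simple[OF Y(1)] by (simp add: simple_functions_iff)
  have ne: "cube_at h \<noteq> {}" for h
    using proper_cube_at[of h] by (simp add: proper_def cube_at_eq)
  have s: "sinner e (indicator (cube_at h)) (Y n) =
      (\<Sum>v\<in>range (Y n) - {0}. cnj v * complex_of_real (lam e (cube_at h \<inter> Y n -` {v})))" for h n
    by (simp add: sinner_def range_indicator_minus_0[OF ne] vimage_indicator_1)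
  have lim: "(\<lambda>n. sinner e (indicator (cube_at h)) (Y n)) \<longlonglongrightarrow> hinner e (shift_op e h cube_vec) \<phi>" for h
    unfolding shift_cube_vec Y(2)
    by (intro hinner_cls const_cauchy_seqs simple_indicator ring_completed cube_at_ring Y(1))
  have lev: "Y n -` {v} \<in> completed_ring e" if "v \<in> range (Y n) - {0}" for n v
    using Ys[of n] that by (simp add: simple_on_def)
  show "(\<lambda>h. hinner e (shift_op e h cube_vec) \<phi>) \<in> borel_measurable M"
  proof (rule borel_measurable_LIMSEQ_metric[OF _ lim])
    show "(\<lambda>h. sinner e (indicator (cube_at h)) (Y n)) \<in> borel_measurable M" for n
      unfolding s
    proof (rule borel_measurable_sum)
      fix v assume "v \<in> range (Y n) - {0}"
      then have [measurable]: "(\<lambda>h. lam e (cube_at h \<inter> Y n -` {v})) \<in> borel_measurable M"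
        using null[OF lev] by blast
      show "(\<lambda>h. cnj v * complex_of_real (lam e (cube_at h \<inter> Y n -` {v}))) \<in> borel_measurable M"
        by measurable
    qed
  qed
  have "AE h in M. \<forall>v\<in>range (Y n) - {0}. lam e (cube_at h \<inter> Y n -` {v}) = 0" for n
    using Ys[of n] null[OF lev] by (intro AE_finite_allI) (auto simp: simple_on_def)
  then have "AE h in M. \<forall>n. \<forall>v\<in>range (Y n) - {0}. lam e (cube_at h \<inter> Y n -` {v}) = 0"
    by (simp add: AE_all_countable)
  then show "AE h in M. hinner e (shift_op e h cube_vec) \<phi> = 0"
  proof eventually_elim
    case (elim h)
    then have "sinner e (indicator (cube_at h)) (Y n) = 0" for n by (simp add: s)
    with lim[of h] show ?case by (simp add: LIMSEQ_const_iff)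
  qed
qed

lemma hinner_zero_left:
  assumes "\<phi> \<in> hspace e"
  shows "hinner e (cls e (\<lambda>n x. 0)) \<phi> = 0"
proof -
  obtain Y where Y: "Y \<in> cauchy_seqs e" "\<phi> = cls e Y" using assms by (rule hspaceE)
  have "(\<lambda>n. sinner e (\<lambda>x. 0) (Y n)) \<longlonglongrightarrow> hinner e (cls e (\<lambda>n x. 0)) \<phi>"
    unfolding Y(2) by (rule hinner_cls[OF const_cauchy_seqs[OF simple_zero] Y(1)])
  then show ?thesis by (simp add: sinner_def LIMSEQ_const_iff)
qed

text \<open>Summable, as nuclearity demands, with the non-summable square roots
  \<open>1 / (k + 1)\<close>.\<close>

definition inv_sq :: "nat \<Rightarrow> real" where
  "inv_sq = (\<lambda>k. 1 / (real (Suc k))\<^sup>2)"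

lemma summable_inv_sq: "summable inv_sq"
proof -
  have "summable (\<lambda>n. inverse ((real n)\<^sup>2))" by (rule inverse_power_summable) simp
  then have "summable (\<lambda>n. inverse ((real (Suc n))\<^sup>2))"
    by (rule summable_Suc_iff[THEN iffD2])
  then show ?thesis by (simp add: inv_sq_def inverse_eq_divide)
qed

lemma inv_sq_nonneg: "0 \<le> inv_sq k"
  by (simp add: inv_sq_def)

lemma U_op_cube_vec:
  assumes t: "0 < t" "t \<le> 1 / 4"
  shows "U_op e (diag inv_sq) t cube_vec = cls e (\<lambda>n x. 0)"
proof -
  let ?M = "gaussian (\<lambda>x. t *\<^sub>R diag inv_sq x)"
  note M = gaussian_diag[OF summable_inv_sq inv_sq_nonneg less_imp_le[OF t(1)]]
  have "summable (\<lambda>k. t * inv_sq k)" by (intro summable_mult summable_inv_sq)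
  then have "(\<lambda>h. lam e (cube_at h \<inter> block e a b)) \<in> borel_measurable ?M \<and>
      (AE h in ?M. lam e (cube_at h \<inter> block e a b) = 0)" if "proper a b" for a b
    using AE_lam_cube_block[OF t, of ?M] M that unfolding inv_sq_def by blast
  then have null: "(\<lambda>h. lam e (cube_at h \<inter> A)) \<in> borel_measurable ?M \<and> (AE h in ?M. lam e (cube_at h \<inter> A) = 0)"
    if "A \<in> completed_ring e" for A
    using that by (rule AE_lam_cube_completed)
  have int: "integrable ?M (\<lambda>h. hinner e (shift_op e h cube_vec) \<phi>)"
    "(\<integral>h. hinner e (shift_op e h cube_vec) \<phi> \<partial>?M) = 0" if "\<phi> \<in> hspace e" for \<phi>
  proof -
    have m: "(\<lambda>h. hinner e (shift_op e h cube_vec) \<phi>) \<in> borel_measurable ?M"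
      and z: "AE h in ?M. hinner e (shift_op e h cube_vec) \<phi> = 0"
      by (intro AE_hinner_shift_cube_vec null that; assumption)+
    show "integrable ?M (\<lambda>h. hinner e (shift_op e h cube_vec) \<phi>)"
      using integrable_cong_AE[OF m _ z] by simp
    show "(\<integral>h. hinner e (shift_op e h cube_vec) \<phi> \<partial>?M) = 0"
      using integral_cong_AE[OF m _ z] by simp
  qed
  show ?thesis
    unfolding U_op_def
  proof (rule the_equality)
    show "has_pettis_integral e ?M (\<lambda>h. shift_op e h cube_vec) (cls e (\<lambda>n x. 0))"
      unfolding has_pettis_integral_def using int hinner_zero_left cls_zero_in_hspace by simp
  next
    fix g assume g: "has_pettis_integral e ?M (\<lambda>h. shift_op e h cube_vec) g"
    then have gh: "g \<in> hspace e" by (simp add: has_pettis_integral_def)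
    \<comment> \<open>Any weak integral is orthogonal to all vectors, in particular to
      itself.\<close>
    with g int(2) have "hinner e g g = 0" by (simp add: has_pettis_integral_def)
    moreover obtain X where "X \<in> cauchy_seqs e" "g = cls e X" using gh by (rule hspaceE)
    ultimately show "g = cls e (\<lambda>n x. 0)" using hinner_self_cls by simp
  qed
qed

end

theorem theorem7p1:
  fixes e :: "nat \<Rightarrow> 'e::{real_inner, polish_space}"
  assumes "orthonormal_basis e"
  shows "\<not> (\<exists>F. unitary_on_hspace e F \<and>
           (\<forall>D. nuclear D \<longrightarrow> nonneg_operator D \<longrightarrow> eigenbasis e D \<longrightarrow>
              (\<forall>t\<ge>0. \<forall>f\<in>hspace e.
                 U_op e D t f = F (U_hat_op e D t (inv_into (hspace e) F f)))))"
proof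
  interpret orthonormal_seq e
    using assms by unfold_locales (simp add: orthonormal_basis_def)
  assume "\<exists>F. unitary_on_hspace e F \<and>
           (\<forall>D. nuclear D \<longrightarrow> nonneg_operator D \<longrightarrow> eigenbasis e D \<longrightarrow>
              (\<forall>t\<ge>0. \<forall>f\<in>hspace e.
                 U_op e D t f = F (U_hat_op e D t (inv_into (hspace e) F f))))"
  then obtain F where F: "unitary_on_hspace e F"
    and eq: "\<And>D t f. nuclear D \<Longrightarrow> nonneg_operator D \<Longrightarrow> eigenbasis e D \<Longrightarrow> 0 \<le> t \<Longrightarrow> f \<in> hspace e \<Longrightarrow>
      U_op e D t f = F (U_hat_op e D t (inv_into (hspace e) F f))"
    by blast
  let ?D = "diag inv_sq" and ?z = "cls e (\<lambda>n x. 0)"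
  note d = summable_inv_sq inv_sq_nonneg
  have bij: "bij_betw F (hspace e) (hspace e)" using F by (simp add: unitary_on_hspace_def)
  \<comment> \<open>Homogeneity with scalar 0 shows that \<open>F\<close> fixes the zero
    vector.\<close>
  have "F (hscale e 0 cube_vec) = hscale e 0 (F cube_vec)"
    using F cube_vec_in_hspace unfolding unitary_on_hspace_def by blast
  then have F0: "F ?z = ?z" by (simp add: hscale_0)
  \<comment> \<open>The equivalence, evaluated at the cube vector, lets the multiplication semigroup
    act on this preimage.\<close>
  define w where "w = inv_into (hspace e) F cube_vec"
  have "cube_vec \<in> F ` hspace e" using bij cube_vec_in_hspace by (simp add: bij_betw_def)
  then have w: "w \<in> hspace e" "F w = cube_vec"
    unfolding w_def by (rule inv_into_into, rule f_inv_into_f)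
  obtain X where X: "X \<in> cauchy_seqs e" "w = cls e X" using w(1) by (rule hspaceE)
  have diag_e: "?D (e k) \<bullet> e k = inv_sq k" for k by (simp add: diag_basis[OF d] orth)
  have eb: "eigenbasis e ?D" unfolding eigenbasis_def by (blast intro: diag_basis[OF d])
  have "mult_op e (\<lambda>x. exp (- (t / 2 * quad inv_sq x))) (cls e X) = ?z" if t: "0 < t" "t \<le> 1 / 4" for t
  proof -
    let ?v = "mult_op e (\<lambda>x. exp (- (t / 2 * quad inv_sq x))) w"
    have "U_hat_op e ?D t w = ?v"
      using U_hat_op_eq[of ?D t w] t w(1) d by (simp add: diag_e)
    then have "F ?v = ?z"
      using eq[OF nuclear_diag[OF d] nonneg_operator_diag[OF d] eb, of t cube_vec] U_op_cube_vec[OF t]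
        t cube_vec_in_hspace by (simp add: w_def)
    moreover have "?v \<in> hspace e"
      using t w(1) by (intro mult_op_in_hspace multiplier_gauss[OF d]) auto
    \<comment> \<open>\<open>F\<close> maps both vectors to zero and is injective; hence
      multiplication annihilates \<open>w\<close> for all these \<open>t\<close>, against its strong
      continuity at 0 unless \<open>w\<close> vanishes.\<close>
    ultimately have "?v = ?z"
      using bij F0 cls_zero_in_hspace by (metis bij_betw_imp_inj_on inj_onD)
    then show ?thesis by (simp add: X(2))
  qed
  then have "w = ?z"
    unfolding X(2) by (intro gauss_mult_eq_0_imp[OF d _ X(1), of "1 / 4"]) auto
  then show False using w(2) F0 cube_vec_nonzero by simp
qed

end
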